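(* Let $p\in\mathbb{N}$ and let $G$ be an undirected graph with vertex set $\{1,\ldots,p\}$ and edge set $E$, and let $q$ be its number of absent edges. Use the notation of the context. Let $(\hat V_n)_{n\in\mathbb{N}}$ be a sequence of random symmetric $p\times p$ matrices such that $\sqrt n\,\mathrm{vec}(\hat V_n-V)$ converges in distribution to an $\mathbb{R}^{p^2}$-valued random vector $Z$ for some fixed matrix $V\in\mathscr{S}^+_p$. (I) Then $\sqrt n\,\mathrm{vec}\{h_G(\hat V_n)-h_G(V)\}\to\mathds{D}h_G(V)Z$ in distribution. (II) If additionally $Z$ is normal with mean zero and covariance matrix $$W_V=2\sigma_1M_p(V\otimes V)+\sigma_2\,\mathrm{vec}V(\mathrm{vec}V)^T$$ for some scalars $\sigma_1\ge0$ and $\sigma_2\ge-2\sigma_1/p$, then $\mathds{D}h_G(V)Z$ is $p^2$-variate normal with mean zero and covariance matrix $$W_{V,G}=2\sigma_1\,\mathds{D}h_G(V)(V\otimes V)\{\mathds{D}h_G(V)\}^T+\sigma_2\,\mathrm{vec}V_G(\mathrm{vec}V_G)^T,$$ where $V_G$ denotes $h_G(V)$. (III) If the assumptions of part (II) hold and $V^{-1}\in\mathscr{S}^+_p(G)$, i.e. $V=h_G(V)$, then $W_{V,G}$ reduces to $$W_{V,G}=2\sigma_1M_p\left[V\otimes V-Q_D^T\left\{Q_DM_p(V^{-1}\otimes V^{-1})Q_D^T\right\}^{-1}Q_DM_p\right]+\sigma_2\,\mathrm{vec}V(\mathrm{vec}V)^T.$$ (IV) Letting $u=Q_K\mathrm{vec}(V^{-1})$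 and $\hat u_G=Q_K\mathrm{vec}\{h_G(\hat V_n)^{-1}\}$, we have under the assumptions of part (III) that $\sqrt n(\hat u_G-u)\to N_{m-q}(0,W_{u,G})$ in distribution with $$W_{u,G}=2\sigma_1\left\{\tilde Q_KD_p^T(V\otimes V)D_p\tilde Q_K^T\right\}^{-1}+\sigma_2uu^T.$$
   Context: Matrix sets: $\mathscr{S}_p$ is the set of symmetric real $p\times p$ matrices, $\mathscr{S}^+_p$ the set of symmetric positive definite ones, and $\mathscr{S}^+_p(G)=\{A\in\mathscr{S}^+_p: A_{i,j}=0 \text{ whenever } i\ne j,\ \{i,j\}\notin E\}$. Graphs are undirected without loops. The map $h_G:\mathscr{S}^+_p\to\mathscr{S}^+_p$: for $A\in\mathscr{S}^+_p$, $A_G=h_G(A)$ is the unique matrix in $\mathscr{S}^+_p$ satisfying $(A_G)_{i,j}=A_{i,j}$ if $\{i,j\}\in E$ or $i=j$, and $(A_G^{-1})_{i,j}=0$ if $\{i,j\}\notin E$ and $i\neq j$. (Existence and uniqueness are known.) Since $V\in\mathscr{S}^+_p$, the matrix $\hat V_n$ is positive definite with probability tending to one; $h_G(\hat V_n)$ may be defined arbitrarily (measurably, with values in $\mathscr{S}^+_p$) otherwise. Matrix notation: $\otimes$ is the Kronecker product; $\mathrm{vec}\,A\in\mathbb{R}^{p^2}$ stacks the columns of $A\in\mathbb{R}^{p\times p}$ from left to right underneath each other. $e_1,\dots,e_p$ are the unit vectors in $\mathbb{R}^p$, $K_p=\sum_{i,j=1}^p e_ie_j^T\otimes e_je_i^T$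 and $M_p=\frac12(I_{p^2}+K_p)$. Let $m=p(p+1)/2$. For $A\in\mathscr{S}_p$, $v(A)\in\mathbb{R}^m$ is obtained from $\mathrm{vec}\,A$ by deleting the super-diagonal elements of $A$; $D_p\in\mathbb{R}^{p^2\times m}$ (duplication matrix) is the matrix with $D_pv(A)=\mathrm{vec}\,A$ for all $A\in\mathscr{S}_p$, and $D_p^+=(D_p^TD_p)^{-1}D_p^T$. Selection matrices: for a set $Y=\{z_1,\dots,z_r\}$ of matrix positions $z_k=(i_k,j_k)\in\{1,\dots,p\}^2$, listed in the order in which these positions appear in $\mathrm{vec}$ (column by column), $Q_Y\in\mathbb{R}^{r\times p^2}$ is the matrix whose $k$-th row has entry $1$ in column $(j_k-1)p+i_k$ and zeros otherwise. Let $D(G)=\{(i,j): 1\le j<i\le p,\ \{i,j\}\notin E\}$ (which has $q$ elements) and $K(G)=\{(i,j):1\le j<i\le p,\ \{i,j\}\in E\}\cup\{(i,i):1\le i\le p\}$ (which has $m-q$ elements). Write $Q_D=Q_{D(G)}$, $Q_K=Q_{K(G)}$ and $\tilde Q_K=Q_KD_p$. If $q=0$, $Q_D$ has no rows and terms containing it are zero. Derivative: let $\tilde h_G$ be the function on $v(\mathscr{S}^+_p)$ (an open subset of $\mathbb{R}^m$) mapping $v(A)$ to $v(h_G(A))$. The derivative of $h_G$ at $A\in\mathscr{S}^+_p$ is the $p^2\times p^2$ matrix $\mathds{D}h_G(A)=D_p\,\mathds{D}\tilde h_G(v(A))\,D_p^+$, where $\mathds{D}\tilde h_G$ is the Jacobi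 matrix. It is given explicitly by $$\mathds{D}h_G(A)=M_p-M_pQ_D^T\left\{Q_DM_p(A_G^{-1}\otimes A_G^{-1})Q_D^T\right\}^{-1}Q_D(A_G^{-1}\otimes A_G^{-1})M_p.$$ *)

theory Defs
  imports "HOL-Probability.Probability" "Jordan_Normal_Form.Gauss_Jordan_Elimination"
begin

unbundle no vec_syntax and no inner_syntax
hide_const (open) Finite_Cartesian_Product.vec Finite_Cartesian_Product.mat
hide_type (open) Finite_Cartesian_Product.vec

text \<open>
  Rows, columns and vertices are numbered from 0: the vertex set is \<open>{0..<p}\<close>, and an edge is a
  two-element set of vertices.
\<close>

definition simple_graph :: "nat \<Rightarrow> nat set set \<Rightarrow> bool" where
  "simple_graph p E \<longleftrightarrow> E \<subseteq> {{i, j} | i j. i < p \<and> j < p \<and> i \<noteq> j}"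


subsection \<open>Symmetric and positive definite matrices\<close>

definition sym_mats :: "nat \<Rightarrow> real mat set" where
  "sym_mats p = {A \<in> carrier_mat p p. A\<^sup>T = A}"

definition pd_mats :: "nat \<Rightarrow> real mat set" where
  "pd_mats p = {A \<in> sym_mats p. \<forall>x\<in>carrier_vec p. x \<noteq> 0\<^sub>v p \<longrightarrow> x \<bullet> (A *\<^sub>v x) > 0}"

definition pd_mats_graph :: "nat \<Rightarrow> nat set set \<Rightarrow> real mat set" where
  "pd_mats_graph p E =
     {A \<in> pd_mats p. \<forall>i<p. \<forall>j<p. i \<noteq> j \<and> {i, j} \<notin> E \<longrightarrow> A $$ (i, j) = 0}"

text \<open>The inverse of a square matrix; unspecified if the matrix is singular.\<close>

definition minv :: "real mat \<Rightarrow> real mat" where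
  "minv A = the (mat_inverse A)"

text \<open>The map \<open>h_G\<close>; only meaningful for positive definite \<open>A\<close>.\<close>

definition hG :: "nat \<Rightarrow> nat set set \<Rightarrow> real mat \<Rightarrow> real mat" where
  "hG p E A = (THE B. B \<in> pd_mats p \<and>
     (\<forall>i<p. \<forall>j<p. {i, j} \<in> E \<or> i = j \<longrightarrow> B $$ (i, j) = A $$ (i, j)) \<and>
     (\<forall>i<p. \<forall>j<p. {i, j} \<notin> E \<and> i \<noteq> j \<longrightarrow> minv B $$ (i, j) = 0))"


subsection \<open>Matrix notation\<close>

definition outer_prod :: "real vec \<Rightarrow> real vec \<Rightarrow> real mat" where
  "outer_prod x y = mat (dim_vec x) (dim_vec y) (\<lambda>(i, j). x $ i * y $ j)"

definition kron :: "real mat \<Rightarrow> real mat \<Rightarrow> real mat" where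
  "kron A B = mat (dim_row A * dim_row B) (dim_col A * dim_col B)
     (\<lambda>(r, c). A $$ (r div dim_row B, c div dim_col B) * B $$ (r mod dim_row B, c mod dim_col B))"

text \<open>Column stacking: entry \<open>(i, j)\<close> goes to position \<open>j * dim_row A + i\<close>.\<close>

definition vec_op :: "real mat \<Rightarrow> real vec" where
  "vec_op A = vec (dim_row A * dim_col A) (\<lambda>k. A $$ (k mod dim_row A, k div dim_row A))"

text \<open>
  \<open>K_p\<close> is the sum of \<open>e_i e_j\<^sup>T \<otimes> e_j e_i\<^sup>T\<close> over all \<open>i, j\<close>, taken entrywise because the type of
  matrices of all sizes has no zero element for \<open>sum\<close>.
\<close>

definition K_mat :: "nat \<Rightarrow> real mat" where
  "K_mat p = mat (p * p) (p * p) (\<lambda>(r, c). \<Sum>i<p. \<Sum>j<p.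
     kron (outer_prod (unit_vec p i) (unit_vec p j)) (outer_prod (unit_vec p j) (unit_vec p i)) $$ (r, c))"

definition M_mat :: "nat \<Rightarrow> real mat" where
  "M_mat p = (1 / 2) \<cdot>\<^sub>m (1\<^sub>m (p * p) + K_mat p)"

text \<open>The positions in \<open>Y\<close> of a \<open>p \<times> p\<close> matrix, listed column by column.\<close>

definition positions :: "nat \<Rightarrow> (nat \<times> nat) set \<Rightarrow> (nat \<times> nat) list" where
  "positions p Y = filter (\<lambda>z. z \<in> Y) [(i, j). j \<leftarrow> [0..<p], i \<leftarrow> [0..<p]]"

definition half_dim :: "nat \<Rightarrow> nat" where
  "half_dim p = p * (p + 1) div 2"

text \<open>The half-vectorization \<open>v\<close>.\<close>

definition vech :: "nat \<Rightarrow> real mat \<Rightarrow> real vec" where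
  "vech p A = vec_of_list (map (\<lambda>z. A $$ z) (positions p {(i, j). j \<le> i}))"

definition unvech :: "nat \<Rightarrow> real vec \<Rightarrow> real mat" where
  "unvech p x = (THE A. A \<in> sym_mats p \<and> vech p A = x)"

definition dup_mat :: "nat \<Rightarrow> real mat" where
  "dup_mat p = (THE D. D \<in> carrier_mat (p * p) (half_dim p) \<and>
     (\<forall>A\<in>sym_mats p. D *\<^sub>v vech p A = vec_op A))"

definition dup_pinv :: "nat \<Rightarrow> real mat" where
  "dup_pinv p = minv ((dup_mat p)\<^sup>T * dup_mat p) * (dup_mat p)\<^sup>T"

definition sel_mat :: "nat \<Rightarrow> (nat \<times> nat) set \<Rightarrow> real mat" where
  "sel_mat p Y = mat (length (positions p Y)) (p * p)
     (\<lambda>(k, c). case positions p Y ! k of (i, j) \<Rightarrow> if c = j * p + i then 1 else 0)"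

definition D_set :: "nat \<Rightarrow> nat set set \<Rightarrow> (nat \<times> nat) set" where
  "D_set p E = {(i, j). j < i \<and> i < p \<and> {i, j} \<notin> E}"

definition K_set :: "nat \<Rightarrow> nat set set \<Rightarrow> (nat \<times> nat) set" where
  "K_set p E = {(i, j). j < i \<and> i < p \<and> {i, j} \<in> E} \<union> {(i, i) | i. i < p}"

definition num_absent :: "nat \<Rightarrow> nat set set \<Rightarrow> nat" where
  "num_absent p E = card (D_set p E)"

definition QD :: "nat \<Rightarrow> nat set set \<Rightarrow> real mat" where
  "QD p E = sel_mat p (D_set p E)"

definition QK :: "nat \<Rightarrow> nat set set \<Rightarrow> real mat" where
  "QK p E = sel_mat p (K_set p E)"

definition QK_tilde :: "nat \<Rightarrow> nat set set \<Rightarrow> real mat" where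
  "QK_tilde p E = QK p E * dup_mat p"


subsection \<open>The derivative of the map\<close>

text \<open>The \<open>k \<times> m\<close> matrix of partial derivatives at \<open>x\<close> of a map from \<open>m\<close>- to \<open>k\<close>-vectors.\<close>

definition jacobi :: "nat \<Rightarrow> nat \<Rightarrow> (real vec \<Rightarrow> real vec) \<Rightarrow> real vec \<Rightarrow> real mat" where
  "jacobi k m f x = mat k m (\<lambda>(i, j). deriv (\<lambda>t. f (x + t \<cdot>\<^sub>v unit_vec m j) $ i) 0)"

definition hG_tilde :: "nat \<Rightarrow> nat set set \<Rightarrow> real vec \<Rightarrow> real vec" where
  "hG_tilde p E x = vech p (hG p E (unvech p x))"

definition DhG :: "nat \<Rightarrow> nat set set \<Rightarrow> real mat \<Rightarrow> real mat" where
  "DhG p E A =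
     dup_mat p * jacobi (half_dim p) (half_dim p) (hG_tilde p E) (vech p A) * dup_pinv p"


subsection \<open>Random vectors and matrices\<close>

definition rand_vec :: "'a measure \<Rightarrow> nat \<Rightarrow> ('a \<Rightarrow> real vec) \<Rightarrow> bool" where
  "rand_vec M d X \<longleftrightarrow> (\<forall>\<omega>\<in>space M. X \<omega> \<in> carrier_vec d) \<and>
     (\<forall>i<d. (\<lambda>\<omega>. X \<omega> $ i) \<in> borel_measurable M)"

definition rand_mat :: "'a measure \<Rightarrow> nat \<Rightarrow> ('a \<Rightarrow> real mat) \<Rightarrow> bool" where
  "rand_mat M p X \<longleftrightarrow> (\<forall>\<omega>\<in>space M. X \<omega> \<in> carrier_mat p p) \<and>
     (\<forall>i<p. \<forall>j<p. (\<lambda>\<omega>. X \<omega> $$ (i, j)) \<in> borel_measurable M)"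

text \<open>Identifies \<open>d\<close>-vectors with points of the topological space \<open>Euclidean_space d\<close>.\<close>

definition vec_point :: "real vec \<Rightarrow> nat \<Rightarrow> real" where
  "vec_point x = (\<lambda>i. if i < dim_vec x then x $ i else 0)"

text \<open>Convergence in distribution of \<open>d\<close>-dimensional random vectors.\<close>

definition conv_distr ::
  "nat \<Rightarrow> 'a measure \<Rightarrow> (nat \<Rightarrow> 'a \<Rightarrow> real vec) \<Rightarrow> 'b measure \<Rightarrow> ('b \<Rightarrow> real vec) \<Rightarrow> bool" where
  "conv_distr d M X N Z \<longleftrightarrow> (\<forall>n. rand_vec M d (X n)) \<and> rand_vec N d Z \<and>
     (\<forall>f. continuous_map (Euclidean_space d) euclideanreal f \<and>
          bounded (f ` topspace (Euclidean_space d)) \<longrightarrow>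
        (\<lambda>n. \<integral>\<omega>. f (vec_point (X n \<omega>)) \<partial>M) \<longlonglongrightarrow> (\<integral>\<omega>. f (vec_point (Z \<omega>)) \<partial>N))"

text \<open>
  Normal laws may be degenerate. In several dimensions, \<open>Z\<close> is normal if all its linear
  combinations are univariate normal.
\<close>

definition normal_rv :: "'a measure \<Rightarrow> ('a \<Rightarrow> real) \<Rightarrow> real \<Rightarrow> real \<Rightarrow> bool" where
  "normal_rv M X \<mu> v \<longleftrightarrow>
     (v > 0 \<and> distributed M lborel X (normal_density \<mu> (sqrt v))) \<or>
     (v = 0 \<and> X \<in> borel_measurable M \<and> (AE \<omega> in M. X \<omega> = \<mu>))"

definition mv_normal ::
  "'a measure \<Rightarrow> nat \<Rightarrow> ('a \<Rightarrow> real vec) \<Rightarrow> real vec \<Rightarrow> real mat \<Rightarrow> bool" where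
  "mv_normal M d Z \<mu> W \<longleftrightarrow> rand_vec M d Z \<and> \<mu> \<in> carrier_vec d \<and> W \<in> sym_mats d \<and>
     (\<forall>a\<in>carrier_vec d. normal_rv M (\<lambda>\<omega>. a \<bullet> Z \<omega>) (a \<bullet> \<mu>) (a \<bullet> (W *\<^sub>v a)))"


subsection \<open>Asymptotic covariance matrices\<close>

definition W_V :: "nat \<Rightarrow> real \<Rightarrow> real \<Rightarrow> real mat \<Rightarrow> real mat" where
  "W_V p \<sigma>1 \<sigma>2 V = (2 * \<sigma>1) \<cdot>\<^sub>m (M_mat p * kron V V) + \<sigma>2 \<cdot>\<^sub>m outer_prod (vec_op V) (vec_op V)"

definition W_VG :: "nat \<Rightarrow> nat set set \<Rightarrow> real \<Rightarrow> real \<Rightarrow> real mat \<Rightarrow> real mat" where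
  "W_VG p E \<sigma>1 \<sigma>2 V = (2 * \<sigma>1) \<cdot>\<^sub>m (DhG p E V * kron V V * (DhG p E V)\<^sup>T)
     + \<sigma>2 \<cdot>\<^sub>m outer_prod (vec_op (hG p E V)) (vec_op (hG p E V))"

definition W_uG :: "nat \<Rightarrow> nat set set \<Rightarrow> real \<Rightarrow> real \<Rightarrow> real mat \<Rightarrow> real mat" where
  "W_uG p E \<sigma>1 \<sigma>2 V =
     (2 * \<sigma>1) \<cdot>\<^sub>m minv (QK_tilde p E * ((dup_mat p)\<^sup>T * kron V V * dup_mat p) * (QK_tilde p E)\<^sup>T)
     + \<sigma>2 \<cdot>\<^sub>m outer_prod (QK p E *\<^sub>v vec_op (minv V)) (QK p E *\<^sub>v vec_op (minv V))"

end

theory Submission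
  imports Defs "Jordan_Normal_Form.Determinant"
begin

hide_const (open) Determinants.det

text \<open>
  The completion \<open>hG A\<close> maximizes the determinant over the positive definite matrices that agree with
  \<open>A\<close> on the diagonal and the edges; it is unique because \<open>\<langle>Y, P Y Q\<rangle>\<close>, the Frobenius product of a
  symmetric \<open>Y\<close> with its sandwich by positive definite \<open>P\<close> and \<open>Q\<close>, is bounded below by a multiple of
  the squared norm of \<open>Y\<close>. For completions \<open>B\<close> and \<open>B'\<close> of \<open>A\<close> and \<open>A'\<close> with inverses \<open>K\<close> and \<open>K'\<close>,
  the identity \<open>K - K' = K (B' - B) K'\<close> turns \<open>\<langle>B' - B, K (B' - B) K'\<rangle>\<close> into \<open>\<langle>A' - A, K - K'\<rangle>\<close>, since
  \<open>K - K'\<close> vanishes at the absent edges. The same lower bound then gives a Lipschitz estimate and, applied to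
  the deviation from the solution of the linearized equations, a quadratic remainder. So \<open>hG\<close> and the
  inverse of \<open>hG\<close> are differentiable with explicit derivatives, and the limit laws follow by the delta
  method; the covariance formulas are matrix algebra on vectorized symmetric matrices.
\<close>

section \<open>Inverses and the Frobenius norm\<close>

text \<open>Differentiability is used in one quantitative form: the error is at most
  \<open>C\<close> times the squared Frobenius norm of the increment, for all symmetric increments
  of norm at most \<delta>. Along a line this yields the partial derivatives; after multiplication
  by sqrt n it is an error of order 1/sqrt n on bounded sets, which is what the delta method
  consumes. The obstacle is uniformity: \<open>C\<close> may depend on the base point but not on the
  increment. Both bounds on the inverse of a completion therefore come from data that the completion
  shares with \<open>A\<close>. Its trace is that of \<open>A\<close> and dominates its largest
  eigenvalue, so the inverse is bounded below. The inverse pairs to p with the completion, hence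
  also with \<open>A\<close>, so the trace of the inverse is bounded above. No continuity of
  \<open>hG\<close> has to be known beforehand. The precision matrix gets its own expansion instead
  of a chain rule, because its remainder consists of the same terms.\<close>

lemma index_mult_mat_sum:
  assumes "A \<in> carrier_mat n k" "B \<in> carrier_mat k m" "i < n" "j < m"
  shows "(A * B) $$ (i, j) = (\<Sum>l<k. A $$ (i, l) * B $$ (l, j))"
  using assms by (auto simp: scalar_prod_def atLeast0LessThan intro!: sum.cong)

lemma index_mult_mat_vec_sum:
  assumes "A \<in> carrier_mat n k" "x \<in> carrier_vec k" "i < n"
  shows "(A *\<^sub>v x) $ i = (\<Sum>l<k. A $$ (i, l) * x $ l)"
  using assms by (auto simp: scalar_prod_def atLeast0LessThan intro!: sum.cong)

lemma mult_mat_unit_vec_index: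
  fixes R :: "real mat"
  assumes "R \<in> carrier_mat n m" "i < n" "j < m"
  shows "(R *\<^sub>v unit_vec m j) $ i = R $$ (i, j)"
  using assms by (subst index_mult_mat_vec_sum[OF assms(1)])
    (auto simp: unit_vec_def if_distrib cong: if_cong)

lemma scalar_prod_sum:
  assumes "y \<in> carrier_vec n"
  shows "x \<bullet> y = (\<Sum>i<n. x $ i * y $ i)"
  using assms by (auto simp: scalar_prod_def atLeast0LessThan)

lemma scalar_prod_mult_mat_vec:
  fixes A :: "real mat"
  assumes "A \<in> carrier_mat n k" "x \<in> carrier_vec k" "y \<in> carrier_vec n"
  shows "y \<bullet> (A *\<^sub>v x) = (A\<^sup>T *\<^sub>v y) \<bullet> x"
proof -
  have "y \<bullet> (A *\<^sub>v x) = (\<Sum>i<n. \<Sum>l<k. y $ i * (A $$ (i, l) * x $ l))"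
    using assms by (simp add: scalar_prod_sum[of _ n] index_mult_mat_vec_sum[OF assms(1,2)] sum_distrib_left
        del: index_mult_mat_vec)
  also have "\<dots> = (\<Sum>l<k. \<Sum>i<n. y $ i * (A $$ (i, l) * x $ l))" by (rule sum.swap)
  also have "\<dots> = (\<Sum>l<k. (A\<^sup>T *\<^sub>v y) $ l * x $ l)"
    using assms
    by (intro sum.cong refl, subst index_mult_mat_vec_sum[of _ k n])
       (auto simp: sum_distrib_left mult_ac simp del: index_mult_mat_vec intro!: sum.cong)
  also have "\<dots> = (A\<^sup>T *\<^sub>v y) \<bullet> x"
    using assms by (simp add: scalar_prod_sum[of _ k] del: index_mult_mat_vec)
  finally show ?thesis .
qed

lemma scalar_prod_self_ge_0: "(x :: real vec) \<bullet> x \<ge> 0"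
  by (simp add: scalar_prod_def sum_nonneg)

lemma scalar_prod_self_eq_0:
  assumes "(x :: real vec) \<in> carrier_vec n" "x \<bullet> x = 0"
  shows "x = 0\<^sub>v n"
  using assms by (intro eq_vecI) (auto simp: scalar_prod_def sum_nonneg_eq_0_iff)

lemma minv_works:
  assumes A: "A \<in> carrier_mat n n" and d: "det A \<noteq> 0"
  shows "minv A \<in> carrier_mat n n" "A * minv A = 1\<^sub>m n" "minv A * A = 1\<^sub>m n"
proof -
  have "A \<in> Units (ring_mat TYPE(real) n ())"
    by (rule det_non_zero_imp_unit[OF A d])
  then obtain B where "mat_inverse A = Some B"
    using mat_inverse(1)[OF A, of "()"] by (cases "mat_inverse A") auto
  then show "minv A \<in> carrier_mat n n" "A * minv A = 1\<^sub>m n" "minv A * A = 1\<^sub>m n"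
    using mat_inverse(2)[OF A] by (auto simp: minv_def)
qed

lemma det_nonzero_if_mult_eq_one:
  fixes A B :: "real mat"
  assumes "A \<in> carrier_mat n n" "B \<in> carrier_mat n n" "A * B = 1\<^sub>m n"
  shows "det A \<noteq> 0"
  using det_mult[OF assms(1,2)] assms(3) by auto

lemma minv_eqI:
  assumes A: "A \<in> carrier_mat n n" and B: "B \<in> carrier_mat n n" and AB: "A * B = 1\<^sub>m n"
  shows "minv A = B"
proof -
  note m = minv_works[OF A det_nonzero_if_mult_eq_one[OF assms]]
  have "minv A = minv A * (A * B)" using m(1) by (simp add: AB)
  also have "\<dots> = (minv A * A) * B" using A B m(1) by (simp add: assoc_mult_mat[of _ n n _ n _ n])
  also have "\<dots> = B" using m B by simp
  finally show ?thesis .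
qed

lemma minv_transpose:
  assumes A: "A \<in> carrier_mat n n" and d: "det A \<noteq> 0"
  shows "minv A\<^sup>T = (minv A)\<^sup>T"
proof (rule minv_eqI)
  note m = minv_works[OF A d]
  show "A\<^sup>T * (minv A)\<^sup>T = 1\<^sub>m n"
    using m A by (metis transpose_mult transpose_one)
qed (use A minv_works[OF A d] in auto)

lemma sym_matsD:
  assumes "A \<in> sym_mats p"
  shows "A \<in> carrier_mat p p" "A\<^sup>T = A" "i < p \<Longrightarrow> j < p \<Longrightarrow> A $$ (i, j) = A $$ (j, i)"
proof -
  show A: "A \<in> carrier_mat p p" "A\<^sup>T = A" using assms by (auto simp: sym_mats_def)
  show "A $$ (i, j) = A $$ (j, i)" if "i < p" "j < p"
    using that A(1) by (subst A(2)[symmetric]) auto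
qed

lemma sym_matsI:
  assumes "A \<in> carrier_mat p p" "\<And>i j. i < p \<Longrightarrow> j < p \<Longrightarrow> A $$ (i, j) = A $$ (j, i)"
  shows "A \<in> sym_mats p"
  using assms unfolding sym_mats_def by (auto intro!: eq_matI)

lemma pd_mats_nonsing:
  assumes "A \<in> pd_mats p"
  shows "det A \<noteq> 0"
proof
  assume "det A = 0"
  have A: "A \<in> carrier_mat p p" using assms by (auto simp: pd_mats_def sym_mats_def)
  with \<open>det A = 0\<close> obtain v where "v \<in> carrier_vec p" "v \<noteq> 0\<^sub>v p" "A *\<^sub>v v = 0\<^sub>v p"
    using det_0_iff_vec_prod_zero[OF A] by auto
  then show False using assms unfolding pd_mats_def by auto
qed

lemma pd_mats_sym: "A \<in> pd_mats p \<Longrightarrow> A \<in> sym_mats p"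
  by (simp add: pd_mats_def)

lemma pd_mats_carrier: "A \<in> pd_mats p \<Longrightarrow> A \<in> carrier_mat p p"
  by (simp add: pd_mats_def sym_mats_def)

lemmas pd_mats_minv = minv_works[OF pd_mats_carrier pd_mats_nonsing]

lemma minv_pd_mats:
  assumes A: "A \<in> pd_mats p"
  shows "minv A \<in> pd_mats p"
proof -
  note c = pd_mats_carrier[OF A] and m = pd_mats_minv[OF A A]
  have "minv A \<in> sym_mats p"
    using minv_transpose[OF c pd_mats_nonsing[OF A]] sym_matsD[OF pd_mats_sym[OF A]] m
    by (auto simp: sym_mats_def)
  moreover have "x \<bullet> (minv A *\<^sub>v x) > 0" if x: "x \<in> carrier_vec p" "x \<noteq> 0\<^sub>v p" for x
  proof -
    let ?y = "minv A *\<^sub>v x"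
    have y: "?y \<in> carrier_vec p" using m x by auto
    have xy: "A *\<^sub>v ?y = x" using m x c
      by (subst assoc_mult_mat_vec[symmetric, of _ p p _ p]) auto
    have "A *\<^sub>v 0\<^sub>v p = 0\<^sub>v p" using c by (intro eq_vecI) auto
    then have "?y \<noteq> 0\<^sub>v p" using xy x by auto
    then have "?y \<bullet> (A *\<^sub>v ?y) > 0" using A y by (auto simp: pd_mats_def)
    then show ?thesis using xy y x by (simp add: comm_scalar_prod[of _ p])
  qed
  ultimately show ?thesis by (simp add: pd_mats_def)
qed

lemma minv_minv_pd_mats:
  assumes A: "A \<in> pd_mats p"
  shows "minv (minv A) = A"
  using pd_mats_minv[OF A A] pd_mats_carrier[OF A] by (intro minv_eqI) auto

section \<open>The Frobenius product and its norm\<close>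

definition frob :: "nat \<Rightarrow> real mat \<Rightarrow> real mat \<Rightarrow> real" where
  "frob p A B = (\<Sum>i<p. \<Sum>j<p. A $$ (i, j) * B $$ (i, j))"

definition fnorm :: "nat \<Rightarrow> real mat \<Rightarrow> real" where
  "fnorm p A = sqrt (frob p A A)"

lemma frob_sum_Times: "frob p A B = (\<Sum>z\<in>{..<p} \<times> {..<p}. A $$ z * B $$ z)"
  by (simp add: frob_def sum.cartesian_product case_prod_unfold)

lemma fnorm_L2_set: "fnorm p A = L2_set (\<lambda>z. A $$ z) ({..<p} \<times> {..<p})"
  by (simp add: fnorm_def L2_set_def frob_sum_Times power2_eq_square)

lemma fnorm_ge_0: "fnorm p A \<ge> 0"
  by (simp add: fnorm_L2_set)

lemma frob_self: "frob p A A = (fnorm p A)\<^sup>2"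
  by (simp add: fnorm_L2_set L2_set_def frob_sum_Times sum_nonneg power2_eq_square)

lemma frob_self_ge_0: "frob p A A \<ge> 0"
  by (simp add: frob_self)

lemma frob_commute: "frob p A B = frob p B A"
  by (simp add: frob_def mult.commute)

lemma abs_frob_le: "\<bar>frob p A B\<bar> \<le> fnorm p A * fnorm p B"
proof -
  have "\<bar>frob p A B\<bar> \<le> (\<Sum>z\<in>{..<p} \<times> {..<p}. \<bar>A $$ z\<bar> * \<bar>B $$ z\<bar>)"
    unfolding frob_sum_Times by (rule order.trans[OF sum_abs]) (simp add: abs_mult)
  also have "\<dots> \<le> fnorm p A * fnorm p B"
    unfolding fnorm_L2_set by (rule L2_set_mult_ineq)
  finally show ?thesis .
qed

lemma abs_index_le_fnorm: "i < p \<Longrightarrow> j < p \<Longrightarrow> \<bar>A $$ (i, j)\<bar> \<le> fnorm p A"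
  using member_le_L2_set[of "{..<p} \<times> {..<p}" "(i, j)" "\<lambda>z. \<bar>A $$ z\<bar>"]
  unfolding fnorm_L2_set by (simp add: L2_set_def)

lemma fnorm_le:
  assumes "\<And>i j. i < p \<Longrightarrow> j < p \<Longrightarrow> \<bar>A $$ (i, j)\<bar> \<le> c" "c \<ge> 0"
  shows "fnorm p A \<le> real p * c"
proof -
  have "frob p A A \<le> (\<Sum>i<p. \<Sum>j<p. c * c)"
    unfolding frob_def
    by (intro sum_mono) (metis abs_ge_zero abs_mult_self_eq assms lessThan_iff mult_mono')
  also have "\<dots> = (real p * c)\<^sup>2" by (simp add: power2_eq_square)
  finally show ?thesis using assms(2) unfolding fnorm_def by (intro real_le_lsqrt) auto
qed

lemma fnorm_add_le:
  assumes "A \<in> carrier_mat p p" "B \<in> carrier_mat p p"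
  shows "fnorm p (A + B) \<le> fnorm p A + fnorm p B"
proof -
  have "fnorm p (A + B) = L2_set (\<lambda>z. A $$ z + B $$ z) ({..<p} \<times> {..<p})"
    unfolding fnorm_L2_set using assms by (intro L2_set_cong) auto
  also have "\<dots> \<le> fnorm p A + fnorm p B" unfolding fnorm_L2_set by (rule L2_set_triangle_ineq)
  finally show ?thesis .
qed

lemma fnorm_uminus:
  assumes "A \<in> carrier_mat p p"
  shows "fnorm p (- A) = fnorm p A"
  unfolding fnorm_def frob_def using assms by (auto intro!: arg_cong[where f=sqrt] sum.cong)

lemma frob_eq_0:
  assumes "A \<in> carrier_mat p p" "frob p A A = 0"
  shows "A = 0\<^sub>m p p"
  using assms unfolding frob_def
  by (intro eq_matI) (auto simp: sum_nonneg_eq_0_iff sum_nonneg)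

lemma frob_transpose:
  assumes "A \<in> carrier_mat p p" "B \<in> carrier_mat p p"
  shows "frob p A\<^sup>T B\<^sup>T = frob p A B"
proof -
  have "frob p A\<^sup>T B\<^sup>T = (\<Sum>i<p. \<Sum>j<p. A $$ (j, i) * B $$ (j, i))"
    using assms by (auto simp: frob_def intro!: sum.cong)
  then show ?thesis unfolding frob_def by (subst sum.swap) simp
qed

lemma frob_mult_left:
  assumes A: "A \<in> carrier_mat p p" and B: "B \<in> carrier_mat p p" and L: "L \<in> carrier_mat p p"
  shows "frob p A (L * B) = frob p (L\<^sup>T * A) B"
proof -
  have "frob p A (L * B) = (\<Sum>i<p. \<Sum>j<p. \<Sum>k<p. A $$ (i, j) * (L $$ (i, k) * B $$ (k, j)))"
    unfolding frob_def
    by (intro sum.cong refl) (subst index_mult_mat_sum[OF L B], auto simp: sum_distrib_left)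
  also have "\<dots> = (\<Sum>i<p. \<Sum>k<p. \<Sum>j<p. A $$ (i, j) * (L $$ (i, k) * B $$ (k, j)))"
    by (intro sum.cong refl sum.swap)
  also have "\<dots> = (\<Sum>k<p. \<Sum>i<p. \<Sum>j<p. A $$ (i, j) * (L $$ (i, k) * B $$ (k, j)))"
    by (rule sum.swap)
  also have "\<dots> = (\<Sum>k<p. \<Sum>j<p. \<Sum>i<p. A $$ (i, j) * (L $$ (i, k) * B $$ (k, j)))"
    by (intro sum.cong refl sum.swap)
  also have "\<dots> = frob p (L\<^sup>T * A) B"
    unfolding frob_def using L A
    by (intro sum.cong refl)
       (subst index_mult_mat_sum[of _ p p _ p], auto simp: sum_distrib_left mult_ac)
  finally show ?thesis .
qed

lemma frob_mult_right:
  assumes A: "A \<in> carrier_mat p p" and B: "B \<in> carrier_mat p p" and L: "L \<in> carrier_mat p p"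
  shows "frob p A (B * L) = frob p (A * L\<^sup>T) B"
proof -
  have "frob p A (B * L) = frob p A\<^sup>T (L\<^sup>T * B\<^sup>T)"
    using frob_transpose[of A p "B * L"] A B L by (simp add: transpose_mult[OF B L])
  also have "\<dots> = frob p (L * A\<^sup>T) B\<^sup>T"
    using frob_mult_left[of "A\<^sup>T" p "B\<^sup>T" "L\<^sup>T"] A B L by simp
  also have "\<dots> = frob p (A * L\<^sup>T)\<^sup>T B\<^sup>T" using A L by (simp add: transpose_mult[of A p p])
  also have "\<dots> = frob p (A * L\<^sup>T) B" using A B L by (intro frob_transpose) auto
  finally show ?thesis .
qed

lemma frob_add_right:
  assumes "B \<in> carrier_mat p p" "C \<in> carrier_mat p p"
  shows "frob p A (B + C) = frob p A B + frob p A C"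
  using assms by (auto simp: frob_def sum.distrib[symmetric] algebra_simps intro!: sum.cong)

lemma frob_cols:
  assumes Y: "Y \<in> carrier_mat p p" and Z: "Z \<in> carrier_mat p p"
  shows "frob p Y Z = (\<Sum>j<p. col Y j \<bullet> col Z j)"
  unfolding frob_def using Y Z
  by (subst sum.swap) (auto simp: scalar_prod_def atLeast0LessThan intro!: sum.cong)

text \<open>Cauchy-Schwarz in each row. The Frobenius norm takes the place of the operator norm, so
  that no spectral theory enters.\<close>

lemma mult_mat_vec_norm_le:
  assumes L: "L \<in> carrier_mat p p" and w: "w \<in> carrier_vec p"
  shows "(L *\<^sub>v w) \<bullet> (L *\<^sub>v w) \<le> frob p L L * (w \<bullet> w)"
proof -
  have "(L *\<^sub>v w) \<bullet> (L *\<^sub>v w) = (\<Sum>i<p. (\<Sum>l<p. L $$ (i, l) * w $ l)\<^sup>2)"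
    using L w by (subst scalar_prod_sum[of _ p])
      (auto simp: index_mult_mat_vec_sum[OF L w] power2_eq_square simp del: index_mult_mat_vec intro!: sum.cong)
  also have "\<dots> \<le> (\<Sum>i<p. (\<Sum>l<p. (L $$ (i, l))\<^sup>2) * (\<Sum>l<p. (w $ l)\<^sup>2))"
    by (intro sum_mono Cauchy_Schwarz_ineq_sum)
  also have "\<dots> = frob p L L * (w \<bullet> w)"
    using w by (simp add: frob_def scalar_prod_sum[of _ p] power2_eq_square sum_distrib_right)
  finally show ?thesis .
qed

lemma fnorm_mult_le:
  assumes A: "A \<in> carrier_mat p p" and B: "B \<in> carrier_mat p p"
  shows "fnorm p (A * B) \<le> fnorm p A * fnorm p B"
proof -
  have "frob p (A * B) (A * B) = (\<Sum>j<p. (A *\<^sub>v col B j) \<bullet> (A *\<^sub>v col B j))"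
    using A B by (subst frob_cols) (auto intro!: sum.cong simp: col_mult2[OF A B])
  also have "\<dots> \<le> (\<Sum>j<p. frob p A A * (col B j \<bullet> col B j))"
    using A B by (intro sum_mono mult_mat_vec_norm_le) auto
  also have "\<dots> = frob p A A * frob p B B"
    using B by (simp add: frob_cols[OF B B] sum_distrib_left)
  finally show ?thesis unfolding fnorm_def by (metis real_sqrt_le_mono real_sqrt_mult)
qed

lemma abs_quadratic_form_le:
  assumes A: "A \<in> carrier_mat p p" and x: "x \<in> carrier_vec p"
  shows "\<bar>x \<bullet> (A *\<^sub>v x)\<bar> \<le> fnorm p A * (x \<bullet> x)"
proof -
  have "\<bar>x \<bullet> (A *\<^sub>v x)\<bar> \<le> (\<Sum>i<p. \<bar>x $ i\<bar> * \<bar>(A *\<^sub>v x) $ i\<bar>)"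
    using A x by (subst scalar_prod_sum[of _ p]) (auto simp: abs_mult intro!: order.trans[OF sum_abs])
  also have "\<dots> \<le> L2_set (\<lambda>i. x $ i) {..<p} * L2_set (\<lambda>i. (A *\<^sub>v x) $ i) {..<p}"
    by (rule L2_set_mult_ineq)
  also have "\<dots> = sqrt (x \<bullet> x) * sqrt ((A *\<^sub>v x) \<bullet> (A *\<^sub>v x))"
    using A x by (simp add: L2_set_def scalar_prod_sum[of _ p] power2_eq_square del: index_mult_mat_vec)
  also have "\<dots> \<le> sqrt (x \<bullet> x) * sqrt (frob p A A * (x \<bullet> x))"
    by (intro mult_left_mono real_sqrt_le_mono mult_mat_vec_norm_le A x)
       (simp add: scalar_prod_self_ge_0)
  also have "\<dots> = fnorm p A * (x \<bullet> x)"
    by (simp add: real_sqrt_mult fnorm_def scalar_prod_self_ge_0)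
  finally show ?thesis .
qed

section \<open>Cholesky factors and coercive forms\<close>

text \<open>Gaussian elimination of the last index, on plain functions so that the induction over the
  dimension needs no block matrices.\<close>

lemma cholesky_fun:
  fixes A :: "nat \<Rightarrow> nat \<Rightarrow> real"
  assumes "\<And>i j. i < n \<Longrightarrow> j < n \<Longrightarrow> A i j = A j i"
    and "\<And>x. \<exists>i<n. x i \<noteq> 0 \<Longrightarrow> (\<Sum>i<n. \<Sum>j<n. x i * A i j * x j) > 0"
  shows "\<exists>l. \<forall>i<n. \<forall>j<n. A i j = (\<Sum>k<n. l i k * l j k)"
  using assms
proof (induction n arbitrary: A)
  case 0
  then show ?case by simp
next
  case (Suc n)
  define a where "a = A n n"
  have "(\<Sum>i<Suc n. \<Sum>j<Suc n. (if i = n then 1 else 0) * A i j * (if j = n then 1 else 0)) > 0"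
    by (rule Suc.prems(2)) auto
  then have a: "a > 0" by (simp add: a_def if_distrib cong: if_cong)
  define B where "B = (\<lambda>i j. A i j - A i n * A j n / a)"
  have "\<exists>l. \<forall>i<n. \<forall>j<n. B i j = (\<Sum>k<n. l i k * l j k)"
  proof (rule Suc.IH)
    show "B i j = B j i" if "i < n" "j < n" for i j
      using Suc.prems(1)[of i j] that by (simp add: B_def)
    fix x :: "nat \<Rightarrow> real" assume x: "\<exists>i<n. x i \<noteq> 0"
    define s where "s = (\<Sum>i<n. x i * A i n)"
    \<comment> \<open>The last coordinate minimizes the quadratic form for given \<open>x\<close>;
      the minimum is the form of the Schur complement \<open>B\<close>, which therefore inherits
      positivity.\<close>
    define y where "y = x(n := - s / a)"
    have sym: "A n j = A j n" if "j < n" for j using Suc.prems(1)[of n j] that by simp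
    have "0 < (\<Sum>i<Suc n. \<Sum>j<Suc n. y i * A i j * y j)"
      using x by (intro Suc.prems(2)) (auto simp: y_def)
    also have "\<dots> = (\<Sum>i<n. \<Sum>j<n. y i * A i j * y j) + (\<Sum>i<n. y i * A i n * y n)
        + (\<Sum>j<n. y n * A n j * y j) + y n * a * y n"
      by (simp add: sum.distrib a_def)
    also have "(\<Sum>i<n. \<Sum>j<n. y i * A i j * y j) = (\<Sum>i<n. \<Sum>j<n. x i * A i j * x j)"
      by (auto simp: y_def intro!: sum.cong)
    also have "(\<Sum>i<n. y i * A i n * y n) = s * y n"
      unfolding s_def sum_distrib_right
      by (intro sum.cong refl) (auto simp: y_def)
    also have "(\<Sum>j<n. y n * A n j * y j) = s * y n"
      unfolding s_def sum_distrib_right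
      by (intro sum.cong refl) (auto simp: sym y_def)
    also have "(\<Sum>i<n. \<Sum>j<n. x i * A i j * x j) + s * y n + s * y n + y n * a * y n
        = (\<Sum>i<n. \<Sum>j<n. x i * A i j * x j) - s * s / a"
      using a by (simp add: y_def field_simps)
    also have "\<dots> = (\<Sum>i<n. \<Sum>j<n. x i * B i j * x j)"
    proof -
      have "s * s / a = (\<Sum>i<n. \<Sum>j<n. x i * (A i n * A j n / a) * x j)"
        unfolding s_def sum_product sum_divide_distrib
        by (intro sum.cong refl) (simp add: mult_ac)
      then show ?thesis by (simp add: B_def algebra_simps sum_subtractf)
    qed
    finally show "(\<Sum>i<n. \<Sum>j<n. x i * B i j * x j) > 0" .
  qed
  then obtain l where l: "\<And>i j. i < n \<Longrightarrow> j < n \<Longrightarrow> B i j = (\<Sum>k<n. l i k * l j k)"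
    by blast
  \<comment> \<open>The new column \<open>n\<close> is column \<open>n\<close> of \<open>A\<close>
    divided by sqrt a, so that its last entry is sqrt a; the rest of the last row is zero.\<close>
  define m where "m = (\<lambda>i k. if k = n then A i n / sqrt a else if i = n then 0 else l i k)"
  have "A i j = (\<Sum>k<Suc n. m i k * m j k)" if ij: "i < Suc n" "j < Suc n" for i j
  proof -
    have "(\<Sum>k<Suc n. m i k * m j k) = (\<Sum>k<n. m i k * m j k) + A i n * A j n / a"
      using a by (simp add: m_def)
    moreover have "(\<Sum>k<n. m i k * m j k) = (if i = n \<or> j = n then 0 else B i j)"
      using ij by (auto simp: m_def l less_Suc_eq)
    ultimately show ?thesis
      using a ij Suc.prems(1)[of i j] by (auto simp: B_def a_def field_simps)
  qed
  then show ?case by blast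
qed

lemma pd_mats_cholesky:
  assumes A: "A \<in> pd_mats p"
  obtains L where "L \<in> carrier_mat p p" "A = L * L\<^sup>T"
proof -
  note c = pd_mats_carrier[OF A]
  have "\<exists>l. \<forall>i<p. \<forall>j<p. A $$ (i, j) = (\<Sum>k<p. l i k * l j k)"
  proof (rule cholesky_fun)
    show "A $$ (i, j) = A $$ (j, i)" if "i < p" "j < p" for i j
      using sym_matsD(3)[OF pd_mats_sym[OF A]] that by auto
    fix x :: "nat \<Rightarrow> real" assume x: "\<exists>i<p. x i \<noteq> 0"
    then have "vec p x \<noteq> 0\<^sub>v p" by (metis index_vec index_zero_vec(1))
    then have "vec p x \<bullet> (A *\<^sub>v vec p x) > 0" using A by (auto simp: pd_mats_def)
    also have "vec p x \<bullet> (A *\<^sub>v vec p x) = (\<Sum>i<p. \<Sum>j<p. x i * A $$ (i, j) * x j)"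
      using c by (subst scalar_prod_sum[of _ p])
        (auto simp: index_mult_mat_vec_sum[OF c] sum_distrib_left mult_ac simp del: index_mult_mat_vec
          intro!: sum.cong)
    finally show "(\<Sum>i<p. \<Sum>j<p. x i * A $$ (i, j) * x j) > 0" .
  qed
  then obtain l where l: "\<And>i j. i < p \<Longrightarrow> j < p \<Longrightarrow> A $$ (i, j) = (\<Sum>k<p. l i k * l j k)" by blast
  let ?L = "mat p p (\<lambda>(i, k). l i k)"
  have "A = ?L * ?L\<^sup>T"
    using c by (intro eq_matI) (auto simp: l index_mult_mat_sum[of _ p p _ p] simp del: index_mult_mat(1))
  then show thesis using that[of ?L] by simp
qed

text \<open>For a symmetric matrix, a lower bound on the spectrum, phrased through the quadratic
  form so that eigenvalues need not be discussed.\<close>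

definition coercive :: "nat \<Rightarrow> real \<Rightarrow> real mat \<Rightarrow> bool" where
  "coercive p c A \<longleftrightarrow> (\<forall>x\<in>carrier_vec p. c * (x \<bullet> x) \<le> x \<bullet> (A *\<^sub>v x))"

lemma coercive_frob:
  assumes P: "P \<in> carrier_mat p p" "coercive p a P" and Y: "Y \<in> carrier_mat p p"
  shows "a * frob p Y Y \<le> frob p Y (P * Y)"
proof -
  have "a * frob p Y Y = (\<Sum>j<p. a * (col Y j \<bullet> col Y j))"
    by (simp add: frob_cols[OF Y Y] sum_distrib_left)
  also have "\<dots> \<le> (\<Sum>j<p. col Y j \<bullet> (P *\<^sub>v col Y j))"
    using P Y by (intro sum_mono) (auto simp: coercive_def)
  also have "\<dots> = frob p Y (P * Y)"
    using P Y by (subst frob_cols) (auto simp: col_mult2[of P p p])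
  finally show ?thesis .
qed

text \<open>With \<open>P = L * L^T\<close> and \<open>W = L^T * Y\<close> the sandwich form becomes
  the product of \<open>W\<close> with \<open>W * Q\<close>. Summing over the rows of
  \<open>W\<close> yields the factor \<open>b\<close>, and the squared norm of \<open>W\<close> is
  the product of \<open>Y\<close> with \<open>P * Y\<close>, which yields \<open>a\<close>.\<close>

lemma coercive_frob_sandwich:
  assumes P: "P \<in> pd_mats p" "coercive p a P" and Q: "Q \<in> sym_mats p" "coercive p b Q" "b \<ge> 0"
    and Y: "Y \<in> carrier_mat p p"
  shows "a * b * frob p Y Y \<le> frob p Y (P * Y * Q)"
proof -
  obtain L where L: "L \<in> carrier_mat p p" "P = L * L\<^sup>T" by (rule pd_mats_cholesky[OF P(1)])
  note Pc = pd_mats_carrier[OF P(1)] and Qc = sym_matsD(1,2)[OF Q(1)]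
  define W where "W = L\<^sup>T * Y"
  have W: "W \<in> carrier_mat p p" using L Y by (auto simp: W_def)
  have PY: "P * Y = L * W" using L Y by (simp add: W_def assoc_mult_mat[of _ p p _ p])
  have "b * (a * frob p Y Y) \<le> b * frob p Y (P * Y)"
    by (intro mult_left_mono coercive_frob Pc P Y Q)
  also have "frob p Y (P * Y) = frob p W W" unfolding PY W_def
    using L Y by (intro frob_mult_left) auto
  also have "b * frob p W W = b * frob p W\<^sup>T W\<^sup>T" using W by (simp add: frob_transpose)
  also have "\<dots> \<le> frob p W\<^sup>T (Q * W\<^sup>T)" using W Q Qc by (intro coercive_frob) auto
  also have "\<dots> = frob p W (W * Q)"
    using frob_transpose[of W p "W * Q"] W Qc by (simp add: transpose_mult[of W p p Q p])
  also have "\<dots> = frob p Y (L * (W * Q))" unfolding W_def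
    using L Y Qc by (intro frob_mult_left[symmetric]) auto
  also have "L * (W * Q) = P * Y * Q" unfolding PY using L W Qc by (simp add: assoc_mult_mat[of _ p p _ p _ p])
  finally show ?thesis by (simp add: mult_ac)
qed

section \<open>Trace bounds in place of eigenvalue bounds\<close>

definition mtrace :: "nat \<Rightarrow> real mat \<Rightarrow> real" where
  "mtrace p A = (\<Sum>i<p. A $$ (i, i))"

lemma frob_one_left: "frob p (1\<^sub>m p) A = mtrace p A"
proof -
  have "frob p (1\<^sub>m p) A = (\<Sum>i<p. \<Sum>j<p. if j = i then A $$ (i, i) else 0)"
    unfolding frob_def by (intro sum.cong refl) auto
  then show ?thesis by (simp add: mtrace_def)
qed

lemma frob_LLT:
  assumes "L \<in> carrier_mat p p"
  shows "frob p L L = mtrace p (L * L\<^sup>T)"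
  using frob_mult_right[of "1\<^sub>m p" p L "L\<^sup>T"] assms by (simp add: frob_one_left)

text \<open>For a Cholesky factor \<open>L\<close> the trace is the squared norm of
  \<open>L\<close>, and the norm is submultiplicative.\<close>

lemma fnorm_le_mtrace:
  assumes "K \<in> pd_mats p"
  shows "fnorm p K \<le> mtrace p K"
proof -
  obtain L where L: "L \<in> carrier_mat p p" "K = L * L\<^sup>T" by (rule pd_mats_cholesky[OF assms])
  have "fnorm p K \<le> fnorm p L * fnorm p L\<^sup>T" unfolding L(2) using L(1) by (intro fnorm_mult_le) auto
  also have "fnorm p L\<^sup>T = fnorm p L" using L(1) by (simp add: fnorm_def frob_transpose)
  also have "fnorm p L * fnorm p L = mtrace p K"
    using frob_self[of p L] by (simp add: L frob_LLT power2_eq_square)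
  finally show ?thesis .
qed

lemma mtrace_pd_ge_0: "K \<in> pd_mats p \<Longrightarrow> mtrace p K \<ge> 0"
  using fnorm_le_mtrace[of K p] fnorm_ge_0[of p K] by linarith

text \<open>With \<open>K = L * L^T\<close> the right side is the product of \<open>L\<close> with
  \<open>A * L\<close>, a sum of quadratic forms at the columns of \<open>L\<close>.\<close>

lemma coercive_mtrace:
  assumes K: "K \<in> pd_mats p" and A: "A \<in> sym_mats p" "coercive p a A"
  shows "a * mtrace p K \<le> frob p K A"
proof -
  obtain L where L: "L \<in> carrier_mat p p" "K = L * L\<^sup>T" by (rule pd_mats_cholesky[OF K])
  note Ac = sym_matsD(1,2)[OF A(1)]
  have "a * mtrace p K = a * frob p L L" using L by (simp add: frob_LLT)
  also have "\<dots> \<le> frob p L (A * L)" using L A Ac by (intro coercive_frob) auto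
  also have "\<dots> = frob p (A * L) L" by (rule frob_commute)
  also have "\<dots> = frob p A (L * L\<^sup>T)" using frob_mult_right[of A p L "L\<^sup>T"] L Ac by simp
  finally show ?thesis by (simp add: L frob_commute)
qed

text \<open>The trace bounds the largest eigenvalue of \<open>B\<close>. For a Cholesky factor
  \<open>L\<close>, the vector \<open>w = L^T * B^-1 * x\<close> satisfies \<open>L * w = x\<close>,
  and its squared length is the form of the inverse at \<open>x\<close>; the squared norm of
  \<open>L\<close> is the trace.\<close>

lemma coercive_minv:
  assumes B: "B \<in> pd_mats p" and t: "mtrace p B \<le> t" "t > 0"
  shows "coercive p (1 / t) (minv B)"
  unfolding coercive_def
proof
  fix x :: "real vec" assume x: "x \<in> carrier_vec p"
  obtain L where L: "L \<in> carrier_mat p p" "B = L * L\<^sup>T" by (rule pd_mats_cholesky[OF B])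
  note m = pd_mats_minv[OF B B] and c = pd_mats_carrier[OF B]
  define y where "y = minv B *\<^sub>v x"
  define w where "w = L\<^sup>T *\<^sub>v y"
  have y: "y \<in> carrier_vec p" and w: "w \<in> carrier_vec p" using m x L by (auto simp: y_def w_def)
  have By: "B *\<^sub>v y = x" unfolding y_def using m x c
    by (subst assoc_mult_mat_vec[symmetric, of _ p p _ p]) auto
  have Lw: "L *\<^sub>v w = x" unfolding w_def By[symmetric] L(2) using L(1) y
    by (subst assoc_mult_mat_vec[symmetric, of _ p p _ p]) auto
  have "x \<bullet> x \<le> frob p L L * (w \<bullet> w)" using mult_mat_vec_norm_le[OF L(1) w] by (simp add: Lw)
  also have "w \<bullet> w = y \<bullet> (L *\<^sub>v w)"
    using scalar_prod_mult_mat_vec[OF L(1) w y] by (simp add: w_def)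
  also have "y \<bullet> (L *\<^sub>v w) = x \<bullet> (minv B *\<^sub>v x)" unfolding Lw
    using x y comm_scalar_prod[of y p x] by (simp add: y_def)
  also have "frob p L L = mtrace p B" using L by (simp add: frob_LLT)
  also have "mtrace p B * (x \<bullet> (minv B *\<^sub>v x)) \<le> t * (x \<bullet> (minv B *\<^sub>v x))"
  proof (rule mult_right_mono[OF t(1)])
    show "x \<bullet> (minv B *\<^sub>v x) \<ge> 0"
      using \<open>w \<bullet> w = y \<bullet> (L *\<^sub>v w)\<close> \<open>y \<bullet> (L *\<^sub>v w) = _\<close> scalar_prod_self_ge_0[of w] by simp
  qed
  finally show "1 / t * (x \<bullet> x) \<le> x \<bullet> (minv B *\<^sub>v x)" using t(2) by (simp add: field_simps)
qed

text \<open>The constant comes from applying the trace bound to the inverse, not from compactness of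
  the sphere. The summand 1 keeps the denominator positive even in dimension 0.\<close>

lemma pd_mats_coercive:
  assumes A: "A \<in> pd_mats p"
  obtains a where "a > 0" "coercive p a A"
proof
  have "coercive p (1 / (mtrace p (minv A) + 1)) (minv (minv A))"
    using mtrace_pd_ge_0[OF minv_pd_mats[OF A]] by (intro coercive_minv minv_pd_mats A) auto
  then show "coercive p (1 / (mtrace p (minv A) + 1)) A" by (simp add: minv_minv_pd_mats[OF A])
  show "1 / (mtrace p (minv A) + 1) > 0" using mtrace_pd_ge_0[OF minv_pd_mats[OF A]] by simp
qed

lemma coercive_imp_pd_mats:
  assumes "A \<in> sym_mats p" "coercive p a A" "a > 0"
  shows "A \<in> pd_mats p"
  unfolding pd_mats_def
proof safe
  fix x :: "real vec" assume x: "x \<in> carrier_vec p" "x \<noteq> 0\<^sub>v p"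
  then have "x \<bullet> x > 0" using scalar_prod_self_eq_0[of x p] scalar_prod_self_ge_0[of x] by fastforce
  then have "0 < a * (x \<bullet> x)" using assms(3) by simp
  also have "\<dots> \<le> x \<bullet> (A *\<^sub>v x)" using assms(2) x by (simp add: coercive_def)
  finally show "0 < x \<bullet> (A *\<^sub>v x)" .
qed (rule assms(1))

text \<open>Openness of positive definiteness with an explicit radius: the quadratic form of
  \<open>D\<close> is at most its Frobenius norm.\<close>

lemma coercive_add:
  assumes A: "A \<in> carrier_mat p p" "coercive p a A" and D: "D \<in> carrier_mat p p" "fnorm p D \<le> d"
  shows "coercive p (a - d) (A + D)"
  unfolding coercive_def
proof
  fix x :: "real vec" assume x: "x \<in> carrier_vec p"
  have "x \<bullet> ((A + D) *\<^sub>v x) = x \<bullet> (A *\<^sub>v x) + x \<bullet> (D *\<^sub>v x)"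
    using A D x by (simp add: add_mult_distrib_mat_vec[of A p p] scalar_prod_add_distrib[of _ p])
  moreover have "\<bar>x \<bullet> (D *\<^sub>v x)\<bar> \<le> d * (x \<bullet> x)"
    using abs_quadratic_form_le[OF D(1) x] mult_right_mono[OF D(2) scalar_prod_self_ge_0[of x]]
    by linarith
  moreover have "a * (x \<bullet> x) \<le> x \<bullet> (A *\<^sub>v x)" using A x by (simp add: coercive_def)
  ultimately show "(a - d) * (x \<bullet> x) \<le> x \<bullet> ((A + D) *\<^sub>v x)" by (simp add: algebra_simps)
qed

lemma frob_minv:
  assumes B: "B \<in> pd_mats p"
  shows "frob p (minv B) B = real p"
proof -
  note m = pd_mats_minv[OF B B] and c = pd_mats_carrier[OF B] and s = sym_matsD(2)[OF pd_mats_sym[OF B]]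
  have "frob p (minv B) B = frob p (1\<^sub>m p) (minv B * B\<^sup>T)"
    using frob_mult_right[of "1\<^sub>m p" p "minv B" "B\<^sup>T"] m c by (simp add: frob_commute)
  also have "\<dots> = real p" by (simp add: s m frob_one_left mtrace_def)
  finally show ?thesis .
qed

section \<open>Existence and uniqueness of the completion\<close>

lemma sub_sym_mats: "A \<in> sym_mats p \<Longrightarrow> B \<in> sym_mats p \<Longrightarrow> A - B \<in> sym_mats p"
  using sym_matsD(1)[of A p] sym_matsD(1)[of B p]
  by (intro sym_matsI) (auto simp: sym_matsD(3)[of A p] sym_matsD(3)[of B p])

lemma add_sym_mats: "A \<in> sym_mats p \<Longrightarrow> B \<in> sym_mats p \<Longrightarrow> A + B \<in> sym_mats p"
  using sym_matsD(1)[of A p] sym_matsD(1)[of B p]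
  by (intro sym_matsI) (auto simp: sym_matsD(3)[of A p] sym_matsD(3)[of B p])

lemma minv_diff:
  assumes A: "A \<in> pd_mats p" and B: "B \<in> pd_mats p"
  shows "minv A - minv B = minv A * (B - A) * minv B"
proof -
  note a = pd_mats_minv[OF A A] pd_mats_carrier[OF A] and b = pd_mats_minv[OF B B] pd_mats_carrier[OF B]
  have "minv A * (B - A) * minv B = minv A * B * minv B - minv A * A * minv B"
    using a(1,4) b(1,4) by (simp add: mult_minus_distrib_mat[of _ p p _ p] minus_mult_distrib_mat[of _ p p _ _ p])
  also have "\<dots> = minv A - minv B"
    using a b by (simp add: assoc_mult_mat[of _ p p B p _ p])
  finally show ?thesis by simp
qed

text \<open>The property inside the description operator of \<open>hG\<close>, named so that
  existence and uniqueness can be stated. It is the likelihood equation of a Gaussian graphical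
  model for covariance selection.\<close>

definition ggm_completion :: "nat \<Rightarrow> nat set set \<Rightarrow> real mat \<Rightarrow> real mat \<Rightarrow> bool" where
  "ggm_completion p E A B \<longleftrightarrow> B \<in> pd_mats p \<and>
     (\<forall>i<p. \<forall>j<p. {i, j} \<in> E \<or> i = j \<longrightarrow> B $$ (i, j) = A $$ (i, j)) \<and>
     (\<forall>i<p. \<forall>j<p. {i, j} \<notin> E \<and> i \<noteq> j \<longrightarrow> minv B $$ (i, j) = 0)"

lemma frob_disjoint_support:
  assumes "\<And>i j. i < p \<Longrightarrow> j < p \<Longrightarrow> {i, j} \<in> E \<or> i = j \<Longrightarrow> Y $$ (i, j) = 0"
    and "\<And>i j. i < p \<Longrightarrow> j < p \<Longrightarrow> {i, j} \<notin> E \<Longrightarrow> i \<noteq> j \<Longrightarrow> Z $$ (i, j) = 0"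
  shows "frob p Y Z = 0"
  unfolding frob_def
proof (intro sum.neutral ballI)
  fix i j assume "i \<in> {..<p}" "j \<in> {..<p}"
  then show "Y $$ (i, j) * Z $$ (i, j) = 0" using assms[of i j] by (cases "{i, j} \<in> E \<or> i = j") auto
qed

text \<open>Strict positivity of the sandwich form. Uniqueness of the completion, invertibility of
  \<open>Schur_D\<close> and uniqueness of the linearized solution all reduce to it.\<close>

lemma sandwich_eq_0:
  assumes P: "P \<in> pd_mats p" and Q: "Q \<in> pd_mats p" and Y: "Y \<in> carrier_mat p p"
    and "frob p Y (P * Y * Q) = 0"
  shows "Y = 0\<^sub>m p p"
proof -
  obtain a where a: "a > 0" "coercive p a P" by (rule pd_mats_coercive[OF P])
  obtain b where b: "b > 0" "coercive p b Q" by (rule pd_mats_coercive[OF Q])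
  have "a * b * frob p Y Y \<le> 0"
    using coercive_frob_sandwich[OF P a(2) pd_mats_sym[OF Q] b(2) _ Y] b assms(4) by simp
  then have "frob p Y Y = 0"
    using a b frob_self_ge_0[of p Y] by (simp add: mult_le_0_iff order.antisym)
  with Y show ?thesis by (rule frob_eq_0)
qed

lemma ggm_completion_unique:
  assumes "ggm_completion p E A B" "ggm_completion p E A C"
  shows "B = C"
proof -
  have B: "B \<in> pd_mats p" and C: "C \<in> pd_mats p" using assms by (auto simp: ggm_completion_def)
  note Bc = pd_mats_carrier[OF B] and Cc = pd_mats_carrier[OF C]
  let ?Y = "C - B"
  have "frob p ?Y (minv B * ?Y * minv C) = frob p ?Y (minv B - minv C)"
    by (simp add: minv_diff[OF B C])
  also have "\<dots> = 0"
    using assms Bc Cc pd_mats_minv(1)[OF B B] pd_mats_minv(1)[OF C C]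
    by (intro frob_disjoint_support[where E = E]) (auto simp: ggm_completion_def)
  finally have Y: "?Y = 0\<^sub>m p p"
    using Bc Cc by (intro sandwich_eq_0[OF minv_pd_mats[OF B] minv_pd_mats[OF C]]) auto
  show ?thesis
  proof (rule eq_matI)
    fix i j assume ij: "i < dim_row C" "j < dim_col C"
    then have "?Y $$ (i, j) = 0" using Cc by (simp add: Y)
    then show "B $$ (i, j) = C $$ (i, j)" using ij Bc Cc by simp
  qed (use Bc Cc in auto)
qed

section \<open>The determinant as a function of single entries\<close>

lemma continuous_on_det_mat:
  fixes f :: "'a::topological_space \<Rightarrow> nat \<times> nat \<Rightarrow> real"
  assumes "\<And>i j. i < n \<Longrightarrow> j < n \<Longrightarrow> continuous_on S (\<lambda>x. f x (i, j))"
  shows "continuous_on S (\<lambda>x. det (mat n n (f x)))"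
proof -
  have "det (mat n n (f x)) = (\<Sum>\<pi>\<in>{\<pi>. \<pi> permutes {0..<n}}. signof \<pi> * (\<Prod>i\<in>{0..<n}. f x (i, \<pi> i)))" for x
    by (subst det_def'[of _ n]) (auto intro!: sum.cong prod.cong dest: permutes_in_image)
  moreover have "continuous_on S
      (\<lambda>x. \<Sum>\<pi>\<in>{\<pi>. \<pi> permutes {0..<n}}. signof \<pi> * (\<Prod>i\<in>{0..<n}. f x (i, \<pi> i)))"
    by (intro continuous_intros assms) (auto dest: permutes_in_image)
  ultimately show ?thesis by simp
qed

text \<open>Changing one entry at a time keeps the determinant affine in the change, with a single
  cofactor as slope. A symmetric change of a matrix is two such steps.\<close>

definition add_entry :: "nat \<Rightarrow> real mat \<Rightarrow> nat \<Rightarrow> nat \<Rightarrow> real \<Rightarrow> real mat" where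
  "add_entry n A i j c = mat n n (\<lambda>z. A $$ z + (if z = (i, j) then c else 0))"

text \<open>Laplace expansion along row \<open>i\<close>: the cofactors of that row do not see the
  changed entry.\<close>

lemma det_add_entry:
  assumes A: "A \<in> carrier_mat n n" and ij: "i < n" "j < n"
  shows "det (add_entry n A i j c) = det A + c * cofactor A i j"
proof -
  let ?B = "add_entry n A i j c"
  have B: "?B \<in> carrier_mat n n" by (simp add: add_entry_def)
  have cof: "cofactor ?B i k = cofactor A i k" if "k < n" for k
  proof -
    have "mat_delete ?B i k = mat_delete A i k"
      using A ij unfolding mat_delete_def add_entry_def
      by (intro eq_matI) (auto split: if_splits)
    then show ?thesis by (simp add: cofactor_def)
  qed
  have "det ?B = (\<Sum>k<n. ?B $$ (i, k) * cofactor ?B i k)" by (rule laplace_expansion_row[OF B ij(1)])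
  also have "\<dots> = (\<Sum>k<n. A $$ (i, k) * cofactor A i k + (if k = j then c * cofactor A i j else 0))"
  proof (intro sum.cong refl)
    fix k assume "k \<in> {..<n}"
    then have k: "k < n" by simp
    have "?B $$ (i, k) = A $$ (i, k) + (if k = j then c else 0)"
      using ij k by (simp add: add_entry_def)
    then show "?B $$ (i, k) * cofactor ?B i k = A $$ (i, k) * cofactor A i k + (if k = j then c * cofactor A i j else 0)"
      by (simp add: cof[OF k] algebra_simps)
  qed
  also have "\<dots> = det A + c * cofactor A i j"
    using ij by (simp add: sum.distrib laplace_expansion_row[OF A ij(1)])
  finally show ?thesis .
qed

text \<open>In the second of two entry changes the slope is a cofactor of the already changed
  matrix; continuity gives its limit as the change tends to 0.\<close>

lemma continuous_on_cofactor_add_entry: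
  assumes A: "A \<in> carrier_mat n n"
  shows "continuous_on UNIV (\<lambda>c. cofactor (add_entry n A i j c) k l)"
proof -
  have cont_if: "continuous_on UNIV (\<lambda>x::real. if P then x else 0)" for P
    by (cases P) (auto intro!: continuous_intros)
  have "mat_delete (add_entry n A i j c) k l = mat (n - 1) (n - 1) (\<lambda>z. case z of (a, b) \<Rightarrow>
      add_entry n A i j c $$ (if a < k then a else Suc a, if b < l then b else Suc b))" for c
    by (simp add: mat_delete_def add_entry_def)
  moreover have "continuous_on UNIV (\<lambda>c. det (mat (n - 1) (n - 1) (\<lambda>z. case z of (a, b) \<Rightarrow>
      add_entry n A i j c $$ (if a < k then a else Suc a, if b < l then b else Suc b))))"
    by (rule continuous_on_det_mat) (use cont_if in \<open>auto simp: add_entry_def intro!: continuous_intros\<close>)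
  ultimately show ?thesis unfolding cofactor_def by (auto intro!: continuous_intros)
qed

lemma minv_adj:
  assumes A: "A \<in> carrier_mat n n" and d: "det A \<noteq> 0"
  shows "minv A = (1 / det A) \<cdot>\<^sub>m adj_mat A"
proof (rule minv_eqI[OF A])
  show "A * ((1 / det A) \<cdot>\<^sub>m adj_mat A) = 1\<^sub>m n"
    using adj_mat[OF A] A d
    by (subst mult_smult_distrib[of A n n _ n]) (auto intro!: eq_matI)
qed (use adj_mat[OF A] in auto)

lemma minv_cofactor:
  assumes A: "A \<in> carrier_mat n n" "det A \<noteq> 0" and ij: "i < n" "j < n"
  shows "minv A $$ (i, j) = cofactor A j i / det A"
  using A ij by (simp add: minv_adj[OF A] adj_mat_def)

text \<open>A nonzero entry of the inverse would let the determinant grow by moving the corresponding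
  pair of entries of the matrix.\<close>

lemma minv_eq_0_if_det_maximal:
  assumes B: "B \<in> pd_mats p" and ij: "i < p" "j < p" "i \<noteq> j"
    and max: "\<And>s. add_entry p (add_entry p B i j s) j i s \<in> pd_mats p \<Longrightarrow>
      det (add_entry p (add_entry p B i j s) j i s) \<le> det B"
  shows "minv B $$ (i, j) = 0"
proof -
  note c = pd_mats_carrier[OF B] and d = pd_mats_nonsing[OF B]
  let ?R = "\<lambda>s. add_entry p B i j s"
  let ?R' = "\<lambda>s. add_entry p (?R s) j i s"
  \<comment> \<open>For nonzero \<open>s\<close> this is the difference quotient of the determinant
    along the symmetric change; at 0 it is twice the cofactor, by symmetry.\<close>
  define h where "h s = cofactor B i j + cofactor (?R s) j i" for s
  have R: "?R s \<in> carrier_mat p p" for s by (simp add: add_entry_def)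
  have det: "det (?R' s) = det B + s * h s" for s
    using det_add_entry[OF c ij(1,2), of s] det_add_entry[OF R ij(2,1), of s]
    by (simp add: h_def algebra_simps)
  have R0: "?R 0 = B" using c by (intro eq_matI) (auto simp: add_entry_def)
  have sym: "cofactor B i j = cofactor B j i"
    using sym_matsD(3)[OF pd_mats_sym[OF minv_pd_mats[OF B]] ij(1,2)] d
    by (simp add: minv_cofactor[OF c d] ij)
  obtain a where a: "a > 0" "coercive p a B" by (rule pd_mats_coercive[OF B])
  have pd: "?R' s \<in> pd_mats p" if s: "real p * \<bar>s\<bar> < a" for s
  proof -
    define D where "D = mat p p (\<lambda>z. if z = (i, j) \<or> z = (j, i) then s else 0)"
    have R': "?R' s = B + D"
      using c ij by (intro eq_matI) (auto simp: add_entry_def D_def)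
    have "fnorm p D \<le> real p * \<bar>s\<bar>" by (rule fnorm_le) (auto simp: D_def)
    then have "coercive p (a - real p * \<bar>s\<bar>) (B + D)"
      by (intro coercive_add a c) (auto simp: D_def)
    moreover have "B + D \<in> sym_mats p"
      by (intro add_sym_mats pd_mats_sym[OF B] sym_matsI) (auto simp: D_def)
    ultimately show ?thesis unfolding R' using s by (intro coercive_imp_pd_mats[of _ p]) auto
  qed
  have cont: "(h \<longlongrightarrow> h 0) (at 0)"
    using continuous_on_cofactor_add_entry[OF c, of i j j i]
    unfolding h_def by (auto intro!: tendsto_intros simp: continuous_on_def)
  have small: "eventually (\<lambda>s. real p * \<bar>s\<bar> < a) (at (0::real))"
  proof -
    have "((\<lambda>s. real p * \<bar>s\<bar>) \<longlongrightarrow> real p * \<bar>0\<bar>) (at (0::real))" by (intro tendsto_intros)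
    then show ?thesis using a by (intro order_tendstoD(2)) auto
  qed
  have "eventually (\<lambda>s. s * h s \<le> 0) (at 0)"
    using small
  proof eventually_elim
    case (elim s)
    then show ?case using max[OF pd[OF elim]] by (simp add: det)
  qed
  \<comment> \<open>Division of \<open>s * h s <= 0\<close> by \<open>s\<close> gives opposite signs
    on the two sides of 0, so the limit \<open>h 0\<close> must vanish.\<close>
  then have right: "eventually (\<lambda>s. h s \<le> 0) (at_right 0)" and left: "eventually (\<lambda>s. h s \<ge> 0) (at_left 0)"
    unfolding eventually_at_filter by (auto elim!: eventually_mono simp: mult_le_0_iff)
  have "h 0 \<le> 0" using right cont
    by (intro tendsto_upperbound[of h "h 0" "at_right 0"]) (auto simp: filterlim_at_split)
  moreover have "h 0 \<ge> 0" using left cont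
    by (intro tendsto_lowerbound[of h "h 0" "at_left 0"]) (auto simp: filterlim_at_split)
  ultimately have "cofactor B j i = 0" by (simp add: h_def R0 sym)
  then show ?thesis by (simp add: minv_cofactor[OF c d] ij)
qed

lemma det_pd_pos:
  assumes A: "A \<in> pd_mats p"
  shows "det A > 0"
proof -
  obtain L where L: "L \<in> carrier_mat p p" "A = L * L\<^sup>T" by (rule pd_mats_cholesky[OF A])
  have "det A = det L * det L" using L by (simp add: det_mult[of _ p] det_transpose)
  then show ?thesis using pd_mats_nonsing[OF A]
    by (metis mult_eq_0_iff not_real_square_gt_zero)
qed

text \<open>A zero \<open>x\<close> of a nonnegative form is a minimum, which forces
  \<open>B * x = 0\<close>. The proof tests the form at \<open>x + t * y\<close> with
  \<open>y = B * x\<close> and a suitable negative \<open>t\<close>.\<close>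

lemma psd_nonsing_pd:
  assumes B: "B \<in> sym_mats p" and psd: "\<And>x. x \<in> carrier_vec p \<Longrightarrow> x \<bullet> (B *\<^sub>v x) \<ge> 0"
    and d: "det B \<noteq> 0"
  shows "B \<in> pd_mats p"
  unfolding pd_mats_def
proof safe
  note Bc = sym_matsD(1,2)[OF B]
  fix x :: "real vec" assume x: "x \<in> carrier_vec p" "x \<noteq> 0\<^sub>v p"
  have "x \<bullet> (B *\<^sub>v x) \<noteq> 0"
  proof
    assume 0: "x \<bullet> (B *\<^sub>v x) = 0"
    define y where "y = B *\<^sub>v x"
    have y: "y \<in> carrier_vec p" using Bc x by (simp add: y_def)
    have "y \<noteq> 0\<^sub>v p" using det_0_iff_vec_prod_zero[OF Bc(1)] d x by (auto simp: y_def)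
    then have yy: "y \<bullet> y > 0"
      using scalar_prod_self_eq_0[OF y] scalar_prod_self_ge_0[of y] by fastforce
    have "0 \<le> 2 * t * (y \<bullet> y) + t * t * (y \<bullet> (B *\<^sub>v y))" for t
    proof -
      have "0 \<le> (x + t \<cdot>\<^sub>v y) \<bullet> (B *\<^sub>v (x + t \<cdot>\<^sub>v y))" using x y by (intro psd) auto
      also have "B *\<^sub>v (x + t \<cdot>\<^sub>v y) = y + t \<cdot>\<^sub>v (B *\<^sub>v y)"
        using Bc x y by (simp add: y_def mult_add_distrib_mat_vec[of _ p p] mult_mat_vec[of _ p p])
      also have "(x + t \<cdot>\<^sub>v y) \<bullet> \<dots> = x \<bullet> y + t * (x \<bullet> (B *\<^sub>v y)) + t * (y \<bullet> y) + t * t * (y \<bullet> (B *\<^sub>v y))"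
        using Bc x y by (simp add: scalar_prod_add_distrib[of _ p] add_scalar_prod_distrib[of _ p] algebra_simps)
      also have "x \<bullet> (B *\<^sub>v y) = y \<bullet> y"
        using scalar_prod_mult_mat_vec[OF Bc(1) y x(1)] Bc by (simp add: y_def)
      finally show ?thesis using 0 by (simp add: y_def[symmetric])
    qed
    \<comment> \<open>The minimizer of \<open>2 * t * a + t * t * b\<close> is -a/b; the denominator
      1 + b also makes the value negative and stays positive when b = 0.\<close>
    note this[of "- (y \<bullet> y) / (1 + y \<bullet> (B *\<^sub>v y))"]
    moreover define a b where "a = y \<bullet> y" and "b = y \<bullet> (B *\<^sub>v y)"
    ultimately have "0 \<le> 2 * (- a / (1 + b)) * a + (- a / (1 + b)) * (- a / (1 + b)) * b" by simp
    also have "\<dots> = - a * a * (2 + b) / ((1 + b) * (1 + b))"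
      using psd[OF y] by (simp add: b_def divide_simps) (simp add: algebra_simps)
    also have "\<dots> < 0"
    proof -
      have "a * a * (2 + b) / ((1 + b) * (1 + b)) > 0"
        using psd[OF y] yy by (intro divide_pos_pos mult_pos_pos) (auto simp: a_def b_def)
      then show ?thesis by simp
    qed
    finally show False by simp
  qed
  then show "0 < x \<bullet> (B *\<^sub>v x)" using psd[OF x(1)] by linarith
qed (rule B)

text \<open>Tychonoff's theorem. Pinning the remaining coordinates to 0 lets matrices and vectors of
  any size live compactly in one function space.\<close>

lemma compact_box:
  "compact (PiE UNIV (\<lambda>i :: 'i. if P i then {-c..c} else {0::real}))"
proof -
  have "compactin (product_topology (\<lambda>_. euclidean) UNIV) (PiE UNIV (\<lambda>i :: 'i. if P i then {-c..c} else {0::real}))"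
    by (subst compactin_PiE) (auto simp: compactin_euclidean_iff)
  then show ?thesis by (simp only: euclidean_product_topology compactin_euclidean_iff)
qed

text \<open>The feasible set is enlarged to positive semidefinite matrices, which makes it closed.
  The prescribed diagonal fixes the trace, and this bounds all entries of positive definite
  competitors. The maximal determinant is at least that of \<open>A\<close>, hence positive, so the
  maximizer is positive definite after all.\<close>

lemma ggm_completion_exists:
  assumes A: "A \<in> pd_mats p"
  shows "\<exists>B. ggm_completion p E A B"
proof -
  define c where "c = mtrace p A"
  note Ac = pd_mats_carrier[OF A]
  let ?box = "PiE UNIV (\<lambda>z. if z \<in> {..<p} \<times> {..<p} then {-c..c} else {0::real})"
  define C where "C = {f :: nat \<times> nat \<Rightarrow> real. (\<forall>i j. i < p \<longrightarrow> j < p \<longrightarrow> f (i, j) = f (j, i)) \<and>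
    (\<forall>x. 0 \<le> (\<Sum>i<p. \<Sum>j<p. x i * f (i, j) * x j)) \<and>
    (\<forall>i j. i < p \<longrightarrow> j < p \<longrightarrow> {i, j} \<in> E \<or> i = j \<longrightarrow> f (i, j) = A $$ (i, j))}"
  have "compact ?box" by (rule compact_box)
  moreover have "closed C"
  proof -
    have eq: "closed {f :: nat \<times> nat \<Rightarrow> real. f z = f w}" "closed {f :: nat \<times> nat \<Rightarrow> real. f z = c}" for z w c
      by (rule closed_Collect_eq; (rule continuous_on_product_coordinates | rule continuous_on_const))+
    have form: "closed {f :: nat \<times> nat \<Rightarrow> real. 0 \<le> (\<Sum>i<p. \<Sum>j<p. x i * f (i, j) * x j)}" for x
      by (rule closed_Collect_le, rule continuous_on_const)
        (rule continuous_on_sum continuous_on_mult continuous_on_const continuous_on_product_coordinates)+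
    show ?thesis unfolding C_def
      by (rule closed_Collect_conj closed_Collect_all closed_Collect_imp open_Collect_const eq form)+
  qed
  ultimately have comp: "compact (?box \<inter> C)" by (rule compact_Int_closed)
  \<comment> \<open>Matrices are encoded as functions that vanish outside the index square, so that
    they lie in the box.\<close>
  define fn where "fn B = (\<lambda>z. if z \<in> {..<p} \<times> {..<p} then B $$ z else 0)" for B :: "real mat"
  have mat_fn: "mat p p (fn B) = B" if "B \<in> carrier_mat p p" for B
    using that by (intro eq_matI) (auto simp: fn_def)
  have form: "vec p x \<bullet> (B *\<^sub>v vec p x) = (\<Sum>i<p. \<Sum>j<p. x i * B $$ (i, j) * x j)"
    if "B \<in> carrier_mat p p" for B :: "real mat" and x
    using that by (subst scalar_prod_sum[of _ p])
      (auto simp: index_mult_mat_vec_sum[OF that] sum_distrib_left mult_ac simp del: index_mult_mat_vec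
          intro!: sum.cong)
  have in_S: "fn B \<in> ?box \<inter> C" if B: "B \<in> pd_mats p"
    and eq: "\<And>i j. i < p \<Longrightarrow> j < p \<Longrightarrow> {i, j} \<in> E \<or> i = j \<Longrightarrow> B $$ (i, j) = A $$ (i, j)" for B
  proof -
    note Bc = pd_mats_carrier[OF B]
    have "mtrace p B = c" unfolding c_def mtrace_def by (auto intro!: sum.cong eq)
    then have "-c \<le> B $$ (i, j) \<and> B $$ (i, j) \<le> c" if "i < p" "j < p" for i j
      using abs_index_le_fnorm[OF that, of B] fnorm_le_mtrace[OF B] by linarith
    then have "fn B z \<in> (if z \<in> {..<p} \<times> {..<p} then {-c..c} else {0})" for z
      by (cases z) (simp add: fn_def)
    then have "fn B \<in> ?box" unfolding PiE_UNIV_domain by (intro Pi_I)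
    moreover have "0 \<le> (\<Sum>i<p. \<Sum>j<p. x i * B $$ (i, j) * x j)" for x
    proof (cases "vec p x = 0\<^sub>v p")
      case True
      then show ?thesis using form[OF Bc, of x] Bc by simp
    next
      case False
      then show ?thesis using B form[OF Bc, of x] by (force simp: pd_mats_def)
    qed
    moreover have "fn B (i, j) = fn B (j, i)" if "i < p" "j < p" for i j
      using sym_matsD(3)[OF pd_mats_sym[OF B] that] by (simp add: fn_def that)
    moreover have "fn B (i, j) = A $$ (i, j)" if "i < p" "j < p" "{i, j} \<in> E \<or> i = j" for i j
      using eq[OF that] by (simp add: fn_def that)
    moreover have "(\<Sum>i<p. \<Sum>j<p. x i * B $$ (i, j) * x j) = (\<Sum>i<p. \<Sum>j<p. x i * fn B (i, j) * x j)" for x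
      by (simp add: fn_def)
    ultimately show ?thesis unfolding C_def by simp
  qed
  have fA: "fn A \<in> ?box \<inter> C" by (rule in_S[OF A]) auto
  have "continuous_on (?box \<inter> C) (\<lambda>f. det (mat p p f))"
    by (rule continuous_on_det_mat, rule continuous_on_subset[OF continuous_on_product_coordinates subset_UNIV])
  then obtain f where f: "f \<in> ?box \<inter> C" and fmax: "\<And>g. g \<in> ?box \<inter> C \<Longrightarrow> det (mat p p g) \<le> det (mat p p f)"
    using continuous_attains_sup[OF comp, of "\<lambda>f. det (mat p p f)"] fA by (metis empty_iff)
  define B where "B = mat p p f"
  have Bc: "B \<in> carrier_mat p p" by (simp add: B_def)
  have Beq: "B $$ (i, j) = A $$ (i, j)" if "i < p" "j < p" "{i, j} \<in> E \<or> i = j" for i j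
    using f that by (auto simp: C_def B_def)
  have "det A \<le> det B" using fmax[OF fA] mat_fn[OF Ac] by (simp add: B_def)
  then have "det B \<noteq> 0" using det_pd_pos[OF A] by linarith
  moreover have "B \<in> sym_mats p" using f by (intro sym_matsI) (auto simp: C_def B_def)
  moreover have "x \<bullet> (B *\<^sub>v x) \<ge> 0" if x: "x \<in> carrier_vec p" for x
  proof -
    have "vec p (vec_index x) = x" using x by auto
    moreover have "0 \<le> (\<Sum>i<p. \<Sum>j<p. x $ i * B $$ (i, j) * x $ j)"
      using f by (auto simp: C_def B_def)
    ultimately show ?thesis using form[OF Bc, of "vec_index x"] by simp
  qed
  ultimately have B: "B \<in> pd_mats p" by (intro psd_nonsing_pd)
  have "minv B $$ (i, j) = 0" if ij: "i < p" "j < p" "{i, j} \<notin> E" "i \<noteq> j" for i j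
  proof (rule minv_eq_0_if_det_maximal[OF B ij(1,2,4)])
    fix s assume pd: "add_entry p (add_entry p B i j s) j i s \<in> pd_mats p"
    have "fn (add_entry p (add_entry p B i j s) j i s) \<in> ?box \<inter> C"
    proof (rule in_S[OF pd])
      fix k l assume kl: "k < p" "l < p" "{k, l} \<in> E \<or> k = l"
      \<comment> \<open>The perturbed pair is an absent edge, so no prescribed entry changes and the
        perturbed matrix remains a competitor.\<close>
      have ne: "(k, l) \<noteq> (i, j)" "(k, l) \<noteq> (j, i)"
        using kl(3) ij(3,4) by (metis Pair_inject insert_commute)+
      have "add_entry p X a b s $$ (k, l) = X $$ (k, l)" if "(k, l) \<noteq> (a, b)" for X a b
        unfolding add_entry_def using kl(1,2) by (subst index_mat(1)) (simp_all only: that if_False add_0_right)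
      then show "add_entry p (add_entry p B i j s) j i s $$ (k, l) = A $$ (k, l)"
        using ne Beq[OF kl] by presburger
    qed
    from fmax[OF this] show "det (add_entry p (add_entry p B i j s) j i s) \<le> det B"
      by (simp add: mat_fn B_def[symmetric] add_entry_def)
  qed
  with B Beq have "ggm_completion p E A B" unfolding ggm_completion_def by blast
  then show ?thesis ..
qed

lemma hG_eqI: "ggm_completion p E A B \<Longrightarrow> hG p E A = B"
  unfolding hG_def ggm_completion_def[symmetric]
  by (rule the_equality) (auto intro: ggm_completion_unique)

lemma ggm_completion_hG: "A \<in> pd_mats p \<Longrightarrow> ggm_completion p E A (hG p E A)"
  using ggm_completion_exists[of A p E] hG_eqI by metis

lemma hG_pd: "A \<in> pd_mats p \<Longrightarrow> hG p E A \<in> pd_mats p"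
  using ggm_completion_hG by (auto simp: ggm_completion_def)

lemma hG_index:
  assumes "A \<in> pd_mats p" "i < p" "j < p" "{i, j} \<in> E \<or> i = j"
  shows "hG p E A $$ (i, j) = A $$ (i, j)"
  using ggm_completion_hG[OF assms(1)] assms(2-) by (auto simp: ggm_completion_def)

lemma minv_hG_index:
  assumes "A \<in> pd_mats p" "i < p" "j < p" "{i, j} \<notin> E" "i \<noteq> j"
  shows "minv (hG p E A) $$ (i, j) = 0"
  using ggm_completion_hG[OF assms(1)] assms(2-) by (auto simp: ggm_completion_def)

lemma minv_graph_iff_hG_fixed:
  assumes V: "V \<in> pd_mats p"
  shows "minv V \<in> pd_mats_graph p E \<longleftrightarrow> V = hG p E V"
proof
  assume "minv V \<in> pd_mats_graph p E"
  then have "ggm_completion p E V V" using V by (auto simp: ggm_completion_def pd_mats_graph_def)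
  then show "V = hG p E V" by (simp add: hG_eqI)
next
  assume "V = hG p E V"
  then show "minv V \<in> pd_mats_graph p E"
    using minv_hG_index[OF V, of _ _ E] minv_pd_mats[OF V] by (auto simp: pd_mats_graph_def)
qed

section \<open>Vectorization and Kronecker products\<close>

text \<open>The premises are equations between dimensions instead of carrier memberships: the
  simplifier can bring long products into right-nested form and settle the side conditions by
  itself.\<close>

lemma mult_mat_assoc_dim:
  "dim_col A = dim_row B \<Longrightarrow> dim_col B = dim_row C \<Longrightarrow> (A * B) * C = A * (B * (C :: real mat))"
  by (rule assoc_mult_mat[of A "dim_row A" "dim_col A" B "dim_col B" C "dim_col C"]) auto

lemma mult_mat_vec_assoc_dim:
  "dim_col A = dim_row B \<Longrightarrow> dim_col B = dim_vec v \<Longrightarrow> (A * B) *\<^sub>v v = A *\<^sub>v (B *\<^sub>v (v :: real vec))"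
  by (rule assoc_mult_mat_vec[of A "dim_row A" "dim_col A" B "dim_col B" v]) auto

lemma transpose_mult_dim:
  "dim_col A = dim_row B \<Longrightarrow> (A * B)\<^sup>T = B\<^sup>T * (A :: real mat)\<^sup>T"
  by (rule transpose_mult[of A "dim_row A" "dim_col A" B "dim_col B"]) auto

lemma vec_idx_less: "i < p \<Longrightarrow> j < p \<Longrightarrow> j * p + i < p * (p :: nat)"
proof -
  assume "i < p" "j < p"
  then have "j * p + i < Suc j * p" by simp
  also have "\<dots> \<le> p * p" using \<open>j < p\<close> by (intro mult_le_mono1) simp
  finally show ?thesis .
qed

lemma sum_vec_idx: "(\<Sum>k<p * p. f k) = (\<Sum>j<p. \<Sum>i<p. f (j * p + i))" for f :: "nat \<Rightarrow> real"
proof -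
  have "(\<Sum>k<p * p. f k) = (\<Sum>j<p. sum f {j * p..<j * p + p})" by (rule sum.nat_group[symmetric])
  also have "\<dots> = (\<Sum>j<p. \<Sum>i<p. f (j * p + i))"
  proof (rule sum.cong)
    fix j
    show "sum f {j * p..<j * p + p} = (\<Sum>i<p. f (j * p + i))"
      by (rule sum.reindex_bij_witness[of _ "\<lambda>i. j * p + i" "\<lambda>k. k - j * p"]) auto
  qed simp
  finally show ?thesis .
qed

lemma vec_op_carrier [simp]: "A \<in> carrier_mat p p \<Longrightarrow> vec_op A \<in> carrier_vec (p * p)"
  by (simp add: vec_op_def)

lemma dim_vec_op [simp]: "dim_vec (vec_op A) = dim_row A * dim_col A"
  by (simp add: vec_op_def)

lemma vec_op_index:
  assumes "A \<in> carrier_mat p p" "i < p" "j < p"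
  shows "vec_op A $ (j * p + i) = A $$ (i, j)"
  using assms vec_idx_less[of i p j] by (auto simp: vec_op_def)

definition unvec :: "nat \<Rightarrow> real vec \<Rightarrow> real mat" where
  "unvec p x = mat p p (\<lambda>(i, j). x $ (j * p + i))"

lemma unvec_carrier [simp]: "unvec p x \<in> carrier_mat p p"
  by (simp add: unvec_def)

lemma unvec_dim [simp]: "dim_row (unvec p x) = p" "dim_col (unvec p x) = p"
  by (simp_all add: unvec_def)

lemma unvec_index [simp]: "i < p \<Longrightarrow> j < p \<Longrightarrow> unvec p x $$ (i, j) = x $ (j * p + i)"
  by (simp add: unvec_def)

lemma idx_div_mod_less:
  assumes "k < p * (p :: nat)"
  shows "k mod p < p" "k div p < p" "k div p * p + k mod p = k"
  using assms by (auto simp: less_mult_imp_div_less) (metis mod_less_divisor mult_0 neq0_conv not_less0)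

lemma vec_op_unvec:
  assumes "x \<in> carrier_vec (p * p)"
  shows "vec_op (unvec p x) = x"
proof (rule eq_vecI)
  fix k assume "k < dim_vec x"
  then have k: "k < p * p" using assms by simp
  note d = idx_div_mod_less[OF k]
  have "vec_op (unvec p x) $ (k div p * p + k mod p) = unvec p x $$ (k mod p, k div p)"
    using d by (intro vec_op_index) auto
  then show "vec_op (unvec p x) $ k = x $ k" using d by simp
qed (use assms in \<open>simp add: unvec_def\<close>)

lemma unvec_vec_op: "A \<in> carrier_mat p p \<Longrightarrow> unvec p (vec_op A) = A"
  by (intro eq_matI) (auto simp: vec_op_index)

lemma eq_vec_opI:
  fixes x y :: "real vec"
  assumes "x \<in> carrier_vec (p * p)" "y \<in> carrier_vec (p * p)"
    and "\<And>i j. i < p \<Longrightarrow> j < p \<Longrightarrow> x $ (j * p + i) = y $ (j * p + i)"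
  shows "x = y"
proof -
  have "unvec p x = unvec p y" using assms(3) by (intro eq_matI) (auto simp: unvec_def)
  then show ?thesis using vec_op_unvec assms(1,2) by metis
qed

text \<open>Every vector of length \<open>p * p\<close> is the vectorization of a matrix, so
  identities between such large matrices reduce to identities between maps of \<open>p\<close> by
  \<open>p\<close> matrices.\<close>

lemma mat_eq_vec_opI:
  assumes P: "P \<in> carrier_mat m (p * p)" and Q: "Q \<in> carrier_mat m (p * p)"
    and eq: "\<And>X. X \<in> carrier_mat p p \<Longrightarrow> P *\<^sub>v vec_op X = Q *\<^sub>v vec_op X"
  shows "P = Q"
proof (rule eq_matI)
  fix i j assume ij: "i < dim_row Q" "j < dim_col Q"
  then have "i < m" "j < p * p" using Q by auto
  then have "(R *\<^sub>v unit_vec (p * p) j) $ i = R $$ (i, j)" if "R \<in> carrier_mat m (p * p)" for R :: "real mat"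
    by (rule mult_mat_unit_vec_index[OF that])
  moreover have "P *\<^sub>v unit_vec (p * p) j = Q *\<^sub>v unit_vec (p * p) j"
    using eq[of "unvec p (unit_vec (p * p) j)"] by (simp add: vec_op_unvec)
  ultimately show "P $$ (i, j) = Q $$ (i, j)" using P Q by metis
qed (use P Q in auto)

lemma vec_op_linear:
  assumes "A \<in> carrier_mat p p" "B \<in> carrier_mat p p"
  shows "vec_op (A + B) = vec_op A + vec_op B" "vec_op (A - B) = vec_op A - vec_op B"
    "vec_op (c \<cdot>\<^sub>m A) = c \<cdot>\<^sub>v vec_op A"
  using assms idx_div_mod_less by (auto simp: vec_op_def intro!: eq_vecI)

lemma scalar_prod_vec_op:
  assumes "A \<in> carrier_mat p p" "B \<in> carrier_mat p p"
  shows "vec_op A \<bullet> vec_op B = frob p A B"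
  using assms
  by (subst scalar_prod_sum[of _ "p * p"], simp, subst sum_vec_idx, subst sum.swap)
     (auto simp: vec_op_index frob_def intro!: sum.cong)

lemma mult_vec_op_index:
  assumes "P \<in> carrier_mat m (p * p)" "X \<in> carrier_mat p p" "k < m"
  shows "(P *\<^sub>v vec_op X) $ k = (\<Sum>b<p. \<Sum>a<p. P $$ (k, b * p + a) * X $$ (a, b))"
  using assms by (subst index_mult_mat_vec_sum[of _ m "p * p"]) (auto simp: sum_vec_idx vec_op_index)

lemma kron_carrier [simp]: "A \<in> carrier_mat p p \<Longrightarrow> B \<in> carrier_mat p p \<Longrightarrow> kron A B \<in> carrier_mat (p * p) (p * p)"
  by (simp add: kron_def)

lemma kron_dim [simp]: "dim_row (kron A B) = dim_row A * dim_row B" "dim_col (kron A B) = dim_col A * dim_col B"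
  by (simp_all add: kron_def)

lemma kron_index:
  assumes "A \<in> carrier_mat p p" "B \<in> carrier_mat p p" "i < p" "j < p" "a < p" "b < p"
  shows "kron A B $$ (j * p + i, b * p + a) = A $$ (j, b) * B $$ (i, a)"
  using assms vec_idx_less[of i p j] vec_idx_less[of a p b] by (simp add: kron_def)

text \<open>The link between Kronecker products and two-sided multiplication, computed entrywise
  once; the product rule and the sandwich maps below are derived from it.\<close>

lemma kron_vec_op:
  assumes A: "A \<in> carrier_mat p p" and B: "B \<in> carrier_mat p p" and X: "X \<in> carrier_mat p p"
  shows "kron A B *\<^sub>v vec_op X = vec_op (B * X * A\<^sup>T)"
proof (rule eq_vec_opI[of _ p])
  show "kron A B *\<^sub>v vec_op X \<in> carrier_vec (p * p)"
    by (rule mult_mat_vec_carrier[OF kron_carrier[OF A B] vec_op_carrier[OF X]])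
  show "vec_op (B * X * A\<^sup>T) \<in> carrier_vec (p * p)" using A B X by (intro vec_op_carrier) auto
  fix i j assume ij: "i < p" "j < p"
  have "(kron A B *\<^sub>v vec_op X) $ (j * p + i) = (\<Sum>b<p. \<Sum>a<p. A $$ (j, b) * B $$ (i, a) * X $$ (a, b))"
    using ij A B by (subst mult_vec_op_index[OF kron_carrier[OF A B] X vec_idx_less]) (auto simp: kron_index)
  also have "\<dots> = (\<Sum>b<p. (B * X) $$ (i, b) * A\<^sup>T $$ (b, j))"
    using ij A by (intro sum.cong refl, subst index_mult_mat_sum[OF B X])
      (auto simp: sum_distrib_right sum_distrib_left mult_ac)
  also have "\<dots> = (B * X * A\<^sup>T) $$ (i, j)"
    using ij A B X by (subst index_mult_mat_sum[of _ p p _ p]) auto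
  also have "\<dots> = vec_op (B * X * A\<^sup>T) $ (j * p + i)"
    using ij A B X by (intro vec_op_index[symmetric]) auto
  finally show "(kron A B *\<^sub>v vec_op X) $ (j * p + i) = vec_op (B * X * A\<^sup>T) $ (j * p + i)" .
qed

lemma kron_mult:
  assumes "A \<in> carrier_mat p p" "B \<in> carrier_mat p p" "C \<in> carrier_mat p p" "D \<in> carrier_mat p p"
  shows "kron A B * kron C D = kron (A * C) (B * D)"
proof (rule mat_eq_vec_opI[of _ "p * p" p])
  fix X :: "real mat" assume X: "X \<in> carrier_mat p p"
  note d = carrier_matD[OF assms(1)] carrier_matD[OF assms(2)] carrier_matD[OF assms(3)]
    carrier_matD[OF assms(4)] carrier_matD[OF X]
  have c: "D * X * C\<^sup>T \<in> carrier_mat p p" "A * C \<in> carrier_mat p p" "B * D \<in> carrier_mat p p"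
    by (auto simp: d)
  have "(kron A B * kron C D) *\<^sub>v vec_op X = kron A B *\<^sub>v (kron C D *\<^sub>v vec_op X)"
    by (rule mult_mat_vec_assoc_dim) (simp_all add: d)
  also have "\<dots> = vec_op (B * (D * X * C\<^sup>T) * A\<^sup>T)"
    by (simp only: kron_vec_op[OF assms(3,4) X] kron_vec_op[OF assms(1,2) c(1)])
  also have "B * (D * X * C\<^sup>T) * A\<^sup>T = (B * D) * X * (A * C)\<^sup>T"
    by (simp add: mult_mat_assoc_dim transpose_mult_dim d)
  also have "vec_op \<dots> = kron (A * C) (B * D) *\<^sub>v vec_op X"
    by (rule kron_vec_op[OF c(2,3) X, symmetric])
  finally show "(kron A B * kron C D) *\<^sub>v vec_op X = kron (A * C) (B * D) *\<^sub>v vec_op X" .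
qed (use assms in \<open>auto intro!: carrier_matI\<close>)

lemma kron_one: "kron (1\<^sub>m p) (1\<^sub>m p) = 1\<^sub>m (p * p)"
proof (rule mat_eq_vec_opI[of _ "p * p" p])
  fix X :: "real mat" assume X: "X \<in> carrier_mat p p"
  then show "kron (1\<^sub>m p) (1\<^sub>m p) *\<^sub>v vec_op X = 1\<^sub>m (p * p) *\<^sub>v vec_op X"
    by (simp add: kron_vec_op[of _ p] one_mult_mat_vec[OF vec_op_carrier[OF X]])
qed (auto intro: kron_carrier)

lemma kron_transpose:
  assumes "A \<in> carrier_mat p p" "B \<in> carrier_mat p p"
  shows "(kron A B)\<^sup>T = kron A\<^sup>T B\<^sup>T"
proof (rule eq_matI)
  fix r c assume "r < dim_row (kron A\<^sup>T B\<^sup>T)" "c < dim_col (kron A\<^sup>T B\<^sup>T)"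
  then have rc: "r < p * p" "c < p * p" using assms by (auto simp: kron_def)
  then show "(kron A B)\<^sup>T $$ (r, c) = kron A\<^sup>T B\<^sup>T $$ (r, c)"
    using assms idx_div_mod_less[OF rc(1)] idx_div_mod_less[OF rc(2)] by (auto simp: kron_def)
qed (use assms in \<open>auto simp: kron_def\<close>)

text \<open>Relates the positions of (i, j) and (j, i) in the column stacking, where the commutation
  matrix has its ones.\<close>

definition transp_idx :: "nat \<Rightarrow> nat \<Rightarrow> nat \<Rightarrow> bool" where
  "transp_idx p r c \<longleftrightarrow> r mod p = c div p \<and> r div p = c mod p"

lemma K_mat_index:
  assumes "r < p * p" "c < p * p"
  shows "K_mat p $$ (r, c) = (if transp_idx p r c then 1 else 0)"
proof -
  note d = idx_div_mod_less[OF assms(1)] idx_div_mod_less[OF assms(2)]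
  have "K_mat p $$ (r, c) = (\<Sum>i<p. \<Sum>j<p. (if r div p = i then 1 else 0) * (if c div p = j then 1 else 0)
      * ((if r mod p = j then 1 else 0) * (if c mod p = i then 1 else 0)))"
    using assms d unfolding K_mat_def
    by (simp, intro sum.cong refl) (auto simp: kron_def outer_prod_def)
  also have "\<dots> = (\<Sum>i<p. if r div p = i then (if transp_idx p r c then 1 else 0) else 0)"
  proof (rule sum.cong)
    fix i
    show "(\<Sum>j<p. (if r div p = i then 1 else 0) * (if c div p = j then 1 else 0)
        * ((if r mod p = j then 1 else 0) * (if c mod p = i then 1 else 0)))
      = (if r div p = i then (if transp_idx p r c then 1 else 0) else (0::real))" (is "sum ?f _ = _")
    proof (cases "r div p = i")
      case True
      have "sum ?f {..<p} = (\<Sum>j<p. if c div p = j then (if transp_idx p r c then 1 else 0) else 0)"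
        using True by (intro sum.cong refl) (simp add: transp_idx_def)
      then show ?thesis using d True by simp
    qed simp
  qed simp
  also have "\<dots> = (if transp_idx p r c then 1 else 0)"
    using d by simp
  finally show ?thesis .
qed

lemma K_mat_carrier [simp]: "K_mat p \<in> carrier_mat (p * p) (p * p)"
  by (simp add: K_mat_def)

lemma K_mat_vec_op:
  assumes X: "X \<in> carrier_mat p p"
  shows "K_mat p *\<^sub>v vec_op X = vec_op X\<^sup>T"
proof (rule eq_vec_opI[of _ p])
  fix i j assume ij: "i < p" "j < p"
  have "(K_mat p *\<^sub>v vec_op X) $ (j * p + i) = (\<Sum>b<p. \<Sum>a<p. (if a = j then if b = i then X $$ (j, i) else 0 else 0))"
  proof (subst mult_vec_op_index[OF K_mat_carrier X vec_idx_less[OF ij]], intro sum.cong refl)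
    fix a b assume "b \<in> {..<p}" "a \<in> {..<p}"
    then show "K_mat p $$ (j * p + i, b * p + a) * X $$ (a, b)
        = (if a = j then if b = i then X $$ (j, i) else 0 else 0)"
      using ij by (auto simp: K_mat_index vec_idx_less transp_idx_def)
  qed
  also have "\<dots> = X $$ (j, i)" using ij by simp
  also have "\<dots> = vec_op X\<^sup>T $ (j * p + i)" using ij X by (subst vec_op_index[of _ p]) auto
  finally show "(K_mat p *\<^sub>v vec_op X) $ (j * p + i) = vec_op X\<^sup>T $ (j * p + i)" .
next
  show "K_mat p *\<^sub>v vec_op X \<in> carrier_vec (p * p)" 
    by (rule mult_mat_vec_carrier[OF K_mat_carrier vec_op_carrier[OF X]])
  show "vec_op X\<^sup>T \<in> carrier_vec (p * p)" using X by (intro vec_op_carrier) auto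
qed

definition sym_part :: "real mat \<Rightarrow> real mat" where
  "sym_part X = (1 / 2) \<cdot>\<^sub>m (X + X\<^sup>T)"

lemma sym_part_sym: "X \<in> carrier_mat p p \<Longrightarrow> sym_part X \<in> sym_mats p"
  by (intro sym_matsI) (auto simp: sym_part_def)

lemma sym_part_id: "X \<in> sym_mats p \<Longrightarrow> sym_part X = X"
  by (intro eq_matI) (auto simp: sym_part_def sym_mats_def)

lemma M_mat_carrier [simp]: "M_mat p \<in> carrier_mat (p * p) (p * p)"
  unfolding M_mat_def using K_mat_carrier[of p] by auto

lemma M_mat_dim [simp]: "dim_row (M_mat p) = p * p" "dim_col (M_mat p) = p * p"
  using M_mat_carrier[of p] by (auto simp del: M_mat_carrier)

text \<open>\<open>K_mat\<close> transposes, so the average with the identity symmetrizes: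
  \<open>M_mat\<close> is the projection onto vectorized symmetric matrices.\<close>

lemma M_mat_vec_op:
  assumes X: "X \<in> carrier_mat p p"
  shows "M_mat p *\<^sub>v vec_op X = vec_op (sym_part X)"
proof -
  have "M_mat p *\<^sub>v vec_op X = (1/2) \<cdot>\<^sub>v ((1\<^sub>m (p * p) + K_mat p) *\<^sub>v vec_op X)"
    unfolding M_mat_def using X K_mat_carrier[of p]
    by (intro eq_vecI) (auto simp: row_smult smult_scalar_prod_distrib[of _ "p * p"] simp del: K_mat_carrier)
  also have "(1\<^sub>m (p * p) + K_mat p) *\<^sub>v vec_op X = vec_op X + vec_op X\<^sup>T"
    using add_mult_distrib_mat_vec[OF one_carrier_mat K_mat_carrier vec_op_carrier[OF X]]
    by (simp add: K_mat_vec_op[OF X] one_mult_mat_vec[OF vec_op_carrier[OF X]])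
  also have "(1/2) \<cdot>\<^sub>v \<dots> = vec_op (sym_part X)"
    using X by (simp add: sym_part_def vec_op_linear[of _ p])
  finally show ?thesis .
qed

lemma M_mat_vec_op_sym: "X \<in> sym_mats p \<Longrightarrow> M_mat p *\<^sub>v vec_op X = vec_op X"
  by (simp add: M_mat_vec_op[of _ p] sym_matsD sym_part_id)

lemma M_mat_fixed_sym:
  assumes "x \<in> carrier_vec (p * p)" "M_mat p *\<^sub>v x = x"
  shows "unvec p x \<in> sym_mats p"
proof -
  have "vec_op (sym_part (unvec p x)) = x"
    using assms M_mat_vec_op[of "unvec p x" p] by (simp add: vec_op_unvec)
  moreover have "sym_part (unvec p x) \<in> sym_mats p" by (intro sym_part_sym) simp
  ultimately show ?thesis by (metis sym_matsD(1) unvec_vec_op)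
qed

lemma M_mat_idem: "M_mat p * M_mat p = M_mat p"
proof (rule mat_eq_vec_opI[of _ "p * p" p])
  fix X :: "real mat" assume X: "X \<in> carrier_mat p p"
  then show "M_mat p * M_mat p *\<^sub>v vec_op X = M_mat p *\<^sub>v vec_op X"
    by (simp add: mult_mat_vec_assoc_dim M_mat_vec_op[OF X] M_mat_vec_op_sym[OF sym_part_sym])
qed (use M_mat_carrier[of p] in \<open>auto simp del: M_mat_carrier\<close>)

lemma M_mat_transpose: "(M_mat p)\<^sup>T = M_mat p"
  using K_mat_carrier[of p]
  by (intro eq_matI) (auto simp: M_mat_def K_mat_index transp_idx_def simp del: K_mat_carrier)

text \<open>Symmetrization commutes with the congruence that sends \<open>X\<close> to
  \<open>A * X * A^T\<close>.\<close>

lemma M_mat_kron_commute: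
  assumes A: "A \<in> carrier_mat p p"
  shows "M_mat p * kron A A = kron A A * M_mat p"
proof (rule mat_eq_vec_opI[of _ "p * p" p])
  fix X :: "real mat" assume X: "X \<in> carrier_mat p p"
  have "sym_part (A * X * A\<^sup>T) = A * sym_part X * A\<^sup>T"
  proof -
    have "(A * X * A\<^sup>T)\<^sup>T = A * X\<^sup>T * A\<^sup>T" using A X by (simp add: transpose_mult_dim mult_mat_assoc_dim)
    moreover have "A * (X + X\<^sup>T) * A\<^sup>T = A * X * A\<^sup>T + A * X\<^sup>T * A\<^sup>T"
      using A X by (simp add: mult_add_distrib_mat[of A p p] add_mult_distrib_mat[of _ p p _ _ p])
    ultimately show ?thesis using A X
      by (simp add: sym_part_def mult_smult_distrib[of A p p _ p] mult_smult_assoc_mat[of _ p p _ p])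
  qed
  then show "M_mat p * kron A A *\<^sub>v vec_op X = kron A A * M_mat p *\<^sub>v vec_op X"
    using A X kron_carrier[OF A A] sym_part_sym[OF X]
    by (simp add: mult_mat_vec_assoc_dim M_mat_vec_op[of _ p] kron_vec_op[of _ p] sym_matsD(1) del: kron_carrier)
qed (use mult_carrier_mat[OF M_mat_carrier kron_carrier[OF A A]] mult_carrier_mat[OF kron_carrier[OF A A] M_mat_carrier] in auto)

section \<open>Selection and duplication matrices\<close>

lemma positions_product: "positions p Y = filter (\<lambda>z. z \<in> Y) (map prod.swap (List.product [0..<p] [0..<p]))"
  by (simp add: positions_def product_concat_map map_concat comp_def)

abbreviation npos :: "nat \<Rightarrow> (nat \<times> nat) set \<Rightarrow> nat" where
  "npos p Y \<equiv> length (positions p Y)"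

lemma set_positions: "set (positions p Y) = Y \<inter> {..<p} \<times> {..<p}"
  unfolding positions_product by (auto simp: image_iff)

lemma distinct_positions: "distinct (positions p Y)"
  unfolding positions_product by (auto simp: distinct_map distinct_product intro: distinct_filter)

lemma length_positions: "npos p Y = card (Y \<inter> {..<p} \<times> {..<p})"
  using distinct_card[OF distinct_positions[of p Y]] by (simp add: set_positions)

lemma positions_nth:
  assumes "k < npos p Y"
  shows "positions p Y ! k \<in> Y" "fst (positions p Y ! k) < p" "snd (positions p Y ! k) < p"
  using nth_mem[OF assms] by (auto simp: set_positions)

definition vec_idx :: "nat \<Rightarrow> nat \<times> nat \<Rightarrow> nat" where
  "vec_idx p z = snd z * p + fst z"

lemma vec_idx_positions_less: "k < npos p Y \<Longrightarrow> vec_idx p (positions p Y ! k) < p * p"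
  unfolding vec_idx_def by (intro vec_idx_less positions_nth)

lemma vec_idx_eq_iff:
  assumes "fst z < p" "snd z < p" "fst w < p" "snd w < p"
  shows "vec_idx p z = vec_idx p w \<longleftrightarrow> z = w"
proof
  assume eq: "vec_idx p z = vec_idx p w"
  have "vec_idx p z mod p = fst z" "vec_idx p z div p = snd z"
       "vec_idx p w mod p = fst w" "vec_idx p w div p = snd w"
    using assms by (simp_all add: vec_idx_def)
  then show "z = w" using eq by (metis prod.collapse)
qed simp

lemma sel_mat_carrier [simp]: "sel_mat p Y \<in> carrier_mat (npos p Y) (p * p)"
  by (simp add: sel_mat_def)

lemma sel_mat_dim [simp]: "dim_row (sel_mat p Y) = npos p Y" "dim_col (sel_mat p Y) = p * p"
  by (simp_all add: sel_mat_def)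

lemma sel_mat_index:
  assumes "k < npos p Y" "c < p * p"
  shows "sel_mat p Y $$ (k, c) = (if c = vec_idx p (positions p Y ! k) then 1 else 0)"
  using assms by (auto simp: sel_mat_def vec_idx_def case_prod_unfold)

lemma sel_mat_mult_vec_index:
  assumes "x \<in> carrier_vec (p * p)" "k < npos p Y"
  shows "(sel_mat p Y *\<^sub>v x) $ k = x $ vec_idx p (positions p Y ! k)"
proof -
  have "(sel_mat p Y *\<^sub>v x) $ k = (\<Sum>c<p * p. if c = vec_idx p (positions p Y ! k) then x $ c else 0)"
    by (subst index_mult_mat_vec_sum[OF sel_mat_carrier assms], intro sum.cong refl)
      (simp add: sel_mat_index[OF assms(2)])
  then show ?thesis using vec_idx_positions_less[OF assms(2)] by simp
qed

lemma sel_mat_vec_op: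
  assumes "X \<in> carrier_mat p p" "k < npos p Y"
  shows "(sel_mat p Y *\<^sub>v vec_op X) $ k = X $$ (positions p Y ! k)"
  using positions_nth[OF assms(2)] assms
  by (subst sel_mat_mult_vec_index) (simp_all add: vec_idx_def vec_op_index)

lemma sel_mat_vec_op_eq_0:
  assumes "X \<in> carrier_mat p p" "sel_mat p Y *\<^sub>v vec_op X = 0\<^sub>v (npos p Y)"
    and "(i, j) \<in> Y" "i < p" "j < p"
  shows "X $$ (i, j) = 0"
proof -
  have "(i, j) \<in> set (positions p Y)" using assms(3-) by (simp add: set_positions)
  then obtain k where k: "k < npos p Y" "positions p Y ! k = (i, j)"
    by (auto simp: in_set_conv_nth)
  then show ?thesis using sel_mat_vec_op[OF assms(1) k(1)] assms(2) by simp
qed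

lemma sel_mat_transpose_mult_index:
  assumes "y \<in> carrier_vec (npos p Y)" "c < p * p"
  shows "((sel_mat p Y)\<^sup>T *\<^sub>v y) $ c =
    (\<Sum>k<npos p Y. if vec_idx p (positions p Y ! k) = c then y $ k else 0)"
  using assms
  by (subst index_mult_mat_vec_sum[of _ "p * p" "npos p Y"])
    (auto simp: sel_mat_index intro!: sum.cong)

lemma sel_mat_transpose_off:
  assumes "y \<in> carrier_vec (npos p Y)" "i < p" "j < p" "(i, j) \<notin> Y"
  shows "unvec p ((sel_mat p Y)\<^sup>T *\<^sub>v y) $$ (i, j) = 0"
proof -
  have "vec_idx p (positions p Y ! k) \<noteq> j * p + i" if "k < npos p Y" for k
    using positions_nth[OF that] vec_idx_eq_iff[of "positions p Y ! k" p "(i, j)"] assms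
    by (auto simp: vec_idx_def)
  then show ?thesis using assms
    by (simp add: sel_mat_transpose_mult_index[OF assms(1) vec_idx_less] del: index_mult_mat_vec)
qed

lemma sel_mat_transpose_sel_mat:
  assumes X: "X \<in> carrier_mat p p"
  shows "(sel_mat p Y)\<^sup>T *\<^sub>v (sel_mat p Y *\<^sub>v vec_op X) =
    vec_op (mat p p (\<lambda>z. if z \<in> Y then X $$ z else 0))"
proof (rule eq_vec_opI[of _ p])
  let ?n = "npos p Y"
  have c: "sel_mat p Y *\<^sub>v vec_op X \<in> carrier_vec ?n"
    by (rule mult_mat_vec_carrier[OF sel_mat_carrier vec_op_carrier[OF X]])
  fix i j assume ij: "i < p" "j < p"
  have "((sel_mat p Y)\<^sup>T *\<^sub>v (sel_mat p Y *\<^sub>v vec_op X)) $ (j * p + i) =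
    (\<Sum>k<?n. if vec_idx p (positions p Y ! k) = j * p + i then (sel_mat p Y *\<^sub>v vec_op X) $ k else 0)"
    by (rule sel_mat_transpose_mult_index[OF c vec_idx_less[OF ij]])
  also have "\<dots> = (\<Sum>k<?n. if positions p Y ! k = (i, j) then X $$ (i, j) else 0)"
  proof (intro sum.cong refl)
    fix k assume "k \<in> {..<?n}"
    then have k: "k < ?n" by simp
    have "vec_idx p (positions p Y ! k) = j * p + i \<longleftrightarrow> positions p Y ! k = (i, j)"
      using positions_nth[OF k] vec_idx_eq_iff[of "positions p Y ! k" p "(i, j)"] ij
      by (simp add: vec_idx_def)
    then show "(if vec_idx p (positions p Y ! k) = j * p + i then (sel_mat p Y *\<^sub>v vec_op X) $ k else 0)
        = (if positions p Y ! k = (i, j) then X $$ (i, j) else 0)"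
      using sel_mat_vec_op[OF X k] by simp
  qed
  also have "\<dots> = (if (i, j) \<in> Y then X $$ (i, j) else 0)"
  proof (cases "(i, j) \<in> Y")
    case True
    then have "(i, j) \<in> set (positions p Y)" using ij by (simp add: set_positions)
    then obtain l where l: "l < ?n" "positions p Y ! l = (i, j)" by (auto simp: in_set_conv_nth)
    have "(\<Sum>k<?n. if positions p Y ! k = (i, j) then X $$ (i, j) else 0) =
      (\<Sum>k<?n. if k = l then X $$ (i, j) else 0)"
      using l nth_eq_iff_index_eq[OF distinct_positions[of p Y], of _ l] by (intro sum.cong refl) auto
    then show ?thesis using True l by simp
  next
    case False
    then have "positions p Y ! k \<noteq> (i, j)" if "k < ?n" for k using positions_nth(1)[OF that] by auto
    then show ?thesis using False by simp
  qed
  also have "\<dots> = vec_op (mat p p (\<lambda>z. if z \<in> Y then X $$ z else 0)) $ (j * p + i)"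
    using ij by (subst vec_op_index[of _ p]) auto
  finally show "((sel_mat p Y)\<^sup>T *\<^sub>v (sel_mat p Y *\<^sub>v vec_op X)) $ (j * p + i) =
    vec_op (mat p p (\<lambda>z. if z \<in> Y then X $$ z else 0)) $ (j * p + i)" .
qed (auto intro!: carrier_vecI)

lemma sel_mat_sandwich_index:
  assumes P: "P \<in> carrier_mat (p * p) (p * p)"
    and kl: "k < npos p Y" "l < npos p Y'"
  shows "(sel_mat p Y * P * (sel_mat p Y')\<^sup>T) $$ (k, l)
    = P $$ (vec_idx p (positions p Y ! k), vec_idx p (positions p Y' ! l))"
proof -
  have QP: "(sel_mat p Y * P) $$ (k, c) = P $$ (vec_idx p (positions p Y ! k), c)" if "c < p * p" for c
    using vec_idx_positions_less[OF kl(1)]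
    by (subst index_mult_mat_sum[OF sel_mat_carrier P kl(1) that])
      (simp add: sel_mat_index[OF kl(1)] if_distrib[of "\<lambda>x. x * _"] cong: if_cong)
  have QPc: "sel_mat p Y * P \<in> carrier_mat (npos p Y) (p * p)"
    using P by (intro carrier_matI) auto
  have "(sel_mat p Y * P * (sel_mat p Y')\<^sup>T) $$ (k, l) =
    (\<Sum>c<p * p. if c = vec_idx p (positions p Y' ! l) then P $$ (vec_idx p (positions p Y ! k), c) else 0)"
  proof (subst index_mult_mat_sum[OF QPc _ kl(1), of _ "npos p Y'"])
    show "(\<Sum>c<p * p. (sel_mat p Y * P) $$ (k, c) * (sel_mat p Y')\<^sup>T $$ (c, l)) =
      (\<Sum>c<p * p. if c = vec_idx p (positions p Y' ! l) then P $$ (vec_idx p (positions p Y ! k), c) else 0)"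
      using kl by (intro sum.cong refl) (simp add: QP sel_mat_index del: index_mult_mat(1))
  qed (use kl in simp_all)
  then show ?thesis using vec_idx_positions_less[OF kl(2)] by simp
qed

text \<open>\<open>X \<mapsto> X + X\<^sup>T - diag X\<close> on vectorized matrices. In terms of the duplication matrix \<open>D\<close> it is
  \<open>D D\<^sup>T\<close>, and \<open>D\<close> itself is its product with the transposed selection of the lower triangle.\<close>

definition fold_mat :: "nat \<Rightarrow> real mat" where
  "fold_mat p = mat (p * p) (p * p) (\<lambda>(r, c). if r = c \<or> transp_idx p r c then 1 else 0)"

definition low_set :: "(nat \<times> nat) set" where
  "low_set = {(i, j). j \<le> i}"

lemma fold_mat_carrier [simp]: "fold_mat p \<in> carrier_mat (p * p) (p * p)"
  by (simp add: fold_mat_def)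

lemma fold_mat_dim [simp]: "dim_row (fold_mat p) = p * p" "dim_col (fold_mat p) = p * p"
  by (simp_all add: fold_mat_def)

lemma fold_mat_transpose: "(fold_mat p)\<^sup>T = fold_mat p"
  by (intro eq_matI) (auto simp: fold_mat_def transp_idx_def)

definition fold_part :: "nat \<Rightarrow> real mat \<Rightarrow> real mat" where
  "fold_part p X = mat p p (\<lambda>(i, j). if i = j then X $$ (i, i) else X $$ (i, j) + X $$ (j, i))"

lemma fold_part_sym: "fold_part p X \<in> sym_mats p"
  by (intro sym_matsI) (auto simp: fold_part_def)

lemma fold_mat_vec_op:
  assumes X: "X \<in> carrier_mat p p"
  shows "fold_mat p *\<^sub>v vec_op X = vec_op (fold_part p X)"
proof (rule eq_vec_opI[of _ p])
  fix i j assume ij: "i < p" "j < p"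
  have "(fold_mat p *\<^sub>v vec_op X) $ (j * p + i) = (\<Sum>b<p. \<Sum>a<p.
      (if a = i then if b = j then X $$ (i, j) else 0 else 0)
      + (if a = j then if b = i then if i = j then 0 else X $$ (j, i) else 0 else 0))"
  proof (subst mult_vec_op_index[OF fold_mat_carrier X vec_idx_less[OF ij]], intro sum.cong refl)
    fix a b assume ab: "b \<in> {..<p}" "a \<in> {..<p}"
    have "j * p + i = b * p + a \<longleftrightarrow> (i, j) = (a, b)"
      using vec_idx_eq_iff[of "(i, j)" p "(a, b)"] ij ab by (simp add: vec_idx_def)
    then show "fold_mat p $$ (j * p + i, b * p + a) * X $$ (a, b)
        = (if a = i then if b = j then X $$ (i, j) else 0 else 0)
      + (if a = j then if b = i then if i = j then 0 else X $$ (j, i) else 0 else 0)"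
      using ij ab by (auto simp: fold_mat_def vec_idx_less transp_idx_def)
  qed
  also have "\<dots> = fold_part p X $$ (i, j)" using ij by (simp add: sum.distrib fold_part_def)
  also have "\<dots> = vec_op (fold_part p X) $ (j * p + i)"
    using ij by (subst vec_op_index[of _ p]) (auto simp: fold_part_def)
  finally show "(fold_mat p *\<^sub>v vec_op X) $ (j * p + i) = vec_op (fold_part p X) $ (j * p + i)" .
qed (auto simp: fold_part_def intro!: carrier_vecI)

text \<open>Two positions of the lower triangle are mirror images only if they are the same diagonal
  position, so between lower positions the folding matrix acts as the identity.\<close>

lemma sel_fold_sel_index:
  assumes Y: "Y \<subseteq> low_set" "Y' \<subseteq> low_set"
    and kl: "k < npos p Y" "l < npos p Y'"
  shows "(sel_mat p Y * fold_mat p * (sel_mat p Y')\<^sup>T) $$ (k, l)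
    = (if positions p Y ! k = positions p Y' ! l then 1 else 0)"
proof -
  let ?z = "positions p Y ! k" and ?w = "positions p Y' ! l"
  note z = positions_nth[OF kl(1)] and w = positions_nth[OF kl(2)]
  have "snd ?z \<le> fst ?z" "snd ?w \<le> fst ?w" using z(1) w(1) Y by (auto simp: low_set_def)
  moreover have "vec_idx p ?z mod p = fst ?z" "vec_idx p ?z div p = snd ?z"
       "vec_idx p ?w mod p = fst ?w" "vec_idx p ?w div p = snd ?w"
    using z w by (simp_all add: vec_idx_def)
  ultimately have "transp_idx p (vec_idx p ?z) (vec_idx p ?w) \<Longrightarrow> ?z = ?w"
    unfolding transp_idx_def by (intro prod_eqI) auto
  moreover have "vec_idx p ?z = vec_idx p ?w \<longleftrightarrow> ?z = ?w" using z w by (intro vec_idx_eq_iff)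
  ultimately show ?thesis
    using vec_idx_positions_less[OF kl(1)] vec_idx_positions_less[OF kl(2)]
    by (subst sel_mat_sandwich_index[OF fold_mat_carrier kl]) (auto simp: fold_mat_def)
qed

lemma sel_fold_sel_one:
  assumes "Y \<subseteq> low_set"
  shows "sel_mat p Y * fold_mat p * (sel_mat p Y)\<^sup>T = 1\<^sub>m (npos p Y)"
  using nth_eq_iff_index_eq[OF distinct_positions[of p Y]]
  by (intro eq_matI) (simp_all add: sel_fold_sel_index[OF assms assms] del: index_mult_mat(1))

text \<open>Applied to the edge positions and the absent positions, this orthogonality replaces a
  block partition of the half-vectorization.\<close>

lemma sel_fold_sel_zero:
  assumes "Y \<subseteq> low_set" "Y' \<subseteq> low_set" "Y \<inter> Y' = {}"
  shows "sel_mat p Y * fold_mat p * (sel_mat p Y')\<^sup>T = 0\<^sub>m (npos p Y) (npos p Y')"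
proof (rule eq_matI; simp del: index_mult_mat(1))
  fix k l assume kl: "k < npos p Y" "l < npos p Y'"
  have "positions p Y ! k \<noteq> positions p Y' ! l"
    using positions_nth(1)[OF kl(1)] positions_nth(1)[OF kl(2)] assms(3) by auto
  then show "(sel_mat p Y * fold_mat p * (sel_mat p Y')\<^sup>T) $$ (k, l) = 0"
    by (simp add: sel_fold_sel_index[OF assms(1,2) kl] del: index_mult_mat(1))
qed

text \<open>Selecting and putting back keeps the lower entries in \<open>Y\<close>; folding mirrors
  them. A symmetric matrix whose lower triangle is supported in \<open>Y\<close> is thereby
  reconstructed.\<close>

lemma fold_sel_sel:
  assumes X: "X \<in> sym_mats p" and Y: "Y \<subseteq> low_set"
    and 0: "\<And>i j. i < p \<Longrightarrow> j \<le> i \<Longrightarrow> (i, j) \<notin> Y \<Longrightarrow> X $$ (i, j) = 0"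
  shows "fold_mat p *\<^sub>v ((sel_mat p Y)\<^sup>T *\<^sub>v (sel_mat p Y *\<^sub>v vec_op X)) = vec_op X"
proof -
  note Xc = sym_matsD(1)[OF X]
  let ?m = "mat p p (\<lambda>z. if z \<in> Y then X $$ z else 0)"
  have low: "?m $$ (i, j) = X $$ (i, j)" if "i < p" "j \<le> i" for i j using 0[OF that] that by simp
  have up: "?m $$ (i, j) = 0" if "i < j" "j < p" for i j using Y that by (auto simp: low_set_def)
  have "fold_part p ?m $$ (i, j) = X $$ (i, j)" if ij: "i < p" "j < p" for i j
  proof -
    consider "i = j" | "i < j" | "j < i" by linarith
    then show ?thesis
    proof cases
      case 1
      then show ?thesis using ij low[of i i] by (simp add: fold_part_def)
    next
      case 2
      then have "fold_part p ?m $$ (i, j) = ?m $$ (i, j) + ?m $$ (j, i)"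
        using ij by (simp add: fold_part_def)
      also have "\<dots> = X $$ (j, i)" using low[of j i] up[of i j] 2 ij by simp
      finally show ?thesis using sym_matsD(3)[OF X ij] by simp
    next
      case 3
      then have "fold_part p ?m $$ (i, j) = ?m $$ (i, j) + ?m $$ (j, i)"
        using ij by (simp add: fold_part_def)
      also have "\<dots> = X $$ (i, j)" using low[of i j] up[of j i] 3 ij by simp
      finally show ?thesis .
    qed
  qed
  then have "fold_part p ?m = X" using Xc by (intro eq_matI) (auto simp: fold_part_def)
  then show ?thesis
    by (simp add: sel_mat_transpose_sel_mat[OF Xc] fold_mat_vec_op[of ?m p])
qed

section \<open>Half-vectorization and the duplication matrix\<close>

abbreviation low_mat :: "nat \<Rightarrow> real mat" where
  "low_mat p \<equiv> sel_mat p low_set"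

lemma vech_eq: "A \<in> carrier_mat p p \<Longrightarrow> vech p A = low_mat p *\<^sub>v vec_op A"
  by (intro eq_vecI)
    (simp_all add: vech_def sel_mat_vec_op low_set_def[symmetric] vec_of_list_index del: index_mult_mat_vec)

lemma card_low_set: "card (low_set \<inter> {..<p} \<times> {..<p}) = half_dim p"
proof -
  have "low_set \<inter> {..<p} \<times> {..<p} = (SIGMA i:{..<p}. {..i})" by (auto simp: low_set_def)
  then have "card (low_set \<inter> {..<p} \<times> {..<p}) = (\<Sum>i<p. Suc i)" by simp
  also have "2 * (\<Sum>i<p. Suc i) = p * (p + 1)" by (induction p) auto
  then have "(\<Sum>i<p. Suc i) = half_dim p" unfolding half_dim_def by linarith
  finally show ?thesis .
qed

lemma length_low_positions: "npos p low_set = half_dim p"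
  by (simp add: length_positions card_low_set)

lemma D_set_subset: "D_set p E \<subseteq> low_set" "D_set p E \<subseteq> {..<p} \<times> {..<p}"
  by (auto simp: D_set_def low_set_def)

lemma K_set_subset: "K_set p E \<subseteq> low_set" "K_set p E \<subseteq> {..<p} \<times> {..<p}"
  by (auto simp: K_set_def low_set_def)

lemma K_D_set_disjoint: "K_set p E \<inter> D_set p E = {}"
  by (auto simp: K_set_def D_set_def)

lemma length_K_positions: "npos p (K_set p E) = half_dim p - num_absent p E"
proof -
  have "K_set p E \<union> D_set p E = low_set \<inter> {..<p} \<times> {..<p}"
    by (auto simp: K_set_def D_set_def low_set_def)
  moreover have "card (K_set p E \<union> D_set p E) = card (K_set p E) + card (D_set p E)"
    using K_D_set_disjoint[of p E] finite_subset[OF K_set_subset(2)[of p E]] finite_subset[OF D_set_subset(2)[of p E]]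
    by (intro card_Un_disjoint) auto
  ultimately have "card (K_set p E) + num_absent p E = half_dim p"
    by (simp add: card_low_set num_absent_def)
  moreover have "K_set p E \<inter> {..<p} \<times> {..<p} = K_set p E" using K_set_subset(2)[of p E] by auto
  ultimately show ?thesis by (simp add: length_positions)
qed

lemma vech_carrier [simp]: "A \<in> carrier_mat p p \<Longrightarrow> vech p A \<in> carrier_vec (half_dim p)"
  by (rule carrier_vecI) (simp add: vech_eq length_low_positions)

lemma low_mat_carrier: "low_mat p \<in> carrier_mat (half_dim p) (p * p)"
  by (rule carrier_matI) (simp_all add: length_low_positions)

lemma fold_low_vech:
  assumes "A \<in> sym_mats p"
  shows "fold_mat p *\<^sub>v ((low_mat p)\<^sup>T *\<^sub>v vech p A) = vec_op A"
  unfolding vech_eq[OF sym_matsD(1)[OF assms]]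
  by (rule fold_sel_sel[OF assms]) (auto simp: low_set_def)

text \<open>An explicit preimage under half-vectorization: the entries are placed in the lower
  triangle and mirrored.\<close>

definition sym_of_vech :: "nat \<Rightarrow> real vec \<Rightarrow> real mat" where
  "sym_of_vech p x = fold_part p (unvec p ((low_mat p)\<^sup>T *\<^sub>v x))"

lemma sym_of_vech_sym [simp]: "sym_of_vech p x \<in> sym_mats p"
  by (simp add: sym_of_vech_def fold_part_sym)

lemma vec_op_sym_of_vech:
  assumes "x \<in> carrier_vec (half_dim p)"
  shows "vec_op (sym_of_vech p x) = fold_mat p *\<^sub>v ((low_mat p)\<^sup>T *\<^sub>v x)"
  unfolding sym_of_vech_def
  by (subst fold_mat_vec_op[symmetric]) (auto simp: vec_op_unvec carrier_vecI)

lemma vech_sym_of_vech: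
  assumes x: "x \<in> carrier_vec (half_dim p)"
  shows "vech p (sym_of_vech p x) = x"
proof -
  have "vech p (sym_of_vech p x) = low_mat p *\<^sub>v (fold_mat p *\<^sub>v ((low_mat p)\<^sup>T *\<^sub>v x))"
    by (simp add: vech_eq[OF sym_matsD(1)[OF sym_of_vech_sym]] vec_op_sym_of_vech[OF x])
  also have "\<dots> = (low_mat p * fold_mat p * (low_mat p)\<^sup>T) *\<^sub>v x"
    using x by (simp add: mult_mat_vec_assoc_dim length_low_positions)
  also have "\<dots> = x" using x by (simp add: sel_fold_sel_one length_low_positions)
  finally show ?thesis .
qed

lemma vech_inj:
  assumes "A \<in> sym_mats p" "B \<in> sym_mats p" "vech p A = vech p B"
  shows "A = B"
  using fold_low_vech[OF assms(1)] fold_low_vech[OF assms(2)] assms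
  by (metis sym_matsD(1) unvec_vec_op)

lemma unvech_vech: "A \<in> sym_mats p \<Longrightarrow> unvech p (vech p A) = A"
  unfolding unvech_def by (rule the_equality) (auto intro: vech_inj)

lemma fold_low_carrier: "fold_mat p * (low_mat p)\<^sup>T \<in> carrier_mat (p * p) (half_dim p)"
  by (rule carrier_matI) (simp_all add: length_low_positions)

text \<open>Half-vectorization of symmetric matrices is onto, so the defining equation fixes the
  action on every unit vector and hence every column.\<close>

lemma dup_mat_eq: "dup_mat p = fold_mat p * (low_mat p)\<^sup>T"
  unfolding dup_mat_def
proof (rule the_equality, intro conjI ballI)
  show "fold_mat p * (low_mat p)\<^sup>T \<in> carrier_mat (p * p) (half_dim p)"
    by (rule fold_low_carrier)
  fix A assume A: "A \<in> sym_mats p"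
  then show "fold_mat p * (low_mat p)\<^sup>T *\<^sub>v vech p A = vec_op A"
    using carrier_vecD[OF vech_carrier[OF sym_matsD(1)[OF A]]]
    by (simp add: mult_mat_vec_assoc_dim fold_low_vech length_low_positions)
next
  fix D assume "D \<in> carrier_mat (p * p) (half_dim p) \<and> (\<forall>A\<in>sym_mats p. D *\<^sub>v vech p A = vec_op A)"
  then have D: "D \<in> carrier_mat (p * p) (half_dim p)" and Dv: "\<And>A. A \<in> sym_mats p \<Longrightarrow> D *\<^sub>v vech p A = vec_op A"
    by auto
  show "D = fold_mat p * (low_mat p)\<^sup>T"
  proof (rule eq_matI)
    fix i j assume ij: "i < dim_row (fold_mat p * (low_mat p)\<^sup>T)" "j < dim_col (fold_mat p * (low_mat p)\<^sup>T)"
    let ?e = "unit_vec (half_dim p) j"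
    have "D *\<^sub>v ?e = fold_mat p * (low_mat p)\<^sup>T *\<^sub>v ?e"
      using Dv[of "sym_of_vech p ?e"]
      by (simp add: vech_sym_of_vech vec_op_sym_of_vech mult_mat_vec_assoc_dim length_low_positions)
    moreover have "(R *\<^sub>v ?e) $ i = R $$ (i, j)" if "R \<in> carrier_mat (p * p) (half_dim p)" for R :: "real mat"
      using ij by (intro mult_mat_unit_vec_index[OF that]) (simp_all add: length_low_positions)
    ultimately show "D $$ (i, j) = (fold_mat p * (low_mat p)\<^sup>T) $$ (i, j)"
      using D fold_low_carrier by metis
  qed (use D in \<open>simp_all add: length_low_positions\<close>)
qed

lemma dup_mat_dim [simp]: "dim_row (dup_mat p) = p * p" "dim_col (dup_mat p) = half_dim p"
  by (simp_all add: dup_mat_eq length_low_positions)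

lemma dup_mat_vech: "A \<in> sym_mats p \<Longrightarrow> dup_mat p *\<^sub>v vech p A = vec_op A"
  using carrier_vecD[OF vech_carrier[OF sym_matsD(1)[of A p]]]
  by (simp add: dup_mat_eq mult_mat_vec_assoc_dim fold_low_vech length_low_positions)

lemma dup_mat_transpose: "(dup_mat p)\<^sup>T = low_mat p * fold_mat p"
  by (simp add: dup_mat_eq transpose_mult_dim fold_mat_transpose)

lemma low_dup: "low_mat p * dup_mat p = 1\<^sub>m (half_dim p)"
  using sel_fold_sel_one[of low_set p]
  by (simp add: dup_mat_eq mult_mat_assoc_dim length_low_positions)

lemma dup_dup_transpose: "dup_mat p * (dup_mat p)\<^sup>T = fold_mat p"
proof (rule mat_eq_vec_opI[of _ "p * p" p])
  fix X :: "real mat" assume X: "X \<in> carrier_mat p p"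
  have "dup_mat p * (dup_mat p)\<^sup>T *\<^sub>v vec_op X = dup_mat p *\<^sub>v (low_mat p *\<^sub>v vec_op (fold_part p X))"
    using carrier_matD[OF X]
    by (simp add: dup_mat_transpose mult_mat_vec_assoc_dim fold_mat_vec_op[OF X] length_low_positions)
  also have "\<dots> = vec_op (fold_part p X)"
    using dup_mat_vech[OF fold_part_sym, of p X] by (simp add: vech_eq[OF sym_matsD(1)[OF fold_part_sym]])
  finally show "dup_mat p * (dup_mat p)\<^sup>T *\<^sub>v vec_op X = fold_mat p *\<^sub>v vec_op X"
    by (simp add: fold_mat_vec_op[OF X])
qed (auto intro!: carrier_matI)

lemma M_fold: "M_mat p * fold_mat p = fold_mat p"
proof (rule mat_eq_vec_opI[of _ "p * p" p])
  fix X :: "real mat" assume X: "X \<in> carrier_mat p p"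
  then show "M_mat p * fold_mat p *\<^sub>v vec_op X = fold_mat p *\<^sub>v vec_op X"
    using carrier_matD[OF X]
    by (simp add: mult_mat_vec_assoc_dim fold_mat_vec_op[OF X] M_mat_vec_op_sym[OF fold_part_sym])
qed (auto intro!: carrier_matI)

lemma fold_M: "fold_mat p * M_mat p = fold_mat p"
  using arg_cong[OF M_fold[of p], of transpose_mat]
  by (simp add: transpose_mult_dim fold_mat_transpose M_mat_transpose)

lemma M_dup: "M_mat p * dup_mat p = dup_mat p"
  using arg_cong[OF M_fold[of p], of "\<lambda>A. A * (low_mat p)\<^sup>T"]
  by (simp add: dup_mat_eq mult_mat_assoc_dim)

text \<open>After symmetrization nothing is lost by keeping only the lower triangle, and duplication
  restores the rest.\<close>

lemma dup_low_M: "dup_mat p * (low_mat p * M_mat p) = M_mat p"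
proof (rule mat_eq_vec_opI[of _ "p * p" p])
  fix X :: "real mat" assume X: "X \<in> carrier_mat p p"
  then show "dup_mat p * (low_mat p * M_mat p) *\<^sub>v vec_op X = M_mat p *\<^sub>v vec_op X"
    using carrier_matD[OF X] dup_mat_vech[OF sym_part_sym[OF X]] carrier_matD[OF sym_matsD(1)[OF sym_part_sym[OF X]]]
    by (simp add: mult_mat_vec_assoc_dim M_mat_vec_op[OF X] vech_eq[OF sym_matsD(1)[OF sym_part_sym[OF X]]]
        length_low_positions)
qed (auto intro!: carrier_matI)

text \<open>The Gram form at \<open>v\<close> is the squared length of the duplicated vector, and
  \<open>low_mat\<close> is a left inverse of duplication.\<close>

lemma dup_gram_nonsing: "det ((dup_mat p)\<^sup>T * dup_mat p) \<noteq> 0"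
proof
  let ?D = "dup_mat p"
  have c: "?D\<^sup>T * ?D \<in> carrier_mat (half_dim p) (half_dim p)" by (intro carrier_matI) auto
  assume "det (?D\<^sup>T * ?D) = 0"
  then obtain v where v: "v \<in> carrier_vec (half_dim p)" "v \<noteq> 0\<^sub>v (half_dim p)"
    "?D\<^sup>T * ?D *\<^sub>v v = 0\<^sub>v (half_dim p)"
    using det_0_iff_vec_prod_zero[OF c] by auto
  have Dc: "?D \<in> carrier_mat (p * p) (half_dim p)" and Dv: "?D *\<^sub>v v \<in> carrier_vec (p * p)"
    using v by (auto intro!: carrier_matI carrier_vecI)
  have "(?D *\<^sub>v v) \<bullet> (?D *\<^sub>v v) = (?D\<^sup>T *\<^sub>v (?D *\<^sub>v v)) \<bullet> v"
    by (rule scalar_prod_mult_mat_vec[OF Dc v(1) Dv])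
  also have "?D\<^sup>T *\<^sub>v (?D *\<^sub>v v) = 0\<^sub>v (half_dim p)"
    using v by (simp add: mult_mat_vec_assoc_dim)
  finally have "?D *\<^sub>v v = 0\<^sub>v (p * p)" using v by (intro scalar_prod_self_eq_0[OF Dv]) simp
  then have "low_mat p *\<^sub>v (?D *\<^sub>v v) = 0\<^sub>v (half_dim p)"
    by (intro eq_vecI) (auto simp: length_low_positions scalar_prod_def)
  moreover have "low_mat p *\<^sub>v (?D *\<^sub>v v) = v"
    using v low_dup[of p] mult_mat_vec_assoc_dim[of "low_mat p" ?D v] by simp
  ultimately show False using v by simp
qed

lemma dup_pinv_dim [simp]: "dim_row (dup_pinv p) = half_dim p" "dim_col (dup_pinv p) = p * p"
proof -
  have "(dup_mat p)\<^sup>T * dup_mat p \<in> carrier_mat (half_dim p) (half_dim p)" by (intro carrier_matI) auto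
  from minv_works(1)[OF this dup_gram_nonsing]
  show "dim_row (dup_pinv p) = half_dim p" "dim_col (dup_pinv p) = p * p"
    by (simp_all add: dup_pinv_def)
qed

text \<open>Both sides are the orthogonal projection onto the vectorized symmetric matrices.\<close>

lemma dup_dup_pinv: "dup_mat p * dup_pinv p = M_mat p"
proof -
  let ?D = "dup_mat p" and ?L = "low_mat p"
  define G where "G = minv (?D\<^sup>T * ?D)"
  have c: "?D\<^sup>T * ?D \<in> carrier_mat (half_dim p) (half_dim p)" by (intro carrier_matI) auto
  note m = minv_works[OF c dup_gram_nonsing, folded G_def]
  have dG [simp]: "dim_row G = half_dim p" "dim_col G = half_dim p" using m(1) by auto
  have "(?D\<^sup>T * ?D)\<^sup>T = ?D\<^sup>T * ?D" by (simp add: transpose_mult_dim)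
  then have GT: "G\<^sup>T = G" using minv_transpose[OF c dup_gram_nonsing] by (simp add: G_def)
  define P where "P = ?D * (G * ?D\<^sup>T)"
  have dP [simp]: "dim_row P = p * p" "dim_col P = p * p" by (simp_all add: P_def)
  have "P * ?D = ?D * (G * (?D\<^sup>T * ?D))" by (simp add: P_def mult_mat_assoc_dim)
  then have PD: "P * ?D = ?D" using right_mult_one_mat[of ?D "p * p" "half_dim p"] m(3)
    by (simp add: carrier_matI)
  \<comment> \<open>\<open>P\<close> fixes the range of the duplication matrix, through which
    \<open>M_mat p\<close> factors. Transposition gives the same on the other side, where
    \<open>M_mat p\<close> is absorbed by duplication, and the two projections coincide.\<close>
  have "P * M_mat p = P * (?D * (?L * M_mat p))" by (simp add: dup_low_M)
  also have "\<dots> = (P * ?D) * (?L * M_mat p)"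
    by (rule mult_mat_assoc_dim[symmetric]) (simp_all add: length_low_positions)
  finally have PM: "P * M_mat p = M_mat p" by (simp add: PD dup_low_M)
  have "P\<^sup>T = P" by (simp add: P_def transpose_mult_dim GT mult_mat_assoc_dim)
  then have "M_mat p * P = M_mat p"
    using arg_cong[OF PM, of transpose_mat] by (simp add: transpose_mult_dim M_mat_transpose)
  moreover have "M_mat p * P = (M_mat p * ?D) * (G * ?D\<^sup>T)"
    unfolding P_def by (rule mult_mat_assoc_dim[symmetric]) simp_all
  ultimately show ?thesis by (simp add: M_dup P_def dup_pinv_def G_def)
qed

section \<open>The linearized completion\<close>

lemma mult_minus_distrib_dim:
  "dim_col A = dim_row B \<Longrightarrow> dim_row B = dim_row C \<Longrightarrow> dim_col B = dim_col C \<Longrightarrow>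
    A * (B - C) = A * B - A * (C :: real mat)"
  by (rule mult_minus_distrib_mat[of A "dim_row A" "dim_col A" B "dim_col B"]) auto

lemma minus_mult_distrib_dim:
  "dim_col A = dim_row C \<Longrightarrow> dim_row A = dim_row B \<Longrightarrow> dim_col A = dim_col B \<Longrightarrow>
    (A - B) * C = A * C - B * (C :: real mat)"
  by (rule minus_mult_distrib_mat[of A "dim_row A" "dim_col A" B C "dim_col C"]) auto

lemma minus_mult_vec_distrib_dim:
  "dim_col A = dim_vec x \<Longrightarrow> dim_row A = dim_row B \<Longrightarrow> dim_col A = dim_col B \<Longrightarrow>
    (A - B) *\<^sub>v x = A *\<^sub>v x - B *\<^sub>v (x :: real vec)"
  by (rule minus_mult_distrib_mat_vec[of A "dim_row A" "dim_col A" B x]) auto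

lemma transpose_minus_dim:
  "dim_row A = dim_row B \<Longrightarrow> dim_col A = dim_col B \<Longrightarrow> (A - B)\<^sup>T = A\<^sup>T - (B :: real mat)\<^sup>T"
  by (intro eq_matI) auto

lemma QD_dim [simp]: "dim_row (QD p E) = npos p (D_set p E)" "dim_col (QD p E) = p * p"
  by (simp_all add: QD_def)

text \<open>The matrix inverted in the explicit derivative formula. It is the block of the
  symmetrized sandwich map at the absent edges, and later the pivot of a Schur complement.\<close>

definition Schur_D :: "nat \<Rightarrow> nat set set \<Rightarrow> real mat \<Rightarrow> real mat" where
  "Schur_D p E K = QD p E * M_mat p * kron K K * (QD p E)\<^sup>T"

text \<open>The explicit derivative formula with \<open>K\<close> in place of the inverse
  completion. The correction term adjusts the absent entries so that the sandwich by
  \<open>K\<close> vanishes there.\<close>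

definition lin_mat :: "nat \<Rightarrow> nat set set \<Rightarrow> real mat \<Rightarrow> real mat" where
  "lin_mat p E K = M_mat p - M_mat p * ((QD p E)\<^sup>T * (minv (Schur_D p E K) * (QD p E * (kron K K * M_mat p))))"

lemma kron_M: "K \<in> carrier_mat p p \<Longrightarrow> kron K K * M_mat p = M_mat p * kron K K"
  by (rule M_mat_kron_commute[symmetric])

text \<open>Like \<open>kron_M_left\<close> below, a form for rewriting inside right-nested
  products: occurrences of \<open>M_mat p\<close> move to the front and merge.\<close>

lemma M_M_left: "dim_row X = p * p \<Longrightarrow> M_mat p * (M_mat p * X) = M_mat p * X"
  using mult_mat_assoc_dim[of "M_mat p" "M_mat p" X] by (simp add: M_mat_idem)

lemma kron_M_left:
  assumes "K \<in> carrier_mat p p" "dim_row X = p * p"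
  shows "kron K K * (M_mat p * X) = M_mat p * (kron K K * X)"
  using mult_mat_assoc_dim[of "kron K K" "M_mat p" X] mult_mat_assoc_dim[of "M_mat p" "kron K K" X]
    carrier_matD[OF assms(1)] assms(2) by (simp add: kron_M[OF assms(1)])

lemma kron_sandwich:
  assumes K: "K \<in> sym_mats p" and X: "X \<in> carrier_mat p p"
  shows "kron K K *\<^sub>v vec_op X = vec_op (K * X * K)"
  using kron_vec_op[OF sym_matsD(1)[OF K] sym_matsD(1)[OF K] X] sym_matsD(2)[OF K] by simp

lemma Schur_D_carrier:
  assumes K: "K \<in> carrier_mat p p"
  shows "Schur_D p E K \<in> carrier_mat (npos p (D_set p E)) (npos p (D_set p E))"
  using carrier_matD[OF K] by (intro carrier_matI) (simp_all add: Schur_D_def)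

lemma Schur_D_sym:
  assumes K: "K \<in> sym_mats p"
  shows "(Schur_D p E K)\<^sup>T = Schur_D p E K"
  using carrier_matD[OF sym_matsD(1)[OF K]]
  by (simp add: Schur_D_def transpose_mult_dim kron_transpose[OF sym_matsD(1)[OF K] sym_matsD(1)[OF K]]
      sym_matsD(2)[OF K] M_mat_transpose mult_mat_assoc_dim kron_M_left[OF sym_matsD(1)[OF K]])

text \<open>The quadratic form of this matrix at \<open>v\<close> is the sandwich form at the symmetric matrix that has
  the entries of \<open>v\<close> at the absent edges.\<close>

lemma Schur_D_nonsing:
  assumes K: "K \<in> pd_mats p"
  shows "det (Schur_D p E K) \<noteq> 0"
proof
  let ?Q = "QD p E" and ?n = "npos p (D_set p E)"
  note Kc = pd_mats_carrier[OF K] and Ks = pd_mats_sym[OF K]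
  note dK = carrier_matD[OF Kc]
  assume "det (Schur_D p E K) = 0"
  then obtain v where v: "v \<in> carrier_vec ?n" "v \<noteq> 0\<^sub>v ?n" "Schur_D p E K *\<^sub>v v = 0\<^sub>v ?n"
    using det_0_iff_vec_prod_zero[OF Schur_D_carrier[OF Kc]] by auto
  \<comment> \<open>Symmetrization leaves half of each entry of \<open>v\<close> at its absent
    position and half at the mirror position.\<close>
  define x where "x = M_mat p *\<^sub>v (?Q\<^sup>T *\<^sub>v v)"
  have x: "x \<in> carrier_vec (p * p)" by (rule carrier_vecI) (simp add: x_def)
  define X where "X = unvec p x"
  have X: "X \<in> carrier_mat p p" "vec_op X = x" by (simp_all add: X_def vec_op_unvec[OF x])
  have Kx: "kron K K *\<^sub>v x \<in> carrier_vec (p * p)" and Qv: "?Q\<^sup>T *\<^sub>v v \<in> carrier_vec (p * p)"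
    and MKx: "M_mat p *\<^sub>v (kron K K *\<^sub>v x) \<in> carrier_vec (p * p)"
    by (rule carrier_vecI, simp add: dK)+
  have Qc: "?Q \<in> carrier_mat ?n (p * p)" by (rule carrier_matI) simp_all
  have KXK: "K * X * K \<in> carrier_mat p p" by (intro carrier_matI) (simp_all add: dK)
  have "frob p X (K * X * K) = x \<bullet> (kron K K *\<^sub>v x)"
    by (simp only: scalar_prod_vec_op[OF X(1) KXK, symmetric] kron_sandwich[OF Ks X(1), symmetric] X(2))
  also have "\<dots> = (M_mat p *\<^sub>v (?Q\<^sup>T *\<^sub>v v)) \<bullet> (kron K K *\<^sub>v x)" by (simp only: x_def)
  also have "\<dots> = (?Q\<^sup>T *\<^sub>v v) \<bullet> (M_mat p *\<^sub>v (kron K K *\<^sub>v x))"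
    using scalar_prod_mult_mat_vec[OF M_mat_carrier Kx Qv] by (simp only: M_mat_transpose)
  also have "\<dots> = v \<bullet> (?Q *\<^sub>v (M_mat p *\<^sub>v (kron K K *\<^sub>v x)))"
    by (rule scalar_prod_mult_mat_vec[OF Qc MKx v(1), symmetric])
  also have "?Q *\<^sub>v (M_mat p *\<^sub>v (kron K K *\<^sub>v x)) = Schur_D p E K *\<^sub>v v"
  proof -
    have "?Q *\<^sub>v (M_mat p *\<^sub>v (kron K K *\<^sub>v x)) = (?Q * (M_mat p * (kron K K * (M_mat p * ?Q\<^sup>T)))) *\<^sub>v v"
      using v(1) by (simp add: mult_mat_vec_assoc_dim x_def dK)
    also have "?Q * (M_mat p * (kron K K * (M_mat p * ?Q\<^sup>T))) = Schur_D p E K"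
      by (simp add: kron_M_left[OF Kc] M_M_left Schur_D_def mult_mat_assoc_dim dK)
    finally show ?thesis .
  qed
  also have "v \<bullet> \<dots> = 0" using v by simp
  finally have "X = 0\<^sub>m p p" using sandwich_eq_0[OF K K X(1)] by simp
  then have x0: "x = 0\<^sub>v (p * p)"
    unfolding X(2)[symmetric] using idx_div_mod_less by (intro eq_vecI) (auto simp: vec_op_def)
  \<comment> \<open>Folding adds the two halves again, so \<open>v\<close> is recovered from
    \<open>x\<close> and must vanish with it.\<close>
  have "?Q *\<^sub>v (fold_mat p *\<^sub>v x) = (?Q * ((fold_mat p * M_mat p) * ?Q\<^sup>T)) *\<^sub>v v"
    using v(1) by (simp add: x_def mult_mat_vec_assoc_dim)
  also have "?Q * ((fold_mat p * M_mat p) * ?Q\<^sup>T) = 1\<^sub>m ?n"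
    using sel_fold_sel_one[OF D_set_subset(1), of p p E] by (simp add: fold_M QD_def mult_mat_assoc_dim)
  finally have "?Q *\<^sub>v (fold_mat p *\<^sub>v x) = v" using v(1) by simp
  moreover have "fold_mat p *\<^sub>v x = 0\<^sub>v (p * p)" unfolding x0 by (intro eq_vecI) (auto simp: scalar_prod_def)
  moreover have "?Q *\<^sub>v 0\<^sub>v (p * p) = 0\<^sub>v ?n" by (intro eq_vecI) (auto simp: scalar_prod_def)
  ultimately show False using v(2) by simp
qed

lemma minv_Schur_D:
  assumes K: "K \<in> pd_mats p"
  shows "dim_row (minv (Schur_D p E K)) = npos p (D_set p E)"
    "dim_col (minv (Schur_D p E K)) = npos p (D_set p E)"
    "Schur_D p E K * minv (Schur_D p E K) = 1\<^sub>m (npos p (D_set p E))"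
    "minv (Schur_D p E K) * Schur_D p E K = 1\<^sub>m (npos p (D_set p E))"
    "(minv (Schur_D p E K))\<^sup>T = minv (Schur_D p E K)"
  using minv_works[OF Schur_D_carrier[OF pd_mats_carrier[OF K]] Schur_D_nonsing[OF K], of E]
    minv_transpose[OF Schur_D_carrier[OF pd_mats_carrier[OF K]] Schur_D_nonsing[OF K], of E]
    Schur_D_sym[OF pd_mats_sym[OF K], of E]
  by auto

lemma lin_mat_dim:
  assumes K: "K \<in> pd_mats p"
  shows "dim_row (lin_mat p E K) = p * p" "dim_col (lin_mat p E K) = p * p"
  by (simp_all add: lin_mat_def)

lemma M_lin_mat:
  assumes K: "K \<in> pd_mats p"
  shows "M_mat p * lin_mat p E K = lin_mat p E K"
  using carrier_matD[OF pd_mats_carrier[OF K]]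
  by (simp add: lin_mat_def mult_minus_distrib_dim M_mat_idem M_M_left minv_Schur_D[OF K])

lemma lin_mat_M:
  assumes K: "K \<in> pd_mats p"
  shows "lin_mat p E K * M_mat p = lin_mat p E K"
  using carrier_matD[OF pd_mats_carrier[OF K]]
  by (simp add: lin_mat_def minus_mult_distrib_dim M_mat_idem mult_mat_assoc_dim minv_Schur_D[OF K])

text \<open>Sandwiching and selecting the absent edges turns the correction term into
  \<open>Schur_D\<close> times its inverse times the leading term, so the two cancel.\<close>

lemma QD_kron_lin_mat:
  assumes K: "K \<in> pd_mats p"
  shows "QD p E * (kron K K * lin_mat p E K) = 0\<^sub>m (npos p (D_set p E)) (p * p)"
proof -
  let ?Q = "QD p E" and ?S = "kron K K" and ?B = "Schur_D p E K"
  let ?R = "?Q * (?S * M_mat p)"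
  note dK = carrier_matD[OF pd_mats_carrier[OF K]]
  define G where "G = minv ?B"
  note m = minv_Schur_D[OF K, of E, folded G_def]
  have "?Q * (?S * lin_mat p E K) = ?R - ?Q * (?S * (M_mat p * (?Q\<^sup>T * (G * ?R))))"
    by (simp add: lin_mat_def mult_minus_distrib_dim dK m G_def[symmetric])
  also have "?Q * (?S * (M_mat p * (?Q\<^sup>T * (G * ?R)))) = ?B * (G * ?R)"
    by (simp add: kron_M_left[OF pd_mats_carrier[OF K]] Schur_D_def mult_mat_assoc_dim dK m)
  also have "\<dots> = (?B * G) * ?R"
    using carrier_matD[OF Schur_D_carrier[OF pd_mats_carrier[OF K], of E]]
    by (intro mult_mat_assoc_dim[symmetric]) (simp_all add: m dK)
  also have "\<dots> = ?R" unfolding m(3) by (rule left_mult_one_mat[OF carrier_matI]) (simp_all add: dK)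
  also have "?R - ?R = 0\<^sub>m (npos p (D_set p E)) (p * p)" by (intro eq_matI) simp_all
  finally show ?thesis .
qed

section \<open>The linearized completion as a map of matrices\<close>

definition lin_map :: "nat \<Rightarrow> nat set set \<Rightarrow> real mat \<Rightarrow> real mat \<Rightarrow> real mat" where
  "lin_map p E K X = unvec p (lin_mat p E K *\<^sub>v vec_op X)"

lemma lin_map_carrier [simp]: "lin_map p E K X \<in> carrier_mat p p"
  by (simp add: lin_map_def)

lemma vec_op_lin_map:
  assumes "K \<in> pd_mats p" "X \<in> carrier_mat p p"
  shows "vec_op (lin_map p E K X) = lin_mat p E K *\<^sub>v vec_op X"
  unfolding lin_map_def by (rule vec_op_unvec, rule carrier_vecI) (simp add: lin_mat_dim[OF assms(1)])

lemma lin_map_sym: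
  assumes K: "K \<in> pd_mats p" and X: "X \<in> carrier_mat p p"
  shows "lin_map p E K X \<in> sym_mats p"
  unfolding lin_map_def
proof (rule M_mat_fixed_sym)
  show "lin_mat p E K *\<^sub>v vec_op X \<in> carrier_vec (p * p)" by (rule carrier_vecI) (simp add: lin_mat_dim[OF K])
  show "M_mat p *\<^sub>v (lin_mat p E K *\<^sub>v vec_op X) = lin_mat p E K *\<^sub>v vec_op X"
    using mult_mat_vec_assoc_dim[of "M_mat p" "lin_mat p E K" "vec_op X"] carrier_matD[OF X]
    by (simp add: lin_mat_dim[OF K] M_lin_mat[OF K])
qed

text \<open>The correction symmetrizes a vector in the range of the transposed selection
  \<open>QD\<close>, hence is supported at absent edges and their mirror positions.\<close>

lemma lin_map_index:
  assumes K: "K \<in> pd_mats p" and X: "X \<in> sym_mats p"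
    and ij: "i < p" "j < p" "{i, j} \<in> E \<or> i = j"
  shows "lin_map p E K X $$ (i, j) = X $$ (i, j)"
proof -
  let ?Q = "QD p E"
  note Xc = sym_matsD(1)[OF X] and dK = carrier_matD[OF pd_mats_carrier[OF K]]
  note dX = carrier_matD[OF Xc]
  define w where "w = minv (Schur_D p E K) *\<^sub>v (?Q *\<^sub>v (kron K K *\<^sub>v (M_mat p *\<^sub>v vec_op X)))"
  have w: "w \<in> carrier_vec (npos p (D_set p E))"
    by (rule carrier_vecI) (simp add: w_def minv_Schur_D[OF K])
  define U where "U = unvec p (?Q\<^sup>T *\<^sub>v w)"
  have Uc: "U \<in> carrier_mat p p" by (simp add: U_def)
  have U: "vec_op U = ?Q\<^sup>T *\<^sub>v w" unfolding U_def by (rule vec_op_unvec, rule carrier_vecI) simp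
  have "lin_mat p E K *\<^sub>v vec_op X = vec_op X - M_mat p *\<^sub>v vec_op U"
    by (simp add: lin_mat_def minus_mult_vec_distrib_dim dX M_mat_vec_op_sym[OF X] mult_mat_vec_assoc_dim
        minv_Schur_D[OF K] dK U w_def)
  also have "\<dots> = vec_op (X - sym_part U)"
    by (simp only: M_mat_vec_op[OF Uc] vec_op_linear(2)[OF Xc sym_matsD(1)[OF sym_part_sym[OF Uc]]])
  finally have "lin_map p E K X = X - sym_part U"
    unfolding lin_map_def
    by (simp only: unvec_vec_op[OF minus_carrier_mat[OF sym_matsD(1)[OF sym_part_sym[OF Uc]]]])
  moreover have "(i, j) \<notin> D_set p E" "(j, i) \<notin> D_set p E"
    using ij(3) by (auto simp: D_set_def insert_commute)
  then have "U $$ (i, j) = 0" "U $$ (j, i) = 0"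
    using sel_mat_transpose_off[OF w] ij(1,2) unfolding U_def QD_def by blast+
  then have "sym_part U $$ (i, j) = 0" using ij(1,2) by (simp add: sym_part_def U_def del: unvec_index)
  moreover have "sym_part U \<in> carrier_mat p p" by (rule sym_matsD(1)[OF sym_part_sym]) (simp add: U_def)
  ultimately show ?thesis using ij(1,2) Xc by simp
qed

lemma sandwich_sym:
  assumes "K \<in> sym_mats p" "X \<in> sym_mats p"
  shows "K * X * K \<in> sym_mats p"
  using sym_matsD(1,2)[OF assms(1)] sym_matsD(1,2)[OF assms(2)]
  by (simp add: sym_mats_def transpose_mult_dim mult_mat_assoc_dim)

lemma QD_vec_op_eq_0:
  assumes X: "X \<in> sym_mats p" and "QD p E *\<^sub>v vec_op X = 0\<^sub>v (npos p (D_set p E))"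
    and ij: "i < p" "j < p" "{i, j} \<notin> E" "i \<noteq> j"
  shows "X $$ (i, j) = 0"
proof (cases "j < i")
  case True
  then show ?thesis using ij assms(2) unfolding QD_def
    by (intro sel_mat_vec_op_eq_0[OF sym_matsD(1)[OF X]]) (auto simp: D_set_def)
next
  case False
  then have "(j, i) \<in> D_set p E" using ij unfolding D_set_def by (simp add: insert_commute[of j i])
  then have "X $$ (j, i) = 0" using ij assms(2) unfolding QD_def
    by (intro sel_mat_vec_op_eq_0[OF sym_matsD(1)[OF X]])
  then show ?thesis using sym_matsD(3)[OF X ij(1,2)] by simp
qed

lemma lin_map_sandwich_index:
  assumes K: "K \<in> pd_mats p" and X: "X \<in> carrier_mat p p"
    and ij: "i < p" "j < p" "{i, j} \<notin> E" "i \<noteq> j"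
  shows "(K * lin_map p E K X * K) $$ (i, j) = 0"
proof (rule QD_vec_op_eq_0[OF sandwich_sym[OF pd_mats_sym[OF K] lin_map_sym[OF K X]] _ ij])
  note dK = carrier_matD[OF pd_mats_carrier[OF K]]
  have "QD p E *\<^sub>v vec_op (K * lin_map p E K X * K) = (QD p E * (kron K K * lin_mat p E K)) *\<^sub>v vec_op X"
    using carrier_matD[OF X]
    by (simp add: kron_sandwich[OF pd_mats_sym[OF K] lin_map_carrier, symmetric] vec_op_lin_map[OF K X]
        mult_mat_vec_assoc_dim dK lin_mat_dim[OF K])
  also have "\<dots> = 0\<^sub>v (npos p (D_set p E))"
    unfolding QD_kron_lin_mat[OF K] using carrier_matD[OF X] by (intro eq_vecI) (simp_all add: scalar_prod_def)
  finally show "QD p E *\<^sub>v vec_op (K * lin_map p E K X * K) = 0\<^sub>v (npos p (D_set p E))" .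
qed

lemma sandwich_minus:
  fixes K X Y :: "real mat"
  assumes "K \<in> carrier_mat p p" "X \<in> carrier_mat p p" "Y \<in> carrier_mat p p"
  shows "K * (X - Y) * K = K * X * K - K * Y * K"
  using assms by (simp add: mult_minus_distrib_dim minus_mult_distrib_dim)

text \<open>Two solutions differ only at absent edges, exactly where the sandwich of the difference
  vanishes, so the sandwich form is 0. This allows a value of \<open>lin_map\<close> to be
  recognized from its equations instead of the explicit formula.\<close>

lemma lin_map_unique:
  assumes K: "K \<in> pd_mats p" and X: "X \<in> sym_mats p" and Y: "Y \<in> sym_mats p"
    and on: "\<And>i j. i < p \<Longrightarrow> j < p \<Longrightarrow> {i, j} \<in> E \<or> i = j \<Longrightarrow> Y $$ (i, j) = X $$ (i, j)"
    and off: "\<And>i j. i < p \<Longrightarrow> j < p \<Longrightarrow> {i, j} \<notin> E \<Longrightarrow> i \<noteq> j \<Longrightarrow> (K * Y * K) $$ (i, j) = 0"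
  shows "lin_map p E K X = Y"
proof -
  note Xc = sym_matsD(1)[OF X] and Yc = sym_matsD(1)[OF Y] and Kc = pd_mats_carrier[OF K]
  let ?T = "lin_map p E K X"
  have T: "?T \<in> carrier_mat p p" by simp
  have c: "K * ?T * K \<in> carrier_mat p p" "K * Y * K \<in> carrier_mat p p"
    using carrier_matD[OF Kc] by (auto intro!: carrier_matI)
  have "frob p (?T - Y) (K * (?T - Y) * K) = 0"
  proof (rule frob_disjoint_support[where E = E])
    show "(?T - Y) $$ (i, j) = 0" if "i < p" "j < p" "{i, j} \<in> E \<or> i = j" for i j
      using lin_map_index[OF K X that] on[OF that] that Yc by simp
    show "(K * (?T - Y) * K) $$ (i, j) = 0" if "i < p" "j < p" "{i, j} \<notin> E" "i \<noteq> j" for i j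
    proof -
      have "(K * (?T - Y) * K) $$ (i, j) = (K * ?T * K) $$ (i, j) - (K * Y * K) $$ (i, j)"
        unfolding sandwich_minus[OF Kc T Yc]
        using that carrier_matD[OF c(2)] by (intro index_minus_mat(1)) (simp_all only:)
      then show ?thesis by (simp only: lin_map_sandwich_index[OF K Xc that] off[OF that] diff_self)
    qed
  qed
  then have 0: "?T - Y = 0\<^sub>m p p" using T Yc by (intro sandwich_eq_0[OF K K]) auto
  show ?thesis
  proof (rule eq_matI)
    fix i j assume ij: "i < dim_row Y" "j < dim_col Y"
    then have "(?T - Y) $$ (i, j) = 0" using Yc by (simp add: 0)
    then show "?T $$ (i, j) = Y $$ (i, j)" using ij Yc by simp
  qed (use carrier_matD[OF T] carrier_matD[OF Yc] in auto)
qed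

section \<open>Second-order expansion of the completion\<close>

lemma frob_eq_on_support:
  assumes "\<And>i j. i < p \<Longrightarrow> j < p \<Longrightarrow> {i, j} \<in> E \<or> i = j \<Longrightarrow> Y $$ (i, j) = Y' $$ (i, j)"
    and "\<And>i j. i < p \<Longrightarrow> j < p \<Longrightarrow> {i, j} \<notin> E \<Longrightarrow> i \<noteq> j \<Longrightarrow> Z $$ (i, j) = 0"
  shows "frob p Y Z = frob p Y' Z"
  unfolding frob_def
proof (intro sum.cong refl)
  fix i j assume "i \<in> {..<p}" "j \<in> {..<p}"
  then show "Y $$ (i, j) * Z $$ (i, j) = Y' $$ (i, j) * Z $$ (i, j)"
    using assms[of i j] by (cases "{i, j} \<in> E \<or> i = j") auto
qed

lemma coercive_antimono:
  assumes "coercive p a A" "b \<le> a"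
  shows "coercive p b A"
  unfolding coercive_def
proof
  fix x :: "real vec" assume "x \<in> carrier_vec p"
  then have "a * (x \<bullet> x) \<le> x \<bullet> (A *\<^sub>v x)" using assms(1) by (simp add: coercive_def)
  moreover have "b * (x \<bullet> x) \<le> a * (x \<bullet> x)" by (rule mult_right_mono[OF assms(2) scalar_prod_self_ge_0])
  ultimately show "b * (x \<bullet> x) \<le> x \<bullet> (A *\<^sub>v x)" by linarith
qed

text \<open>\<open>hG A\<close> and \<open>A\<close> have the same diagonal and the same inner product with \<open>(hG A)\<^sup>-\<^sup>1\<close>; this bounds
  the inverse from both sides in terms of \<open>A\<close> alone.\<close>

lemma minv_hG_bounds:
  assumes A: "A \<in> pd_mats p" "coercive p c A" "c > 0" and t: "mtrace p A \<le> t" "t > 0"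
  shows "coercive p (1 / t) (minv (hG p E A))" "fnorm p (minv (hG p E A)) \<le> real p / c"
proof -
  let ?B = "hG p E A"
  let ?K = "minv ?B"
  note B = hG_pd[OF A(1), of E]
  have "mtrace p ?B = mtrace p A" unfolding mtrace_def
    by (intro sum.cong refl hG_index[OF A(1)]) auto
  then show "coercive p (1 / t) ?K" using coercive_minv[OF B _ t(2)] t(1) by simp
  have "c * mtrace p ?K \<le> frob p ?K A"
    by (rule coercive_mtrace[OF minv_pd_mats[OF B] pd_mats_sym[OF A(1)] A(2)])
  also have "\<dots> = frob p A ?K" by (rule frob_commute)
  also have "\<dots> = frob p ?B ?K"
    by (rule frob_eq_on_support[where E = E]) (simp_all add: hG_index[OF A(1)] minv_hG_index[OF A(1)])
  also have "\<dots> = real p" using frob_minv[OF B] by (simp add: frob_commute)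
  finally have "mtrace p ?K \<le> real p / c" using A(3) by (simp add: field_simps)
  then show "fnorm p ?K \<le> real p / c" using fnorm_le_mtrace[OF minv_pd_mats[OF B]] by linarith
qed

lemma fnorm_minus_le:
  assumes "A \<in> carrier_mat p p" "B \<in> carrier_mat p p"
  shows "fnorm p (A - B) \<le> fnorm p A + fnorm p B"
proof -
  have "A - B = A + (- B)" using assms by (intro eq_matI) auto
  then show ?thesis using fnorm_add_le[of A p "- B"] assms by (simp add: fnorm_uminus)
qed

lemma frob_minus_right:
  assumes "B \<in> carrier_mat p p" "C \<in> carrier_mat p p"
  shows "frob p A (B - C) = frob p A B - frob p A C"
  using assms by (auto simp: frob_def sum_subtractf[symmetric] algebra_simps intro!: sum.cong)

lemma fnorm_sandwich_le:
  assumes "P \<in> carrier_mat p p" "X \<in> carrier_mat p p" "Q \<in> carrier_mat p p"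
    and "fnorm p P \<le> k" "fnorm p Q \<le> k"
  shows "fnorm p (P * X * Q) \<le> k * k * fnorm p X"
proof -
  have k: "k \<ge> 0" using assms(4) fnorm_ge_0[of p P] by linarith
  have "fnorm p (P * X * Q) \<le> fnorm p (P * X) * fnorm p Q"
    using assms by (intro fnorm_mult_le mult_carrier_mat[OF assms(1,2)] assms(3))
  also have "\<dots> \<le> (fnorm p P * fnorm p X) * fnorm p Q"
    by (intro mult_right_mono fnorm_mult_le assms fnorm_ge_0)
  also have "\<dots> \<le> (k * fnorm p X) * k"
    using k by (intro mult_mono mult_right_mono assms fnorm_ge_0 mult_nonneg_nonneg)
  finally show ?thesis by (simp add: mult_ac)
qed

text \<open>No implicit function theorem is needed: testing with the sandwich form gives first the
  Lipschitz bound for \<open>hG\<close> and then the quadratic bound for the remainder.\<close>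

lemma hG_expansion_step:
  fixes t k :: real and E :: "nat set set"
  assumes A: "A \<in> pd_mats p" and A': "A' \<in> pd_mats p"
  defines "B \<equiv> hG p E A" and "B' \<equiv> hG p E A'"
  defines "K \<equiv> minv B" and "K' \<equiv> minv B'"
  assumes co: "coercive p (1 / t) K" "coercive p (1 / t) K'" and t: "t > 0"
    and k: "fnorm p K \<le> k" "fnorm p K' \<le> k"
  defines "T \<equiv> lin_map p E K (A' - A)"
  shows "fnorm p (B' - B - T) \<le> t\<^sup>2 * (k^3 * (t\<^sup>2 * k\<^sup>2)\<^sup>2) * (fnorm p (A' - A))\<^sup>2"
    and "fnorm p (K' - K + K * T * K) \<le> (k\<^sup>2 * t\<^sup>2 + 1) * (k^3 * (t\<^sup>2 * k\<^sup>2)\<^sup>2) * (fnorm p (A' - A))\<^sup>2"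
proof -
  let ?D = "A' - A"
  define d where "d = B' - B"
  note B = hG_pd[OF A, of E, folded B_def] and B' = hG_pd[OF A', of E, folded B'_def]
  note K = minv_pd_mats[OF B, folded K_def] and K' = minv_pd_mats[OF B', folded K'_def]
  note c = pd_mats_carrier[OF A] pd_mats_carrier[OF A'] pd_mats_carrier[OF B] pd_mats_carrier[OF B']
    pd_mats_carrier[OF K] pd_mats_carrier[OF K']
  note dims = carrier_matD[OF c(1)] carrier_matD[OF c(2)] carrier_matD[OF c(3)] carrier_matD[OF c(4)]
    carrier_matD[OF c(5)] carrier_matD[OF c(6)]
  have D: "?D \<in> sym_mats p" by (rule sub_sym_mats[OF pd_mats_sym[OF A'] pd_mats_sym[OF A]])
  note Dc = sym_matsD(1)[OF D]
  have ds: "d \<in> sym_mats p" unfolding d_def by (rule sub_sym_mats[OF pd_mats_sym[OF B'] pd_mats_sym[OF B]])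
  note dc = sym_matsD(1)[OF ds] and dd = carrier_matD[OF sym_matsD(1)[OF ds]]
  have Ts: "T \<in> sym_mats p" unfolding T_def by (rule lin_map_sym[OF K Dc])
  note Tc = sym_matsD(1)[OF Ts] and dT = carrier_matD[OF sym_matsD(1)[OF Ts]]
  have k0: "k \<ge> 0" using k(1) fnorm_ge_0[of p K] by linarith
  have diff: "K - K' = K * d * K'" unfolding K_def K'_def d_def by (rule minv_diff[OF B B'])
  have KK': "K - K' \<in> carrier_mat p p" by (rule minus_carrier_mat[OF c(6)])
  have d_on: "d $$ (i, j) = ?D $$ (i, j)" if "i < p" "j < p" "{i, j} \<in> E \<or> i = j" for i j
  proof -
    have "d $$ (i, j) = B' $$ (i, j) - B $$ (i, j)" using that(1,2) by (simp add: d_def dims)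
    also have "\<dots> = A' $$ (i, j) - A $$ (i, j)"
      unfolding B_def B'_def by (simp only: hG_index[OF A that] hG_index[OF A' that])
    also have "\<dots> = ?D $$ (i, j)" using that(1,2) by (simp add: dims)
    finally show ?thesis .
  qed
  have off: "(K - K') $$ (i, j) = 0" if "i < p" "j < p" "{i, j} \<notin> E" "i \<noteq> j" for i j
  proof -
    have "(K - K') $$ (i, j) = K $$ (i, j) - K' $$ (i, j)" using that(1,2) by (simp add: dims)
    then show ?thesis
      unfolding K_def K'_def B_def B'_def by (simp only: minv_hG_index[OF A that] minv_hG_index[OF A' that] diff_self)
  qed
  define f where "f = fnorm p ?D"
  have f0: "f \<ge> 0" by (simp add: f_def fnorm_ge_0)
  have lip: "fnorm p d \<le> t\<^sup>2 * k\<^sup>2 * f"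
  proof -
    \<comment> \<open>The two coercivity constants 1/t bound the form below. On the right
      \<open>d\<close> is exchanged for the data increment, which agrees with it where
      \<open>K - K'\<close> lives, and the norm of \<open>K * d * K'\<close> is at most
      \<open>k * k\<close> times that of \<open>d\<close>. Cancelling one factor leaves the
      Lipschitz constant.\<close>
    have "1 / t * (1 / t) * frob p d d \<le> frob p d (K * d * K')"
      using t by (intro coercive_frob_sandwich K co pd_mats_sym[OF K'] dc) simp
    also have "\<dots> = frob p d (K - K')" by (simp only: diff)
    also have "\<dots> = frob p ?D (K - K')" by (rule frob_eq_on_support[where E = E]) (fact d_on, fact off)
    also have "\<dots> \<le> fnorm p ?D * fnorm p (K - K')" using abs_frob_le[of p ?D "K - K'"] by linarith
    also have "\<dots> \<le> f * (k * k * fnorm p d)" unfolding diff f_def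
      by (intro mult_left_mono fnorm_sandwich_le c dc k fnorm_ge_0)
    finally have "fnorm p d * fnorm p d \<le> (t\<^sup>2 * k\<^sup>2 * f) * fnorm p d"
      using t by (simp add: frob_self power2_eq_square field_simps)
    then show ?thesis
      using fnorm_ge_0[of p d] k0 f0 by (cases "fnorm p d = 0") (auto simp: mult_le_cancel_right)
  qed
  \<comment> \<open>The quadratic term left over when the resolvent identity is inserted into
    itself: \<open>K * d * K\<close> is \<open>K - K'\<close> plus \<open>R\<close>.\<close>
  define R where "R = K * d * (K * d * K')"
  have dR: "dim_row R = p" "dim_col R = p" by (simp_all add: R_def dims)
  then have Rc: "R \<in> carrier_mat p p" by auto
  have KdK: "K * d * K = K - K' + R"
  proof -
    have "R = K * d * (K - K')" by (simp only: R_def diff)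
    also have "\<dots> = K * d * K - K * d * K'" by (rule mult_minus_distrib_dim) (simp_all add: dims dd)
    finally have R: "R = K * d * K - (K - K')" by (simp only: diff)
    show ?thesis unfolding R
      by (rule eq_matI) (simp_all add: dims dd del: index_mult_mat(1) assoc_mult_mat)
  qed
  define b where "b = k^3 * (t\<^sup>2 * k\<^sup>2)\<^sup>2 * f\<^sup>2"
  have fR: "fnorm p R \<le> b"
  proof -
    have Kdc: "K * d \<in> carrier_mat p p" and KdK'c: "K * d * K' \<in> carrier_mat p p"
      using diff KK' by (auto intro: mult_carrier_mat[OF c(5) dc])
    have "fnorm p R \<le> fnorm p (K * d) * fnorm p (K * d * K')" unfolding R_def by (rule fnorm_mult_le[OF Kdc KdK'c])
    also have "\<dots> \<le> (k * fnorm p d) * (k * k * fnorm p d)"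
    proof (rule mult_mono)
      have "fnorm p (K * d) \<le> fnorm p K * fnorm p d" by (rule fnorm_mult_le[OF c(5) dc])
      also have "\<dots> \<le> k * fnorm p d" by (rule mult_right_mono[OF k(1) fnorm_ge_0])
      finally show "fnorm p (K * d) \<le> k * fnorm p d" .
    qed (use k0 fnorm_ge_0 in \<open>auto intro: fnorm_sandwich_le[OF c(5) dc c(6) k]\<close>)
    also have "\<dots> = k^3 * (fnorm p d)\<^sup>2" by (simp add: power2_eq_square power3_eq_cube)
    also have "\<dots> \<le> k^3 * (t\<^sup>2 * k\<^sup>2 * f)\<^sup>2"
      using k0 by (intro mult_left_mono power_mono lip fnorm_ge_0) simp
    finally show ?thesis by (simp add: b_def power_mult_distrib)
  qed
  define Y where "Y = d - T"
  have Yc: "Y \<in> carrier_mat p p" unfolding Y_def by (rule minus_carrier_mat[OF Tc])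
  note dY = carrier_matD[OF Yc]
  have KYK: "K * Y * K = K * d * K - K * T * K" unfolding Y_def by (rule sandwich_minus[OF c(5) dc Tc])
  have KTKc: "K * T * K \<in> carrier_mat p p" and KdKc: "K * d * K \<in> carrier_mat p p"
    by (rule carrier_matI; simp add: dims dT dd)+
  have fY: "fnorm p Y \<le> t\<^sup>2 * b"
  proof -
    have Y_on: "Y $$ (i, j) = 0" if "i < p" "j < p" "{i, j} \<in> E \<or> i = j" for i j
      using d_on[OF that] lin_map_index[OF K D that] that by (simp add: Y_def T_def[symmetric] dT dd)
    have "1 / t * (1 / t) * frob p Y Y \<le> frob p Y (K * Y * K)"
      using t by (intro coercive_frob_sandwich K co pd_mats_sym[OF K] Yc) simp
    \<comment> \<open>\<open>Y\<close> vanishes on the diagonal and the edges, while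
      \<open>K - K'\<close> and \<open>K * T * K\<close> vanish at the absent edges. Only the
      quadratic term \<open>R\<close> survives.\<close>
    also have "\<dots> = frob p Y (K - K') + frob p Y R - frob p Y (K * T * K)"
      unfolding KYK KdK
      by (simp only: frob_minus_right[OF add_carrier_mat[OF Rc] KTKc] frob_add_right[OF KK' Rc])
    also have "frob p Y (K - K') = 0" by (rule frob_disjoint_support[where E = E]) (fact Y_on, fact off)
    also have "frob p Y (K * T * K) = 0" unfolding T_def
      by (rule frob_disjoint_support[where E = E]) (fact Y_on, fact lin_map_sandwich_index[OF K Dc])
    also have "0 + frob p Y R - 0 \<le> fnorm p Y * b"
      using abs_frob_le[of p Y R] mult_left_mono[OF fR fnorm_ge_0[of p Y]] by linarith
    finally have *: "fnorm p Y * fnorm p Y \<le> (t\<^sup>2 * b) * fnorm p Y"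
      using t by (simp add: frob_self power2_eq_square field_simps)
    have "b \<ge> 0" using fR fnorm_ge_0[of p R] by linarith
    with * show ?thesis
      using fnorm_ge_0[of p Y] by (cases "fnorm p Y = 0") (auto simp: mult_le_cancel_right)
  qed
  then show "fnorm p (B' - B - T) \<le> t\<^sup>2 * (k^3 * (t\<^sup>2 * k\<^sup>2)\<^sup>2) * (fnorm p (A' - A))\<^sup>2"
    by (simp add: Y_def d_def b_def f_def mult_ac)
  \<comment> \<open>The error for the inverse needs no new estimate: it combines the quadratic term
    with the sandwich of the error \<open>Y\<close> of the completion.\<close>
  have "K' - K + K * T * K = R - K * Y * K" unfolding KYK KdK
    by (rule eq_matI) (simp_all add: dims dT dR del: index_mult_mat(1) assoc_mult_mat)
  then have "fnorm p (K' - K + K * T * K) \<le> fnorm p R + fnorm p (K * Y * K)"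
    using fnorm_minus_le[OF Rc, of "K * Y * K"] c Yc by (metis mult_carrier_mat)
  also have "\<dots> \<le> b + k * k * (t\<^sup>2 * b)"
    using k0 by (intro add_mono fR order.trans[OF fnorm_sandwich_le[OF c(5) Yc c(5) k(1) k(1)]] mult_left_mono fY) auto
  finally show "fnorm p (K' - K + K * T * K) \<le> (k\<^sup>2 * t\<^sup>2 + 1) * (k^3 * (t\<^sup>2 * k\<^sup>2)\<^sup>2) * (fnorm p (A' - A))\<^sup>2"
    by (simp add: b_def f_def power2_eq_square algebra_simps)
qed

lemma hG_expansion:
  assumes A: "A \<in> pd_mats p"
  obtains C \<delta> where "C \<ge> 0" "\<delta> > 0"
    "\<And>X. X \<in> sym_mats p \<Longrightarrow> fnorm p X \<le> \<delta> \<Longrightarrow> A + X \<in> pd_mats p"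
    "\<And>X. X \<in> sym_mats p \<Longrightarrow> fnorm p X \<le> \<delta> \<Longrightarrow>
      fnorm p (hG p E (A + X) - hG p E A - lin_map p E (minv (hG p E A)) X) \<le> C * (fnorm p X)\<^sup>2"
    "\<And>X. X \<in> sym_mats p \<Longrightarrow> fnorm p X \<le> \<delta> \<Longrightarrow>
      fnorm p (minv (hG p E (A + X)) - minv (hG p E A) + minv (hG p E A) * lin_map p E (minv (hG p E A)) X * minv (hG p E A))
        \<le> C * (fnorm p X)\<^sup>2"
proof -
  obtain a where a: "a > 0" "coercive p a A" by (rule pd_mats_coercive[OF A])
  \<comment> \<open>Half of \<open>a\<close> is spent on the perturbation, so coercivity a/2
    remains; the bound 1 lets each diagonal entry grow by at most 1, hence the trace by at most p.
    The extra 1 in \<open>t\<close> makes it positive for p = 0, \<open>k\<close> is the inverse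
    bound for coercivity a/2, and \<open>C\<close> dominates both error constants.\<close>
  define \<delta> where "\<delta> = min (a / 2) 1"
  define t where "t = mtrace p A + real p + 1"
  define k where "k = real p / (a / 2)"
  define C where "C = (k\<^sup>2 * t\<^sup>2 + 1 + t\<^sup>2) * (k^3 * (t\<^sup>2 * k\<^sup>2)\<^sup>2)"
  note Ac = pd_mats_carrier[OF A]
  have t: "t > 0" using mtrace_pd_ge_0[OF A] by (simp add: t_def)
  have k: "k \<ge> 0" using a by (simp add: k_def)
  have pd: "A + X \<in> pd_mats p \<and> coercive p (a / 2) (A + X) \<and> mtrace p (A + X) \<le> t"
    if X: "X \<in> sym_mats p" "fnorm p X \<le> \<delta>" for X
  proof (intro conjI)
    note Xc = sym_matsD(1)[OF X(1)]
    have "fnorm p X \<le> a / 2" using X by (simp add: \<delta>_def)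
    from coercive_add[OF Ac a(2) Xc this] show co: "coercive p (a / 2) (A + X)" by simp
    from coercive_imp_pd_mats[OF add_sym_mats[OF pd_mats_sym[OF A] X(1)] this]
    show "A + X \<in> pd_mats p" using a by simp
    have "mtrace p X \<le> (\<Sum>i<p. 1)" unfolding mtrace_def
    proof (rule sum_mono)
      fix i assume "i \<in> {..<p}"
      then have "\<bar>X $$ (i, i)\<bar> \<le> fnorm p X" by (intro abs_index_le_fnorm) auto
      then show "X $$ (i, i) \<le> 1" using X(2) unfolding \<delta>_def by linarith
    qed
    moreover have "mtrace p (A + X) = mtrace p A + mtrace p X"
      unfolding mtrace_def sum.distrib[symmetric] using Ac Xc by (intro sum.cong refl) auto
    ultimately show "mtrace p (A + X) \<le> t" by (simp add: t_def)
  qed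
  have coA: "coercive p (a / 2) A" using a by (intro coercive_antimono[OF a(2)]) simp
  have a2: "a / 2 > 0" and tA: "mtrace p A \<le> t" using a by (simp_all add: t_def)
  note bA = minv_hG_bounds[OF A coA a2 tA t, of E, folded k_def]
  have AX: "A + X - A = X" if "X \<in> sym_mats p" for X
    using sym_matsD(1)[OF that] Ac by (intro eq_matI) auto
  have main: "fnorm p (hG p E (A + X) - hG p E A - lin_map p E (minv (hG p E A)) X)
        \<le> t\<^sup>2 * (k^3 * (t\<^sup>2 * k\<^sup>2)\<^sup>2) * (fnorm p X)\<^sup>2 \<and>
      fnorm p (minv (hG p E (A + X)) - minv (hG p E A) + minv (hG p E A) * lin_map p E (minv (hG p E A)) X * minv (hG p E A))
        \<le> (k\<^sup>2 * t\<^sup>2 + 1) * (k^3 * (t\<^sup>2 * k\<^sup>2)\<^sup>2) * (fnorm p X)\<^sup>2"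
    if X: "X \<in> sym_mats p" "fnorm p X \<le> \<delta>" for X
  proof -
    note q = pd[OF X, THEN conjunct1] pd[OF X, THEN conjunct2, THEN conjunct1] pd[OF X, THEN conjunct2, THEN conjunct2]
    note bX = minv_hG_bounds[OF q(1,2) a2 q(3) t, of E, folded k_def]
    show ?thesis
      using hG_expansion_step[OF A q(1) bA(1) bX(1) t bA(2) bX(2)] by (simp only: AX[OF X(1)])
  qed
  have C1: "t\<^sup>2 * (k^3 * (t\<^sup>2 * k\<^sup>2)\<^sup>2) \<le> C" and C2: "(k\<^sup>2 * t\<^sup>2 + 1) * (k^3 * (t\<^sup>2 * k\<^sup>2)\<^sup>2) \<le> C"
    unfolding C_def using k by (intro mult_right_mono; simp)+
  show thesis
  proof (rule that[of C \<delta>])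
    have "0 \<le> t\<^sup>2 * (k^3 * (t\<^sup>2 * k\<^sup>2)\<^sup>2)" using k by simp
    then show "C \<ge> 0" using C1 by linarith
    show "\<delta> > 0" using a by (simp add: \<delta>_def)
  qed (use main pd mult_right_mono[OF C1 zero_le_power2] mult_right_mono[OF C2 zero_le_power2] in \<open>blast intro: order.trans\<close>)+
qed

section \<open>The derivative and the covariance of the limit\<close>

lemma deriv_quadratic_remainder:
  fixes g :: "real \<Rightarrow> real"
  assumes d: "d > 0" and bound: "\<And>t. \<bar>t\<bar> \<le> d \<Longrightarrow> \<bar>g t - g 0 - t * c\<bar> \<le> C * t\<^sup>2"
  shows "deriv g 0 = c"
proof (rule DERIV_imp_deriv)
  have "((\<lambda>t. (g (0 + t) - g 0) / t - c) \<longlongrightarrow> 0) (at 0)"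
  proof (rule Lim_null_comparison)
    have "eventually (\<lambda>t. \<bar>t\<bar> < d) (at (0::real))"
      using d by (intro order_tendstoD(2)[where y = "\<bar>0\<bar>"] tendsto_intros) auto
    moreover have "eventually (\<lambda>t. t \<noteq> 0) (at (0::real))" by (simp add: eventually_at_filter)
    ultimately show "\<forall>\<^sub>F t in at 0. norm ((g (0 + t) - g 0) / t - c) \<le> C * \<bar>t\<bar>"
    proof eventually_elim
      case (elim t)
      have "(g (0 + t) - g 0) / t - c = (g t - g 0 - t * c) / t" using elim by (simp add: field_simps)
      then have "norm ((g (0 + t) - g 0) / t - c) = \<bar>g t - g 0 - t * c\<bar> / \<bar>t\<bar>" by simp
      also have "\<dots> \<le> (C * t\<^sup>2) / \<bar>t\<bar>" using bound[of t] elim by (intro divide_right_mono) auto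
      also have "t\<^sup>2 = \<bar>t\<bar> * \<bar>t\<bar>" by (simp only: power2_eq_square abs_mult_self_eq)
      also have "C * (\<bar>t\<bar> * \<bar>t\<bar>) / \<bar>t\<bar> = C * \<bar>t\<bar>"
        using elim by (cases "t > 0") (simp_all add: abs_of_neg not_less)
      finally show ?case .
    qed
    show "((\<lambda>t. C * \<bar>t\<bar>) \<longlongrightarrow> 0) (at (0::real))" by (auto intro!: tendsto_eq_intros)
  qed
  then show "(g has_field_derivative c) (at 0)"
    unfolding DERIV_def by (simp add: LIM_zero_iff)
qed

lemma lin_map_smult:
  assumes K: "K \<in> pd_mats p" and X: "X \<in> carrier_mat p p"
  shows "lin_map p E K (t \<cdot>\<^sub>m X) = t \<cdot>\<^sub>m lin_map p E K X"
proof -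
  have L: "lin_mat p E K \<in> carrier_mat (p * p) (p * p)"
    by (rule carrier_matI) (simp_all only: lin_mat_dim[OF K])
  have "lin_mat p E K *\<^sub>v (t \<cdot>\<^sub>v vec_op X) = t \<cdot>\<^sub>v (lin_mat p E K *\<^sub>v vec_op X)"
    by (rule mult_mat_vec[OF L vec_op_carrier[OF X]])
  then have "unvec p (lin_mat p E K *\<^sub>v vec_op (t \<cdot>\<^sub>m X)) = t \<cdot>\<^sub>m unvec p (lin_mat p E K *\<^sub>v vec_op X)"
    unfolding vec_op_linear(3)[OF X X]
    using vec_idx_less carrier_matD[OF L] by (intro eq_matI) (simp_all del: index_mult_mat_vec)
  then show ?thesis by (simp only: lin_map_def)
qed

lemma dup_mat_unit:
  assumes "j < half_dim p"
  shows "dup_mat p *\<^sub>v unit_vec (half_dim p) j = vec_op (sym_of_vech p (unit_vec (half_dim p) j))"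
  using dup_mat_vech[OF sym_of_vech_sym, of p "unit_vec (half_dim p) j"] by (simp add: vech_sym_of_vech)

lemma smult_sym_mats: "X \<in> sym_mats p \<Longrightarrow> t \<cdot>\<^sub>m X \<in> sym_mats p"
proof (rule sym_matsI)
  assume X: "X \<in> sym_mats p"
  show "t \<cdot>\<^sub>m X \<in> carrier_mat p p" using sym_matsD(1)[OF X] by simp
  show "(t \<cdot>\<^sub>m X) $$ (i, j) = (t \<cdot>\<^sub>m X) $$ (j, i)" if "i < p" "j < p" for i j
    using that carrier_matD[OF sym_matsD(1)[OF X]] sym_matsD(3)[OF X that] by simp
qed

lemma fnorm_smult:
  assumes "X \<in> carrier_mat p p"
  shows "fnorm p (t \<cdot>\<^sub>m X) = \<bar>t\<bar> * fnorm p X"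
proof -
  have "frob p (t \<cdot>\<^sub>m X) (t \<cdot>\<^sub>m X) = t\<^sup>2 * frob p X X"
    unfolding frob_def using assms by (auto simp: sum_distrib_left power2_eq_square mult_ac intro!: sum.cong)
  then show ?thesis by (simp add: fnorm_def real_sqrt_mult)
qed

text \<open>A step in one half-vectorized coordinate is a step along a fixed symmetric matrix
  \<open>S\<close>, so the expansion restricted to the line through \<open>A\<close> has a quadratic
  error in \<open>t\<close>.\<close>

lemma hG_tilde_deriv:
  assumes A: "A \<in> pd_mats p" and ij: "i < half_dim p" "j < half_dim p"
  shows "deriv (\<lambda>t. hG_tilde p E (vech p A + t \<cdot>\<^sub>v unit_vec (half_dim p) j) $ i) 0
    = (low_mat p *\<^sub>v (lin_mat p E (minv (hG p E A)) *\<^sub>v (dup_mat p *\<^sub>v unit_vec (half_dim p) j))) $ i"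
proof -
  define K where "K = minv (hG p E A)"
  have K: "K \<in> pd_mats p" unfolding K_def by (intro minv_pd_mats hG_pd A)
  let ?e = "unit_vec (half_dim p) j"
  define S where "S = sym_of_vech p ?e"
  have S: "S \<in> sym_mats p" by (simp add: S_def)
  note Sc = sym_matsD(1)[OF S] and Ac = pd_mats_carrier[OF A]
  have tSc: "t \<cdot>\<^sub>m S \<in> carrier_mat p p" for t using Sc by simp
  obtain C \<delta> where C: "C \<ge> 0" and \<delta>: "\<delta> > 0"
    and pd: "\<And>X. X \<in> sym_mats p \<Longrightarrow> fnorm p X \<le> \<delta> \<Longrightarrow> A + X \<in> pd_mats p"
    and bound: "\<And>X. X \<in> sym_mats p \<Longrightarrow> fnorm p X \<le> \<delta> \<Longrightarrow>
      fnorm p (hG p E (A + X) - hG p E A - lin_map p E K X) \<le> C * (fnorm p X)\<^sup>2"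
    unfolding K_def using hG_expansion[OF A, of E] by metis
  define z where "z = positions p low_set ! i"
  have il: "i < npos p low_set" using ij by (simp add: length_low_positions)
  have z: "fst z < p" "snd z < p" using positions_nth[OF il] by (simp_all add: z_def)
  have unv: "unvech p (vech p A + t \<cdot>\<^sub>v ?e) = A + t \<cdot>\<^sub>m S" for t
  proof -
    have "vech p (A + t \<cdot>\<^sub>m S) = low_mat p *\<^sub>v (vec_op A + t \<cdot>\<^sub>v vec_op S)"
      by (simp only: vech_eq[OF add_carrier_mat[OF tSc]] vec_op_linear(1)[OF Ac tSc] vec_op_linear(3)[OF Sc Sc])
    also have "\<dots> = vech p A + t \<cdot>\<^sub>v vech p S"
      unfolding vech_eq[OF Ac] vech_eq[OF Sc]
      using mult_add_distrib_mat_vec[OF low_mat_carrier vec_op_carrier[OF Ac] smult_carrier_vec[THEN iffD2, OF vec_op_carrier[OF Sc]]]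
        mult_mat_vec[OF low_mat_carrier vec_op_carrier[OF Sc]] by simp
    also have "vech p S = ?e" by (simp add: S_def vech_sym_of_vech)
    finally have "vech p (A + t \<cdot>\<^sub>m S) = vech p A + t \<cdot>\<^sub>v ?e" .
    then show ?thesis
      using unvech_vech[OF add_sym_mats[OF pd_mats_sym[OF A] smult_sym_mats[OF S]], of t] by simp
  qed
  define g where "g t = hG_tilde p E (vech p A + t \<cdot>\<^sub>v ?e) $ i" for t
  have g: "g t = hG p E (A + t \<cdot>\<^sub>m S) $$ z" if "A + t \<cdot>\<^sub>m S \<in> pd_mats p" for t
    unfolding g_def hG_tilde_def unv z_def
    using pd_mats_carrier[OF hG_pd[OF that]] il
    by (simp add: vech_eq sel_mat_vec_op del: index_mult_mat_vec)
  define c where "c = lin_map p E K S $$ z"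
  have "deriv g 0 = c"
  proof (rule deriv_quadratic_remainder)
    \<comment> \<open>The radius keeps the norm of \<open>t * S\<close> within \<delta>; the summand
      1 avoids division by zero.\<close>
    show "0 < \<delta> / (fnorm p S + 1)" using \<delta> fnorm_ge_0[of p S] by simp
    fix t :: real assume t: "\<bar>t\<bar> \<le> \<delta> / (fnorm p S + 1)"
    have tS: "t \<cdot>\<^sub>m S \<in> sym_mats p" by (rule smult_sym_mats[OF S])
    have "\<bar>t\<bar> * (fnorm p S + 1) \<le> \<delta>" using t fnorm_ge_0[of p S] by (simp add: pos_le_divide_eq)
    then have small: "fnorm p (t \<cdot>\<^sub>m S) \<le> \<delta>" by (simp add: fnorm_smult[OF Sc] algebra_simps)
    note pdt = pd[OF tS small]
    have pd0: "A + 0 \<cdot>\<^sub>m S \<in> pd_mats p"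
      using pd[OF smult_sym_mats[OF S, of 0]] \<delta> by (simp add: fnorm_smult[OF Sc])
    have A0: "A + 0 \<cdot>\<^sub>m S = A" using Ac Sc by (intro eq_matI) auto
    have B: "hG p E A \<in> carrier_mat p p" and Bt: "hG p E (A + t \<cdot>\<^sub>m S) \<in> carrier_mat p p"
      by (rule pd_mats_carrier[OF hG_pd[OF A]], rule pd_mats_carrier[OF hG_pd[OF pdt]])
    have lz: "lin_map p E K (t \<cdot>\<^sub>m S) $$ z = t * c"
      unfolding lin_map_smult[OF K Sc] c_def using z carrier_matD[OF lin_map_carrier[of p E K S]]
      by (cases z) (simp only: index_smult_mat fst_conv snd_conv)
    have "g t - g 0 - t * c = (hG p E (A + t \<cdot>\<^sub>m S) - hG p E A - lin_map p E K (t \<cdot>\<^sub>m S)) $$ z"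
      unfolding g[OF pdt] g[OF pd0] A0 lz[symmetric]
      using z carrier_matD[OF B] carrier_matD[OF lin_map_carrier[of p E K "t \<cdot>\<^sub>m S"]]
      by (cases z) (simp only: index_minus_mat fst_conv snd_conv)
    also have "\<bar>\<dots>\<bar> \<le> fnorm p (hG p E (A + t \<cdot>\<^sub>m S) - hG p E A - lin_map p E K (t \<cdot>\<^sub>m S))"
      using abs_index_le_fnorm[OF z] by simp
    also have "\<dots> \<le> C * (fnorm p (t \<cdot>\<^sub>m S))\<^sup>2" by (rule bound[OF tS small])
    also have "\<dots> = (C * (fnorm p S)\<^sup>2) * t\<^sup>2" by (simp add: fnorm_smult[OF Sc] power_mult_distrib)
    finally show "\<bar>g t - g 0 - t * c\<bar> \<le> (C * (fnorm p S)\<^sup>2) * t\<^sup>2" .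
  qed
  moreover have "c = (low_mat p *\<^sub>v (lin_mat p E K *\<^sub>v (dup_mat p *\<^sub>v ?e))) $ i"
    unfolding dup_mat_unit[OF ij(2)] S_def[symmetric] vec_op_lin_map[OF K Sc, symmetric]
    by (simp only: sel_mat_vec_op[OF lin_map_carrier il] c_def z_def)
  ultimately show ?thesis by (simp only: g_def[abs_def] K_def)
qed

text \<open>This is the explicit formula for the derivative. The Jacobi matrix is
  \<open>lin_mat\<close> between restriction to the lower triangle and duplication; the outer
  factors combine to copies of \<open>M_mat p\<close>, which \<open>lin_mat\<close> absorbs on
  either side.\<close>

lemma DhG_eq_lin_mat:
  assumes A: "A \<in> pd_mats p"
  shows "DhG p E A = lin_mat p E (minv (hG p E A))"
proof -
  define L where "L = lin_mat p E (minv (hG p E A))"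
  have K: "minv (hG p E A) \<in> pd_mats p" by (intro minv_pd_mats hG_pd A)
  have dL [simp]: "dim_row L = p * p" "dim_col L = p * p" by (simp_all only: L_def lin_mat_dim[OF K])
  let ?J = "low_mat p * (L * dup_mat p)"
  have J: "?J \<in> carrier_mat (half_dim p) (half_dim p)"
    by (rule carrier_matI) (simp_all add: length_low_positions)
  have "jacobi (half_dim p) (half_dim p) (hG_tilde p E) (vech p A) = ?J"
  proof (rule eq_matI)
    fix i j assume "i < dim_row ?J" "j < dim_col ?J"
    then have ij: "i < half_dim p" "j < half_dim p" using J by auto
    have "?J $$ (i, j) = (?J *\<^sub>v unit_vec (half_dim p) j) $ i"
      by (rule mult_mat_unit_vec_index[OF J ij, symmetric])
    also have "?J *\<^sub>v unit_vec (half_dim p) j = low_mat p *\<^sub>v (L *\<^sub>v (dup_mat p *\<^sub>v unit_vec (half_dim p) j))"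
      by (simp add: mult_mat_vec_assoc_dim)
    finally show "jacobi (half_dim p) (half_dim p) (hG_tilde p E) (vech p A) $$ (i, j) = ?J $$ (i, j)"
      using ij by (simp only: jacobi_def index_mat split_conv hG_tilde_deriv[OF A ij] L_def)
  qed (use carrier_matD[OF J] in \<open>simp_all only: jacobi_def dim_row_mat dim_col_mat\<close>)
  then have "DhG p E A = dup_mat p * ?J * dup_pinv p" by (simp only: DhG_def)
  also have "\<dots> = dup_mat p * (low_mat p * (L * (dup_mat p * dup_pinv p)))"
    by (simp add: mult_mat_assoc_dim length_low_positions)
  also have "\<dots> = dup_mat p * (low_mat p * (M_mat p * L))"
    by (simp only: dup_dup_pinv L_def lin_mat_M[OF K] M_lin_mat[OF K])
  also have "\<dots> = dup_mat p * (low_mat p * M_mat p) * L"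
    by (simp add: mult_mat_assoc_dim length_low_positions)
  also have "\<dots> = L" by (simp only: dup_low_M L_def M_lin_mat[OF K])
  finally show ?thesis by (simp only: L_def)
qed

text \<open>Euler's identity: \<open>hG\<close> is homogeneous of degree one.\<close>

lemma lin_mat_vec_op_self:
  assumes V: "V \<in> pd_mats p"
  shows "lin_mat p E (minv (hG p E V)) *\<^sub>v vec_op V = vec_op (hG p E V)"
proof -
  let ?B = "hG p E V"
  note B = hG_pd[OF V, of E] and Vs = pd_mats_sym[OF V]
  note K = minv_pd_mats[OF B]
  note m = pd_mats_minv[OF B B]
  \<comment> \<open>The completion solves its own linearized equations with data \<open>V\<close>:
    it agrees with \<open>V\<close> at the edges, and its sandwich is the inverse, which vanishes at
    absent edges.\<close>
  have "minv ?B * ?B * minv ?B = minv ?B" using m by simp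
  then have "(minv ?B * ?B * minv ?B) $$ (i, j) = 0" if "i < p" "j < p" "{i, j} \<notin> E" "i \<noteq> j" for i j
    using minv_hG_index[OF V that] by (simp only:)
  then have "lin_map p E (minv ?B) V = ?B"
    by (intro lin_map_unique[OF K Vs pd_mats_sym[OF B] hG_index[OF V]])
  then show ?thesis using vec_op_lin_map[OF K sym_matsD(1)[OF Vs], of E] by simp
qed

lemma outer_prod_dim [simp]: "dim_row (outer_prod x y) = dim_vec x" "dim_col (outer_prod x y) = dim_vec y"
  by (simp_all add: outer_prod_def)

lemma outer_prod_sandwich:
  assumes R: "R \<in> carrier_mat n k" and x: "x \<in> carrier_vec k" and y: "y \<in> carrier_vec k"
  shows "R * outer_prod x y * R\<^sup>T = outer_prod (R *\<^sub>v x) (R *\<^sub>v y)"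
proof (rule eq_matI)
  note d = carrier_matD[OF R] carrier_vecD[OF x] carrier_vecD[OF y]
  have O: "outer_prod x y \<in> carrier_mat k k" by (rule carrier_matI) (simp_all only: outer_prod_dim d)
  have RO: "R * outer_prod x y \<in> carrier_mat n k" by (rule mult_carrier_mat[OF R O])
  have RT: "R\<^sup>T \<in> carrier_mat k n" using R by simp
  fix i j assume "i < dim_row (outer_prod (R *\<^sub>v x) (R *\<^sub>v y))" "j < dim_col (outer_prod (R *\<^sub>v x) (R *\<^sub>v y))"
  then have ij: "i < n" "j < n" by (simp_all add: d)
  have 1: "(R * outer_prod x y) $$ (i, l) = (R *\<^sub>v x) $ i * y $ l" if "l < k" for l
    unfolding index_mult_mat_sum[OF R O ij(1) that] index_mult_mat_vec_sum[OF R x ij(1)] sum_distrib_right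
    using that by (intro sum.cong refl) (simp add: outer_prod_def d)
  have "(R * outer_prod x y * R\<^sup>T) $$ (i, j) = (\<Sum>l<k. (R *\<^sub>v x) $ i * (R $$ (j, l) * y $ l))"
    unfolding index_mult_mat_sum[OF RO RT ij] using ij
    by (intro sum.cong refl) (simp add: 1 d del: index_mult_mat(1) index_mult_mat_vec)
  also have "\<dots> = (R *\<^sub>v x) $ i * (R *\<^sub>v y) $ j"
    unfolding index_mult_mat_vec_sum[OF R y ij(2)] by (simp only: sum_distrib_left)
  also have "\<dots> = outer_prod (R *\<^sub>v x) (R *\<^sub>v y) $$ (i, j)"
    using ij by (simp add: outer_prod_def d del: index_mult_mat_vec)
  finally show "(R * outer_prod x y * R\<^sup>T) $$ (i, j) = outer_prod (R *\<^sub>v x) (R *\<^sub>v y) $$ (i, j)" .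
qed simp_all

lemma sandwich_comb:
  fixes R X Y :: "real mat"
  assumes "R \<in> carrier_mat n k" "X \<in> carrier_mat k k" "Y \<in> carrier_mat k k"
  shows "R * (a \<cdot>\<^sub>m X + b \<cdot>\<^sub>m Y) * R\<^sup>T = a \<cdot>\<^sub>m (R * X * R\<^sup>T) + b \<cdot>\<^sub>m (R * Y * R\<^sup>T)"
proof -
  have RT: "R\<^sup>T \<in> carrier_mat k n" using assms by simp
  have c: "a \<cdot>\<^sub>m X \<in> carrier_mat k k" "b \<cdot>\<^sub>m Y \<in> carrier_mat k k" "R * X \<in> carrier_mat n k" "R * Y \<in> carrier_mat n k"
    using assms by auto
  have sc: "a \<cdot>\<^sub>m (R * X) \<in> carrier_mat n k" "b \<cdot>\<^sub>m (R * Y) \<in> carrier_mat n k" using c by auto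
  show ?thesis
    by (simp only: mult_add_distrib_mat[OF assms(1) c(1,2)] mult_smult_distrib[OF assms(1,2)]
        mult_smult_distrib[OF assms(1,3)] add_mult_distrib_mat[OF sc RT]
        mult_smult_assoc_mat[OF c(3) RT] mult_smult_assoc_mat[OF c(4) RT])
qed

lemma one_mult_dim: "dim_row X = n \<Longrightarrow> 1\<^sub>m n * X = (X :: real mat)"
  by (rule left_mult_one_mat[of _ _ "dim_col X"]) auto

lemma zero_mult_dim: "dim_row X = n \<Longrightarrow> 0\<^sub>m m n * X = (0\<^sub>m m (dim_col X) :: real mat)"
  by (rule left_mult_zero_mat[of _ _ "dim_col X"]) auto

text \<open>The derivative absorbs \<open>M_mat p\<close>, which settles the Kronecker term; Euler's
  identity sends the vector in the rank-one term to the vectorized completion.\<close>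

lemma lin_mat_W_V:
  assumes V: "V \<in> pd_mats p"
  shows "DhG p E V * W_V p \<sigma>1 \<sigma>2 V * (DhG p E V)\<^sup>T = W_VG p E \<sigma>1 \<sigma>2 V"
proof -
  define L where "L = lin_mat p E (minv (hG p E V))"
  have K: "minv (hG p E V) \<in> pd_mats p" by (intro minv_pd_mats hG_pd V)
  have L: "L \<in> carrier_mat (p * p) (p * p)" by (rule carrier_matI) (simp_all only: L_def lin_mat_dim[OF K])
  note dL = carrier_matD[OF L] and Vc = pd_mats_carrier[OF V]
  note dV = carrier_matD[OF Vc]
  have c: "M_mat p * kron V V \<in> carrier_mat (p * p) (p * p)"
    "outer_prod (vec_op V) (vec_op V) \<in> carrier_mat (p * p) (p * p)"
    by (rule carrier_matI; simp add: dV)+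
  have "L * (M_mat p * kron V V) = L * M_mat p * kron V V" by (simp add: mult_mat_assoc_dim dL dV)
  also have "L * M_mat p = L" unfolding L_def by (rule lin_mat_M[OF K])
  finally have 1: "L * (M_mat p * kron V V) = L * kron V V" .
  show ?thesis
    unfolding W_V_def W_VG_def DhG_eq_lin_mat[OF V] L_def[symmetric] sandwich_comb[OF L c] 1
      outer_prod_sandwich[OF L vec_op_carrier[OF Vc] vec_op_carrier[OF Vc]]
    by (simp only: L_def lin_mat_vec_op_self[OF V])
qed

lemma kron_minv:
  assumes V: "V \<in> pd_mats p"
  shows "kron V V * kron (minv V) (minv V) = 1\<^sub>m (p * p)" "kron (minv V) (minv V) * kron V V = 1\<^sub>m (p * p)"
  using kron_mult[OF pd_mats_carrier[OF V] pd_mats_carrier[OF V] pd_mats_minv(1)[OF V V] pd_mats_minv(1)[OF V V]]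
    kron_mult[OF pd_mats_minv(1)[OF V V] pd_mats_minv(1)[OF V V] pd_mats_carrier[OF V] pd_mats_carrier[OF V]]
    pd_mats_minv[OF V V]
  by (simp_all add: kron_one)

text \<open>\<open>kron V V\<close> and \<open>kron K K\<close> are mutually inverse, so
  multiplication by the former strips the latter from the correction and leaves the symmetric matrix
  \<open>U\<close>; the inverse of \<open>Schur_D\<close> makes the second-order product equal to
  \<open>U\<close> again.\<close>

lemma lin_mat_sandwich:
  assumes V: "V \<in> pd_mats p"
  defines "K \<equiv> minv V"
  shows "lin_mat p E K * kron V V * (lin_mat p E K)\<^sup>T =
    M_mat p * (kron V V - (QD p E)\<^sup>T * minv (Schur_D p E K) * QD p E * M_mat p)"
proof -
  note K = minv_pd_mats[OF V, folded K_def]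
  note Vc = pd_mats_carrier[OF V] and Kc = pd_mats_carrier[OF K]
  note dims = carrier_matD[OF Vc] carrier_matD[OF Kc]
  define G where "G = minv (Schur_D p E K)"
  note G = minv_Schur_D[OF K, of E, folded G_def]
  define Q where "Q = QD p E"
  have dQ: "dim_row Q = npos p (D_set p E)" "dim_col Q = p * p" by (simp_all add: Q_def)
  define S T where "S = kron V V" and "T = kron K K"
  have dST: "dim_row S = p * p" "dim_col S = p * p" "dim_row T = p * p" "dim_col T = p * p"
    by (simp_all add: S_def T_def dims)
  have ST: "S * T = 1\<^sub>m (p * p)" "T * S = 1\<^sub>m (p * p)"
    unfolding S_def T_def K_def by (rule kron_minv[OF V])+
  have STx: "S * (T * X) = X" "T * (S * X) = X" if "dim_row X = p * p" for X
    using mult_mat_assoc_dim[of S T X] mult_mat_assoc_dim[of T S X] that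
    by (simp_all add: dST ST one_mult_dim)
  have SM: "S * M_mat p = M_mat p * S" "T * M_mat p = M_mat p * T"
    unfolding S_def T_def by (rule kron_M[OF Vc], rule kron_M[OF Kc])
  have SMx: "S * (M_mat p * X) = M_mat p * (S * X)" "T * (M_mat p * X) = M_mat p * (T * X)"
    if "dim_row X = p * p" for X
    unfolding S_def T_def by (rule kron_M_left[OF Vc that], rule kron_M_left[OF Kc that])
  have TT: "T\<^sup>T = T" unfolding T_def
    by (simp add: kron_transpose[OF Kc Kc] sym_matsD(2)[OF pd_mats_sym[OF K]])
  have GBG: "G * (Q * (M_mat p * (T * (Q\<^sup>T * X)))) = X" if "dim_row X = npos p (D_set p E)" for X
  proof -
    have "G * (Q * (M_mat p * (T * (Q\<^sup>T * X)))) = G * Schur_D p E K * X"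
      by (simp add: Schur_D_def Q_def T_def mult_mat_assoc_dim G dims that)
    then show ?thesis by (simp add: G that one_mult_dim)
  qed
  define U where "U = M_mat p * (Q\<^sup>T * (G * (Q * M_mat p)))"
  have dU: "dim_row U = p * p" "dim_col U = p * p" by (simp_all add: U_def)
  have lin: "lin_mat p E K = M_mat p - M_mat p * (Q\<^sup>T * (G * (Q * (T * M_mat p))))"
    by (simp only: lin_mat_def Q_def G_def T_def)
  have LS: "lin_mat p E K * S = M_mat p * S - U"
    unfolding lin
    by (simp add: minus_mult_distrib_dim mult_mat_assoc_dim dQ dST G SM SMx STx U_def)
      (simp add: SM(1)[symmetric] STx ST)
  have LT: "(lin_mat p E K)\<^sup>T = M_mat p - M_mat p * (T * (Q\<^sup>T * (G * (Q * M_mat p))))"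
    unfolding lin
    by (simp add: transpose_minus_dim transpose_mult_dim M_mat_transpose TT G mult_mat_assoc_dim dQ dST SMx)
  have 1: "M_mat p * S * (M_mat p * (T * (Q\<^sup>T * (G * (Q * M_mat p))))) = U"
    by (simp add: mult_mat_assoc_dim dQ dST G SMx STx M_M_left U_def)
  have 2: "U * M_mat p = U" by (simp add: U_def mult_mat_assoc_dim dQ G M_mat_idem)
  have 3: "U * (M_mat p * (T * (Q\<^sup>T * (G * (Q * M_mat p))))) = U"
    by (simp add: U_def mult_mat_assoc_dim dQ dST G M_M_left GBG)
  have 4: "M_mat p * S * M_mat p = M_mat p * S"
    by (simp add: mult_mat_assoc_dim dST SM M_M_left)
  \<comment> \<open>The two cross terms and the quadratic term all equal \<open>U\<close>, so that
    only one \<open>U\<close> remains subtracted.\<close>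
  have "lin_mat p E K * S * (lin_mat p E K)\<^sup>T = (M_mat p * S - U) * M_mat p
      - (M_mat p * S - U) * (M_mat p * (T * (Q\<^sup>T * (G * (Q * M_mat p)))))"
    unfolding LS LT by (rule mult_minus_distrib_dim) (simp_all add: dU dST dQ)
  also have "\<dots> = (M_mat p * S - U) - (U - U)"
    by (simp only: minus_mult_distrib_dim[of "M_mat p * S" _ U] dU dST M_mat_dim index_mult_mat 1 2 3 4)
  also have "\<dots> = M_mat p * S - U" by (rule eq_matI) (simp_all add: dU dST del: index_mult_mat(1))
  also have "\<dots> = M_mat p * (S - Q\<^sup>T * G * Q * M_mat p)"
    by (simp add: mult_minus_distrib_dim mult_mat_assoc_dim dQ dST G U_def)
  finally show ?thesis by (simp only: S_def Q_def G_def)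
qed

section \<open>The covariance of the precision entries\<close>

lemma QK_dim [simp]: "dim_row (QK p E) = npos p (K_set p E)" "dim_col (QK p E) = p * p"
  by (simp_all add: QK_def)

lemma mult_one_dim: "dim_col X = n \<Longrightarrow> X * 1\<^sub>m n = (X :: real mat)"
  by (rule right_mult_one_mat[of _ "dim_row X"]) auto

text \<open>The hypotheses say that the range of \<open>C\<close> consists of vectorized symmetric
  matrices that vanish at the absent edges; these are recovered from their diagonal and edge
  entries.\<close>

lemma fold_QK_QK:
  assumes C: "C \<in> carrier_mat (p * p) (p * p)" and MC: "M_mat p * C = C"
    and QC: "QD p E * C = 0\<^sub>m (npos p (D_set p E)) (p * p)"
  shows "fold_mat p * ((QK p E)\<^sup>T * (QK p E * C)) = C"
proof (rule mat_eq_vec_opI[of _ "p * p" p])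
  note dC = carrier_matD[OF C]
  fix X :: "real mat" assume X: "X \<in> carrier_mat p p"
  note dX = carrier_matD[OF X]
  define y where "y = C *\<^sub>v vec_op X"
  have y: "y \<in> carrier_vec (p * p)" by (rule carrier_vecI) (simp add: y_def dC)
  have My: "M_mat p *\<^sub>v y = y"
    using mult_mat_vec_assoc_dim[of "M_mat p" C "vec_op X"] by (simp add: MC y_def dC dX)
  have Qy: "QD p E *\<^sub>v y = 0\<^sub>v (npos p (D_set p E))"
  proof -
    have "QD p E *\<^sub>v y = (QD p E * C) *\<^sub>v vec_op X"
      unfolding y_def by (rule mult_mat_vec_assoc_dim[symmetric]) (simp_all add: dC dX)
    then show ?thesis unfolding QC by (simp only:) (intro eq_vecI; simp add: scalar_prod_def dX)
  qed
  define Y where "Y = unvec p y"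
  have Ys: "Y \<in> sym_mats p" unfolding Y_def by (rule M_mat_fixed_sym[OF y My])
  have Yy: "vec_op Y = y" unfolding Y_def by (rule vec_op_unvec[OF y])
  have QY: "QD p E *\<^sub>v vec_op Y = 0\<^sub>v (npos p (D_set p E))" by (simp only: Yy Qy)
  have "fold_mat p *\<^sub>v ((QK p E)\<^sup>T *\<^sub>v (QK p E *\<^sub>v vec_op Y)) = vec_op Y" unfolding QK_def
  proof (rule fold_sel_sel[OF Ys K_set_subset(1)])
    fix i j assume ij: "i < p" "j \<le> i" "(i, j) \<notin> K_set p E"
    then have "j < p" "{i, j} \<notin> E" "i \<noteq> j" by (auto simp: K_set_def)
    then show "Y $$ (i, j) = 0" by (rule QD_vec_op_eq_0[OF Ys QY ij(1)])
  qed
  then show "fold_mat p * ((QK p E)\<^sup>T * (QK p E * C)) *\<^sub>v vec_op X = C *\<^sub>v vec_op X"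
    by (simp add: mult_mat_vec_assoc_dim dC dX Yy y_def)
qed (use carrier_matD[OF C] in \<open>auto intro!: carrier_matI\<close>)

text \<open>A Schur complement of the inverse is the inverse of a block; the argument avoids partitioned
  matrices by working on the vectorized symmetric matrices that vanish at the absent edges.\<close>

lemma precision_covariance:
  assumes V: "V \<in> pd_mats p"
  defines "K \<equiv> minv V"
  shows "minv (QK_tilde p E * ((dup_mat p)\<^sup>T * kron V V * dup_mat p) * (QK_tilde p E)\<^sup>T)
    = (QK p E * kron K K) * (lin_mat p E K * kron V V * (lin_mat p E K)\<^sup>T) * (QK p E * kron K K)\<^sup>T"
proof -
  note K = minv_pd_mats[OF V, folded K_def]
  note Vc = pd_mats_carrier[OF V] and Kc = pd_mats_carrier[OF K]
  note dims = carrier_matD[OF Vc] carrier_matD[OF Kc]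
  define G where "G = minv (Schur_D p E K)"
  note G = minv_Schur_D[OF K, of E, folded G_def]
  define Q P F where "Q = QD p E" and "P = QK p E" and "F = fold_mat p"
  have dQ: "dim_row Q = npos p (D_set p E)" "dim_col Q = p * p" by (simp_all add: Q_def)
  have dP: "dim_row P = npos p (K_set p E)" "dim_col P = p * p" by (simp_all add: P_def)
  have dF: "dim_row F = p * p" "dim_col F = p * p" by (simp_all add: F_def)
  define S T where "S = kron V V" and "T = kron K K"
  have dST: "dim_row S = p * p" "dim_col S = p * p" "dim_row T = p * p" "dim_col T = p * p"
    by (simp_all add: S_def T_def dims)
  have ST: "S * T = 1\<^sub>m (p * p)" "T * S = 1\<^sub>m (p * p)"
    unfolding S_def T_def K_def by (rule kron_minv[OF V])+
  have STx: "S * (T * X) = X" "T * (S * X) = X" if "dim_row X = p * p" for X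
    using mult_mat_assoc_dim[of S T X] mult_mat_assoc_dim[of T S X] that
    by (simp_all add: dST ST one_mult_dim)
  have SM: "T * M_mat p = M_mat p * T" unfolding T_def by (rule kron_M[OF Kc])
  have SMx: "S * (M_mat p * X) = M_mat p * (S * X)" "T * (M_mat p * X) = M_mat p * (T * X)"
    if "dim_row X = p * p" for X
    unfolding S_def T_def by (rule kron_M_left[OF Vc that], rule kron_M_left[OF Kc that])
  have TT: "T\<^sup>T = T" unfolding T_def
    by (simp add: kron_transpose[OF Kc Kc] sym_matsD(2)[OF pd_mats_sym[OF K]])
  have BG: "Q * (M_mat p * (T * (Q\<^sup>T * (G * X)))) = X" if "dim_row X = npos p (D_set p E)" for X
  proof -
    have "Q * (M_mat p * (T * (Q\<^sup>T * (G * X)))) = Schur_D p E K * G * X"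
      by (simp add: Schur_D_def Q_def T_def mult_mat_assoc_dim G dims that)
    then show ?thesis by (simp add: G that one_mult_dim)
  qed
  define R where "R = Q * (M_mat p * T)"
  have dR: "dim_row R = npos p (D_set p E)" "dim_col R = p * p"
    by (simp_all add: R_def dQ dST)
  define U where "U = M_mat p * (T * (Q\<^sup>T * (G * R)))"
  have dU: "dim_row U = p * p" "dim_col U = p * p" by (simp_all add: U_def dR)
  \<comment> \<open>The Schur complement of the absent block in \<open>M_mat p * T\<close>. By
    \<open>TCT\<close> below it is the sandwiched covariance from which the precision entries are
    selected.\<close>
  define C where "C = M_mat p * T - U"
  have dC: "dim_row C = p * p" "dim_col C = p * p" by (simp_all add: C_def dU)
  have Cc: "C \<in> carrier_mat (p * p) (p * p)" by (rule carrier_matI) (simp_all add: dC)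
  have TCT: "T * (lin_mat p E K * S * (lin_mat p E K)\<^sup>T) * T = C"
  proof -
    have "lin_mat p E K * S * (lin_mat p E K)\<^sup>T = M_mat p * S - M_mat p * (Q\<^sup>T * (G * (Q * M_mat p)))"
      using lin_mat_sandwich[OF V, of E, folded K_def, folded S_def G_def Q_def]
      by (simp add: mult_minus_distrib_dim mult_mat_assoc_dim dQ dST G)
    then have "T * (lin_mat p E K * S * (lin_mat p E K)\<^sup>T) * T
      = T * (M_mat p * S) * T - T * (M_mat p * (Q\<^sup>T * (G * (Q * M_mat p)))) * T"
      by (simp add: mult_minus_distrib_dim minus_mult_distrib_dim dQ dST G)
    also have "T * (M_mat p * S) * T = M_mat p * T"
      by (simp add: mult_mat_assoc_dim dST SMx STx)
    also have "T * (M_mat p * (Q\<^sup>T * (G * (Q * M_mat p)))) * T = U"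
      by (simp add: mult_mat_assoc_dim dST dQ G SMx U_def R_def)
    finally show ?thesis by (simp only: C_def)
  qed
  have MC: "M_mat p * C = C"
    by (simp add: C_def U_def mult_minus_distrib_dim dST dQ dR G M_M_left)
  have QC: "Q * C = 0\<^sub>m (npos p (D_set p E)) (p * p)"
  proof -
    have "Q * C = R - R" unfolding C_def U_def
      by (simp add: mult_minus_distrib_dim dST dQ dR G BG R_def[symmetric])
    also have "\<dots> = 0\<^sub>m (npos p (D_set p E)) (p * p)"
      by (rule eq_matI) (simp_all add: dR)
    finally show ?thesis .
  qed
  have NC: "F * (P\<^sup>T * (P * C)) = C"
    unfolding F_def P_def by (rule fold_QK_QK[OF Cc MC QC[unfolded Q_def]])
  have NCx: "F * (P\<^sup>T * (P * (C * X))) = C * X" if "dim_row X = p * p" for X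
  proof -
    have "F * (P\<^sup>T * (P * (C * X))) = F * (P\<^sup>T * (P * C)) * X"
      by (simp add: mult_mat_assoc_dim dF dP dC that)
    then show ?thesis by (simp only: NC)
  qed
  have FM: "F * (M_mat p * X) = F * X" if "dim_row X = p * p" for X
    using mult_mat_assoc_dim[of F "M_mat p" X] that by (simp add: F_def fold_M)
  have PFQ: "P * (F * (Q\<^sup>T * X)) = 0\<^sub>m (npos p (K_set p E)) (dim_col X)"
    if "dim_row X = npos p (D_set p E)" for X
  proof -
    have "P * (F * (Q\<^sup>T * X)) = (P * F * Q\<^sup>T) * X"
      by (simp add: mult_mat_assoc_dim dF dP dQ that)
    also have "P * F * Q\<^sup>T = 0\<^sub>m (npos p (K_set p E)) (npos p (D_set p E))"
      unfolding P_def F_def Q_def QK_def QD_def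
      by (rule sel_fold_sel_zero[OF K_set_subset(1) D_set_subset(1) K_D_set_disjoint])
    finally show ?thesis by (simp only: zero_mult_dim[OF that])
  qed
  have SC: "S * C = M_mat p - M_mat p * (Q\<^sup>T * (G * R))"
  proof -
    have "S * C = S * (M_mat p * T) - S * (M_mat p * (T * (Q\<^sup>T * (G * R))))"
      unfolding C_def U_def by (rule mult_minus_distrib_dim) (simp_all add: dST dR)
    also have "S * (M_mat p * T) = M_mat p"
      by (simp add: SMx(1) dST ST mult_one_dim)
    also have "S * (M_mat p * (T * (Q\<^sup>T * (G * R)))) = M_mat p * (Q\<^sup>T * (G * R))"
      by (simp add: SMx(1) STx dST dQ)
    finally show ?thesis .
  qed
  \<comment> \<open>\<open>S * C\<close> differs from \<open>M_mat p\<close> by a term in the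
    symmetrized span of absent positions. Folding absorbs the symmetrization, and the selection of
    the disjoint edge positions annihilates what remains.\<close>
  have PFSC: "P * (F * (S * C)) = P * F"
  proof -
    have "P * (F * (S * C)) = P * (F * M_mat p) - P * (F * (M_mat p * (Q\<^sup>T * (G * R))))"
      unfolding SC by (simp add: mult_minus_distrib_dim dP dF dQ dR)
    also have "P * (F * (M_mat p * (Q\<^sup>T * (G * R)))) = 0\<^sub>m (npos p (K_set p E)) (p * p)"
      by (simp add: FM dQ PFQ G dR)
    also have "F * M_mat p = F" by (simp only: F_def fold_M)
    also have "P * F - 0\<^sub>m (npos p (K_set p E)) (p * p) = P * F"
      by (rule eq_matI) (simp_all add: dP dF del: index_mult_mat(1))
    finally show ?thesis .
  qed
  have dup: "dup_mat p * ((dup_mat p)\<^sup>T * X) = F * X" if "dim_row X = p * p" for X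
    using mult_mat_assoc_dim[of "dup_mat p" "(dup_mat p)\<^sup>T" X] that by (simp add: dup_dup_transpose F_def)
  let ?n = "npos p (K_set p E)"
  \<comment> \<open>Each duplication matrix meets a transposed one, and the pair is the folding
    matrix.\<close>
  have X: "QK_tilde p E * ((dup_mat p)\<^sup>T * S * dup_mat p) * (QK_tilde p E)\<^sup>T = P * (F * (S * (F * P\<^sup>T)))"
    unfolding QK_tilde_def P_def[symmetric]
    by (simp add: transpose_mult_dim mult_mat_assoc_dim dP dST dF dup)
  have "minv (P * (F * (S * (F * P\<^sup>T)))) = P * (C * P\<^sup>T)"
  proof (rule minv_eqI)
    show "P * (F * (S * (F * P\<^sup>T))) \<in> carrier_mat ?n ?n" "P * (C * P\<^sup>T) \<in> carrier_mat ?n ?n"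
      by (rule carrier_matI; simp add: dP)+
    \<comment> \<open>The inner selection, restoration and folding act as the identity on the range
      of \<open>C\<close>, so the two factors meet in \<open>S * C\<close>.\<close>
    have "P * (F * (S * (F * P\<^sup>T))) * (P * (C * P\<^sup>T)) = P * (F * (S * (F * (P\<^sup>T * (P * (C * P\<^sup>T))))))"
      by (simp add: mult_mat_assoc_dim dP dF dST dC)
    also have "\<dots> = P * (F * (S * C)) * P\<^sup>T"
      by (simp add: NCx mult_mat_assoc_dim dP dF dST dC)
    also have "\<dots> = P * F * P\<^sup>T" by (simp only: PFSC)
    also have "\<dots> = 1\<^sub>m ?n" unfolding P_def F_def QK_def by (rule sel_fold_sel_one[OF K_set_subset(1)])
    finally show "P * (F * (S * (F * P\<^sup>T))) * (P * (C * P\<^sup>T)) = 1\<^sub>m ?n" .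
  qed
  also have "P * (C * P\<^sup>T) = P * ((T * (lin_mat p E K * S * (lin_mat p E K)\<^sup>T) * T) * P\<^sup>T)" by (simp only: TCT)
  also have "\<dots> = (P * T) * (lin_mat p E K * S * (lin_mat p E K)\<^sup>T) * (P * T)\<^sup>T"
    by (simp add: transpose_mult_dim TT mult_mat_assoc_dim dP dST lin_mat_dim[OF K])
  finally show ?thesis unfolding X[symmetric] by (simp only: S_def T_def P_def)
qed

text \<open>\<open>R\<close> is the selected derivative of matrix inversion at \<open>V\<close>, up
  to a sign that a covariance does not see. For the rank-one term, sandwiching \<open>V\<close>
  between its inverses gives the inverse.\<close>

lemma W_uG_eq:
  assumes V: "V \<in> pd_mats p" and fix_V: "V = hG p E V"
  defines "R \<equiv> QK p E * kron (minv V) (minv V)"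
  shows "R * W_VG p E \<sigma>1 \<sigma>2 V * R\<^sup>T = W_uG p E \<sigma>1 \<sigma>2 V"
proof -
  define K where "K = minv V"
  have K: "K \<in> pd_mats p" unfolding K_def by (rule minv_pd_mats[OF V])
  note Vc = pd_mats_carrier[OF V] and Kc = pd_mats_carrier[OF K]
  note dims = carrier_matD[OF Vc] carrier_matD[OF Kc]
  have D: "DhG p E V = lin_mat p E K" by (simp only: DhG_eq_lin_mat[OF V] fix_V[symmetric] K_def)
  let ?n = "npos p (K_set p E)"
  have R: "R \<in> carrier_mat ?n (p * p)" unfolding R_def K_def[symmetric]
    by (rule carrier_matI) (simp_all add: dims)
  have c: "lin_mat p E K * kron V V * (lin_mat p E K)\<^sup>T \<in> carrier_mat (p * p) (p * p)"
    "outer_prod (vec_op V) (vec_op V) \<in> carrier_mat (p * p) (p * p)"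
    by (rule carrier_matI; simp add: dims lin_mat_dim[OF K])+
  have "kron K K *\<^sub>v vec_op V = vec_op (K * V * K)" by (rule kron_sandwich[OF pd_mats_sym[OF K] Vc])
  also have "K * V * K = K" using pd_mats_minv(3)[OF V V] Kc by (simp add: K_def)
  finally have "R *\<^sub>v vec_op V = QK p E *\<^sub>v vec_op K"
    unfolding R_def K_def[symmetric] by (simp add: mult_mat_vec_assoc_dim dims)
  then show ?thesis
    unfolding W_VG_def W_uG_def D fix_V[symmetric] sandwich_comb[OF R c]
      outer_prod_sandwich[OF R vec_op_carrier[OF Vc] vec_op_carrier[OF Vc]]
      precision_covariance[OF V, folded R_def] K_def[symmetric]
    unfolding R_def K_def[symmetric] by simp
qed

section \<open>Convergence in distribution\<close>

text \<open>The retraction of the function space onto the subspace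
  \<open>Euclidean_space d\<close>.\<close>

definition clip :: "nat \<Rightarrow> (nat \<Rightarrow> real) \<Rightarrow> nat \<Rightarrow> real" where
  "clip d x = (\<lambda>i. if i < d then x i else 0)"

lemma continuous_on_coordinate: "continuous_on S (\<lambda>x :: nat \<Rightarrow> real. x i)"
  by (rule continuous_on_subset[OF continuous_on_product_coordinates subset_UNIV])

lemma continuous_on_clip: "continuous_on UNIV (clip d)"
proof (rule continuous_on_coordinatewise_then_product)
  fix i show "continuous_on UNIV (\<lambda>x. clip d x i)"
    by (cases "i < d") (simp_all add: clip_def continuous_on_coordinate)
qed

lemma clip_vec_point: "x \<in> carrier_vec d \<Longrightarrow> clip d (vec_point x) = vec_point x"
  by (auto simp: clip_def vec_point_def)

text \<open>Test functions on the whole function space restrict to the subspace, and those on the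
  subspace extend by composition with \<open>clip\<close>. The global form allows ordinary
  continuity, compactness and measurability to be used.\<close>

lemma conv_distr_iff:
  "conv_distr d M X N Z \<longleftrightarrow> (\<forall>n. rand_vec M d (X n)) \<and> rand_vec N d Z \<and>
    (\<forall>g :: (nat \<Rightarrow> real) \<Rightarrow> real. continuous_on UNIV g \<and> bounded (range g) \<longrightarrow>
        (\<lambda>n. \<integral>\<omega>. g (vec_point (X n \<omega>)) \<partial>M) \<longlonglongrightarrow> (\<integral>\<omega>. g (vec_point (Z \<omega>)) \<partial>N))"
  (is "?L \<longleftrightarrow> ?R")
proof
  assume L: ?L
  have "(\<lambda>n. \<integral>\<omega>. g (vec_point (X n \<omega>)) \<partial>M) \<longlonglongrightarrow> (\<integral>\<omega>. g (vec_point (Z \<omega>)) \<partial>N)"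
    if g: "continuous_on UNIV g" "bounded (range g)" for g :: "(nat \<Rightarrow> real) \<Rightarrow> real"
  proof -
    have "continuous_map (powertop_real UNIV) euclideanreal g"
      using g(1) by (simp add: euclidean_product_topology)
    then have "continuous_map (Euclidean_space d) euclideanreal g"
      unfolding Euclidean_space_def by (rule continuous_map_from_subtopology)
    moreover have "bounded (g ` topspace (Euclidean_space d))"
      by (rule bounded_subset[OF g(2)]) auto
    ultimately show ?thesis using L by (simp add: conv_distr_def)
  qed
  then show ?R using L unfolding conv_distr_def by blast
next
  assume R: ?R
  have "(\<lambda>n. \<integral>\<omega>. f (vec_point (X n \<omega>)) \<partial>M) \<longlonglongrightarrow> (\<integral>\<omega>. f (vec_point (Z \<omega>)) \<partial>N)"
    if f: "continuous_map (Euclidean_space d) euclideanreal f" "bounded (f ` topspace (Euclidean_space d))" for f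
  proof -
    have clip_in: "clip d x \<in> topspace (Euclidean_space d)" for x
      by (simp add: topspace_Euclidean_space clip_def)
    have "continuous_map euclidean (Euclidean_space d) (clip d)"
      unfolding Euclidean_space_def
      using continuous_on_clip[of d]
      by (intro continuous_map_into_subtopology) (auto simp: euclidean_product_topology clip_def)
    from continuous_map_compose[OF this f(1)] have "continuous_on UNIV (\<lambda>x. f (clip d x))"
      by (simp add: o_def)
    moreover have "bounded (range (\<lambda>x. f (clip d x)))"
      using clip_in by (intro bounded_subset[OF f(2)]) auto
    ultimately have "(\<lambda>n. \<integral>\<omega>. f (clip d (vec_point (X n \<omega>))) \<partial>M) \<longlonglongrightarrow> (\<integral>\<omega>. f (clip d (vec_point (Z \<omega>))) \<partial>N)"
      using R by blast
    moreover have "(\<integral>\<omega>. f (clip d (vec_point (X n \<omega>))) \<partial>M) = (\<integral>\<omega>. f (vec_point (X n \<omega>)) \<partial>M)" for n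
      using R by (intro Bochner_Integration.integral_cong refl) (simp add: clip_vec_point rand_vec_def)
    moreover have "(\<integral>\<omega>. f (clip d (vec_point (Z \<omega>))) \<partial>N) = (\<integral>\<omega>. f (vec_point (Z \<omega>)) \<partial>N)"
      using R by (intro Bochner_Integration.integral_cong refl) (simp add: clip_vec_point rand_vec_def)
    ultimately show ?thesis by simp
  qed
  then show ?L using R unfolding conv_distr_def by blast
qed

lemma vec_point_measurable:
  assumes "rand_vec M d X"
  shows "(\<lambda>\<omega>. vec_point (X \<omega>)) \<in> borel_measurable M"
proof (rule measurable_coordinatewise_then_product)
  fix i
  have X: "X \<omega> \<in> carrier_vec d" if "\<omega> \<in> space M" for \<omega> using assms that by (simp add: rand_vec_def)
  show "(\<lambda>\<omega>. vec_point (X \<omega>) i) \<in> borel_measurable M"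
  proof (cases "i < d")
    case True
    then have "(\<lambda>\<omega>. X \<omega> $ i) \<in> borel_measurable M" using assms by (simp add: rand_vec_def)
    then show ?thesis using True carrier_vecD[OF X]
      by (subst measurable_cong[where g = "\<lambda>\<omega>. X \<omega> $ i"]) (simp_all add: vec_point_def)
  next
    case False
    then show ?thesis using carrier_vecD[OF X]
      by (subst measurable_cong[where g = "\<lambda>\<omega>. 0"]) (simp_all add: vec_point_def)
  qed
qed

lemma bounded_continuous_integrable:
  assumes "prob_space M" "rand_vec M d X" "continuous_on UNIV g" "\<And>x. \<bar>g x\<bar> \<le> B"
  shows "integrable M (\<lambda>\<omega>. g (vec_point (X \<omega>)) :: real)"
proof -
  interpret prob_space M by fact
  have [measurable]: "g \<in> borel_measurable borel"
    by (rule borel_measurable_continuous_onI[OF assms(3)])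
  have [measurable]: "(\<lambda>\<omega>. vec_point (X \<omega>)) \<in> borel_measurable M" by (rule vec_point_measurable[OF assms(2)])
  show ?thesis by (rule integrable_const_bound[where B = B]) (auto simp: assms(4))
qed

section \<open>Linear images, uniform continuity and tightness\<close>

definition lin_fun :: "nat \<Rightarrow> nat \<Rightarrow> real mat \<Rightarrow> (nat \<Rightarrow> real) \<Rightarrow> nat \<Rightarrow> real" where
  "lin_fun k d L x = (\<lambda>i. if i < k then (\<Sum>l<d. L $$ (i, l) * x l) else 0)"

lemma lin_fun_vec_point:
  assumes L: "L \<in> carrier_mat k d" and x: "x \<in> carrier_vec d"
  shows "lin_fun k d L (vec_point x) = vec_point (L *\<^sub>v x)"
proof
  fix i
  have "(\<Sum>l<d. L $$ (i, l) * vec_point x l) = (\<Sum>l<d. L $$ (i, l) * x $ l)"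
    using carrier_vecD[OF x] by (intro sum.cong refl) (simp add: vec_point_def)
  then show "lin_fun k d L (vec_point x) i = vec_point (L *\<^sub>v x) i"
    using index_mult_mat_vec_sum[OF L x, of i] carrier_matD[OF L]
    by (simp add: lin_fun_def vec_point_def del: index_mult_mat_vec)
qed

lemma continuous_on_lin_fun: "continuous_on UNIV (lin_fun k d L)"
proof (rule continuous_on_coordinatewise_then_product)
  fix i show "continuous_on UNIV (\<lambda>x. lin_fun k d L x i)"
  proof (cases "i < k")
    case True
    have "continuous_on UNIV (\<lambda>x. \<Sum>l<d. L $$ (i, l) * x l)"
      by (rule continuous_on_sum, rule continuous_on_mult, rule continuous_on_const, rule continuous_on_coordinate)
    then show ?thesis using True by (simp add: lin_fun_def)
  qed (simp add: lin_fun_def)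
qed

text \<open>The metric of the function space is a sum of truncated coordinate distances with weights
  1, 1/2, 1/4 and so on, whose total is 2.\<close>

lemma dist_fun_le:
  fixes x y :: "nat \<Rightarrow> real"
  assumes "\<And>i. \<bar>x i - y i\<bar> \<le> e"
  shows "dist x y \<le> 2 * e"
proof -
  have s: "summable (\<lambda>n. (1/2) ^ n * e)" and e: "(\<Sum>n. (1/2) ^ n * e) = 2 * e"
    using geometric_sums[of "1/2 :: real", THEN sums_mult2, of e] by (auto simp: sums_iff)
  have le: "(1/2) ^ n * min (dist (x (from_nat n)) (y (from_nat n))) 1 \<le> (1/2) ^ n * e" for n
    using assms[of "from_nat n"] by (intro mult_left_mono) (auto simp: dist_real_def)
  have "summable (\<lambda>n. (1/2) ^ n * min (dist (x (from_nat n)) (y (from_nat n))) 1)"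
    by (rule summable_comparison_test'[OF s, of 0]) (use le in \<open>simp\<close>)
  then have "dist x y \<le> (\<Sum>n. (1/2) ^ n * e)"
    unfolding dist_fun_def using le s by (intro suminf_le)
  then show ?thesis by (simp only: e)
qed

text \<open>Heine-Cantor on a compact box, translated from the product metric to coordinate
  distances.\<close>

lemma uniformly_continuous_on_box:
  fixes g :: "(nat \<Rightarrow> real) \<Rightarrow> real"
  assumes g: "continuous_on UNIV g" and e: "e > 0"
  obtains \<delta> where "\<delta> > 0"
    "\<And>x y. (\<And>i. i < k \<Longrightarrow> \<bar>x i\<bar> \<le> c) \<Longrightarrow> (\<And>i. i < k \<Longrightarrow> \<bar>y i\<bar> \<le> c) \<Longrightarrow>
      (\<And>i. i \<ge> k \<Longrightarrow> x i = 0) \<Longrightarrow> (\<And>i. i \<ge> k \<Longrightarrow> y i = 0) \<Longrightarrow>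
      (\<And>i. i < k \<Longrightarrow> \<bar>x i - y i\<bar> \<le> \<delta>) \<Longrightarrow> \<bar>g x - g y\<bar> < e"
proof -
  let ?box = "PiE UNIV (\<lambda>i. if i < k then {-c..c} else {0::real})"
  have "compact ?box" by (rule compact_box)
  then have "uniformly_continuous_on ?box g"
    by (rule compact_uniformly_continuous[OF continuous_on_subset[OF g subset_UNIV]])
  then obtain d where d: "d > 0" "\<And>x y. x \<in> ?box \<Longrightarrow> y \<in> ?box \<Longrightarrow> dist y x < d \<Longrightarrow> dist (g y) (g x) < e"
    unfolding uniformly_continuous_on_def using e by metis
  have in_box: "x \<in> ?box" if "\<And>i. i < k \<Longrightarrow> \<bar>x i\<bar> \<le> c" "\<And>i. i \<ge> k \<Longrightarrow> x i = 0" for x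
    unfolding PiE_UNIV_domain
  proof (rule Pi_I)
    fix i show "x i \<in> (if i < k then {-c..c} else {0})"
    proof (cases "i < k")
      case True
      then have "-c \<le> x i \<and> x i \<le> c" using that(1)[of i] by linarith
      then show ?thesis using True by simp
    qed (use that(2)[of i] in simp)
  qed
  show thesis
  \<comment> \<open>Coordinate distances at most d/3 give distance at most 2d/3, strictly below
    \<open>d\<close>.\<close>
  proof (rule that[of "d / 3"])
    show "d / 3 > 0" using d by simp
    fix x y :: "nat \<Rightarrow> real"
    assume x: "\<And>i. i < k \<Longrightarrow> \<bar>x i\<bar> \<le> c" and y: "\<And>i. i < k \<Longrightarrow> \<bar>y i\<bar> \<le> c"
      and x0: "\<And>i. i \<ge> k \<Longrightarrow> x i = 0" and y0: "\<And>i. i \<ge> k \<Longrightarrow> y i = 0"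
      and xy: "\<And>i. i < k \<Longrightarrow> \<bar>x i - y i\<bar> \<le> d / 3"
    have "\<bar>x i - y i\<bar> \<le> d / 3" for i
      using xy[of i] x0[of i] y0[of i] d(1) by (cases "i < k") simp_all
    then have "dist x y \<le> 2 * (d / 3)" by (rule dist_fun_le)
    then have "dist x y < d" using d(1) by linarith
    then show "\<bar>g x - g y\<bar> < e"
      using d(2)[OF in_box[OF y y0] in_box[OF x x0]] by (simp add: dist_real_def)
  qed
qed

text \<open>A continuous substitute for the indicator of the complement of a ball, rising from 0 to
  1 while the sum of absolute coordinates goes from \<open>K\<close> to \<open>K + 1\<close>. Being
  a test function, it carries tail bounds through convergence in distribution.\<close>

definition tail_cutoff :: "nat \<Rightarrow> real \<Rightarrow> (nat \<Rightarrow> real) \<Rightarrow> real" where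
  "tail_cutoff d K x = min 1 (max 0 ((\<Sum>i<d. \<bar>x i\<bar>) - K))"

lemma tail_cutoff_bounds: "0 \<le> tail_cutoff d K x" "tail_cutoff d K x \<le> 1" "\<bar>tail_cutoff d K x\<bar> \<le> 1"
  by (auto simp: tail_cutoff_def)

lemma continuous_on_tail_cutoff: "continuous_on UNIV (tail_cutoff d K)"
  unfolding tail_cutoff_def[abs_def]
  by (intro continuous_on_min continuous_on_max continuous_on_const continuous_on_diff continuous_on_sum
      continuous_on_rabs continuous_on_coordinate)

lemma tail_cutoff_lt_1:
  assumes "tail_cutoff d K x < 1" "i < d"
  shows "\<bar>x i\<bar> \<le> K + 1"
proof -
  have "\<bar>x i\<bar> \<le> (\<Sum>i<d. \<bar>x i\<bar>)" using assms(2) by (intro member_le_sum) auto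
  moreover have "(\<Sum>i<d. \<bar>x i\<bar>) < K + 1" using assms(1) by (auto simp: tail_cutoff_def min_def max_def split: if_splits)
  ultimately show ?thesis by linarith
qed

text \<open>Tightness of the limit law: at each point the cutoffs are eventually 0, and dominated
  convergence applies.\<close>

lemma tail_cutoff_tendsto_0:
  assumes N: "prob_space N" and Z: "rand_vec N d Z"
  shows "(\<lambda>K. \<integral>\<omega>. tail_cutoff d (real K) (vec_point (Z \<omega>)) \<partial>N) \<longlonglongrightarrow> 0"
proof -
  interpret prob_space N by fact
  note m = borel_measurable_integrable[OF bounded_continuous_integrable[OF N Z continuous_on_tail_cutoff tail_cutoff_bounds(3)]]
  have "(\<lambda>K. \<integral>\<omega>. tail_cutoff d (real K) (vec_point (Z \<omega>)) \<partial>N) \<longlonglongrightarrow> (\<integral>\<omega>. 0 \<partial>N)"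
  proof (rule integral_dominated_convergence[where w = "\<lambda>_. 1"])
    show "AE \<omega> in N. (\<lambda>K. tail_cutoff d (real K) (vec_point (Z \<omega>))) \<longlonglongrightarrow> 0"
    proof (rule AE_I2)
      fix \<omega>
      obtain K0 :: nat where K0: "(\<Sum>i<d. \<bar>vec_point (Z \<omega>) i\<bar>) \<le> real K0" using real_arch_simple by blast
      have "tail_cutoff d (real K) (vec_point (Z \<omega>)) = 0" if "K \<ge> K0" for K
        using K0 that by (simp add: tail_cutoff_def)
      then show "(\<lambda>K. tail_cutoff d (real K) (vec_point (Z \<omega>))) \<longlonglongrightarrow> 0"
        by (intro tendsto_eventually) (auto simp: eventually_sequentially)
    qed
  qed (use m tail_cutoff_bounds in auto)
  then show ?thesis by simp
qed

text \<open>The hypothesis on the remainder is pointwise: it has to be small, uniformly in \<open>\<omega>\<close>, as long as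
  \<open>X n \<omega>\<close> stays in a bounded set. Tightness of the convergent sequence does the rest.\<close>

lemma conv_distr_delta:
  assumes M: "prob_space M" and N: "prob_space N"
    and conv: "conv_distr d M X N Z" and L: "L \<in> carrier_mat k d"
    and Y: "\<And>n. rand_vec M k (Y n)"
    and rem: "\<And>K e. e > 0 \<Longrightarrow> \<exists>n0. \<forall>n\<ge>n0. \<forall>\<omega>\<in>space M. (\<forall>i<d. \<bar>X n \<omega> $ i\<bar> \<le> K) \<longrightarrow>
      (\<forall>i<k. \<bar>Y n \<omega> $ i - (L *\<^sub>v X n \<omega>) $ i\<bar> \<le> e)"
  shows "conv_distr k M Y N (\<lambda>\<omega>. L *\<^sub>v Z \<omega>)"
  unfolding conv_distr_iff
proof (intro conjI allI impI)
  interpret M: prob_space M by fact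
  interpret N: prob_space N by fact
  have X: "\<And>n. rand_vec M d (X n)" and Z: "rand_vec N d Z" using conv by (auto simp: conv_distr_iff)
  have lim: "(\<lambda>n. \<integral>\<omega>. g (vec_point (X n \<omega>)) \<partial>M) \<longlonglongrightarrow> (\<integral>\<omega>. g (vec_point (Z \<omega>)) \<partial>N)"
    if "continuous_on UNIV g" "bounded (range g)" for g :: "(nat \<Rightarrow> real) \<Rightarrow> real" using conv that by (auto simp: conv_distr_iff)
  show "rand_vec M k (Y n)" for n by (rule Y)
  show "rand_vec N k (\<lambda>\<omega>. L *\<^sub>v Z \<omega>)"
    unfolding rand_vec_def
  proof (intro conjI ballI allI impI)
    show "L *\<^sub>v Z \<omega> \<in> carrier_vec k" if "\<omega> \<in> space N" for \<omega>
      by (rule carrier_vecI) (simp add: carrier_matD[OF L])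
    fix i assume i: "i < k"
    have "(\<lambda>\<omega>. \<Sum>l<d. L $$ (i, l) * Z \<omega> $ l) \<in> borel_measurable N"
      using Z unfolding rand_vec_def by (intro borel_measurable_sum borel_measurable_times) auto
    then show "(\<lambda>\<omega>. (L *\<^sub>v Z \<omega>) $ i) \<in> borel_measurable N"
      using Z index_mult_mat_vec_sum[OF L _ i] unfolding rand_vec_def
      by (subst measurable_cong[where g = "\<lambda>\<omega>. \<Sum>l<d. L $$ (i, l) * Z \<omega> $ l"]) (blast | assumption)+
  qed
  fix g :: "(nat \<Rightarrow> real) \<Rightarrow> real" assume "continuous_on UNIV g \<and> bounded (range g)"
  then have g: "continuous_on UNIV g" "bounded (range g)" by auto
  then obtain B where B: "\<And>x. \<bar>g x\<bar> \<le> B" unfolding bounded_iff by auto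
  have B0: "B \<ge> 0" using B[of "\<lambda>_. 0"] by linarith
  \<comment> \<open>Continuous mapping for the linear part: the integrals of \<open>h\<close> at
    \<open>X n\<close> already have the desired limit, so only the effect of the remainder has to
    vanish.\<close>
  define h where "h = (\<lambda>x. g (lin_fun k d L x))"
  have h: "continuous_on UNIV h" unfolding h_def
    by (rule continuous_on_compose2[OF g(1) continuous_on_lin_fun]) simp
  have hB: "\<bar>h x\<bar> \<le> B" for x by (simp add: h_def B)
  then have hb: "bounded (range h)" unfolding bounded_iff by auto
  have hZ: "(\<integral>\<omega>. h (vec_point (Z \<omega>)) \<partial>N) = (\<integral>\<omega>. g (vec_point (L *\<^sub>v Z \<omega>)) \<partial>N)"
    using Z unfolding h_def rand_vec_def
    by (intro Bochner_Integration.integral_cong refl) (simp add: lin_fun_vec_point[OF L])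
  have limh: "(\<lambda>n. \<integral>\<omega>. h (vec_point (X n \<omega>)) \<partial>M) \<longlonglongrightarrow> (\<integral>\<omega>. g (vec_point (L *\<^sub>v Z \<omega>)) \<partial>N)"
    using lim[OF h hb] by (simp only: hZ)
  have diff0: "(\<lambda>n. (\<integral>\<omega>. g (vec_point (Y n \<omega>)) \<partial>M) - (\<integral>\<omega>. h (vec_point (X n \<omega>)) \<partial>M)) \<longlonglongrightarrow> 0"
  proof (rule LIMSEQ_I)
    fix e :: real assume e: "e > 0"
    \<comment> \<open>Chosen so that \<open>2 * B * e'\<close> is at most e/2; the summand 1 covers
      \<open>B = 0\<close>.\<close>
    define e' where "e' = e / (4 * (B + 1))"
    have e': "e' > 0" using e B0 by (simp add: e'_def)
    have "eventually (\<lambda>K. (\<integral>\<omega>. tail_cutoff d (real K) (vec_point (Z \<omega>)) \<partial>N) < e') sequentially"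
      by (rule order_tendstoD(2)[OF tail_cutoff_tendsto_0[OF N Z] e'])
    then obtain K :: nat where K: "(\<integral>\<omega>. tail_cutoff d (real K) (vec_point (Z \<omega>)) \<partial>N) < e'"
      unfolding eventually_sequentially by blast
    let ?c = "tail_cutoff d (real K)"
    have cb: "bounded (range ?c)" unfolding bounded_iff
      using tail_cutoff_bounds(3)[of d "real K"] by (intro exI[of _ 1]) auto
    \<comment> \<open>The tail bound for \<open>Z\<close> passes to \<open>X n\<close> for all large
      \<open>n\<close>, because the cutoff is itself a bounded continuous test function.\<close>
    have ev: "eventually (\<lambda>n. (\<integral>\<omega>. ?c (vec_point (X n \<omega>)) \<partial>M) < e') sequentially"
      by (rule order_tendstoD(2)[OF lim[OF continuous_on_tail_cutoff cb] K])
    \<comment> \<open>Where the cutoff is below 1, the coordinates of \<open>X n\<close> are at most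
      \<open>K + 1\<close>; the first summand then bounds the linear image, and the extra 1 leaves
      room for the remainder, which is kept below \<open>min \<delta> 1\<close>.\<close>
    define b where "b = (\<Sum>i<k. \<Sum>l<d. \<bar>L $$ (i, l)\<bar>) * (real K + 1) + 1"
    obtain \<delta> where \<delta>: "\<delta> > 0" and unif: "\<And>x y. (\<And>i. i < k \<Longrightarrow> \<bar>x i\<bar> \<le> b) \<Longrightarrow> (\<And>i. i < k \<Longrightarrow> \<bar>y i\<bar> \<le> b) \<Longrightarrow>
      (\<And>i. i \<ge> k \<Longrightarrow> x i = 0) \<Longrightarrow> (\<And>i. i \<ge> k \<Longrightarrow> y i = 0) \<Longrightarrow>
      (\<And>i. i < k \<Longrightarrow> \<bar>x i - y i\<bar> \<le> \<delta>) \<Longrightarrow> \<bar>g x - g y\<bar> < e / 4"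
      using uniformly_continuous_on_box[OF g(1), of "e / 4" k b] e by (metis divide_pos_pos zero_less_numeral)
    have "min \<delta> 1 > 0" using \<delta> by simp
    from rem[OF this, of "real K + 1"] obtain n0 where n0: "\<And>n \<omega> i. n \<ge> n0 \<Longrightarrow> \<omega> \<in> space M \<Longrightarrow>
      (\<forall>i<d. \<bar>X n \<omega> $ i\<bar> \<le> real K + 1) \<Longrightarrow> i < k \<Longrightarrow> \<bar>Y n \<omega> $ i - (L *\<^sub>v X n \<omega>) $ i\<bar> \<le> min \<delta> 1"
      by blast
    \<comment> \<open>Where the cutoff equals 1 the trivial bound \<open>2 * B\<close> suffices;
      elsewhere both arguments lie in the box, and uniform continuity gives e/4.\<close>
    have point: "\<bar>g (vec_point (Y n \<omega>)) - h (vec_point (X n \<omega>))\<bar> \<le> e / 4 + 2 * B * ?c (vec_point (X n \<omega>))"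
      if n: "n \<ge> n0" and \<omega>: "\<omega> \<in> space M" for n \<omega>
    proof (cases "?c (vec_point (X n \<omega>)) < 1")
      case False
      then have "?c (vec_point (X n \<omega>)) = 1" using tail_cutoff_bounds(2)[of d "real K" "vec_point (X n \<omega>)"] by linarith
      then show ?thesis using B[of "vec_point (Y n \<omega>)"] hB[of "vec_point (X n \<omega>)"] e by simp
    next
      case True
      have Xc: "X n \<omega> \<in> carrier_vec d" and Yc: "Y n \<omega> \<in> carrier_vec k"
        using X[of n] Y[of n] \<omega> by (auto simp: rand_vec_def)
      have Xb: "\<bar>X n \<omega> $ i\<bar> \<le> real K + 1" if "i < d" for i
        using tail_cutoff_lt_1[OF True that] that carrier_vecD[OF Xc] by (simp add: vec_point_def)
      let ?y = "vec_point (Y n \<omega>)" and ?x = "lin_fun k d L (vec_point (X n \<omega>))"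
      have x: "?x i = (L *\<^sub>v X n \<omega>) $ i" if "i < k" for i
        unfolding lin_fun_vec_point[OF L Xc]
        using that carrier_matD[OF L] by (simp add: vec_point_def del: index_mult_mat_vec)
      have y: "?y i = Y n \<omega> $ i" if "i < k" for i using that carrier_vecD[OF Yc] by (simp add: vec_point_def)
      have close: "\<bar>?y i - ?x i\<bar> \<le> min \<delta> 1" if "i < k" for i
        unfolding x[OF that] y[OF that] using n0[OF n \<omega> _ that] Xb by blast
      have xb: "\<bar>?x i\<bar> \<le> b - 1" if i: "i < k" for i
      proof -
        have "\<bar>?x i\<bar> \<le> (\<Sum>l<d. \<bar>L $$ (i, l)\<bar> * \<bar>X n \<omega> $ l\<bar>)"
          unfolding x[OF i] index_mult_mat_vec_sum[OF L Xc i] abs_mult[symmetric] by (rule sum_abs)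
        also have "\<dots> \<le> (\<Sum>l<d. \<bar>L $$ (i, l)\<bar> * (real K + 1))"
          using Xb by (intro sum_mono mult_left_mono) auto
        also have "\<dots> = (\<Sum>l<d. \<bar>L $$ (i, l)\<bar>) * (real K + 1)" by (simp only: sum_distrib_right)
        also have "\<dots> \<le> (\<Sum>i<k. \<Sum>l<d. \<bar>L $$ (i, l)\<bar>) * (real K + 1)"
          using i by (intro mult_right_mono member_le_sum[of i "{..<k}" "\<lambda>i. \<Sum>l<d. \<bar>L $$ (i, l)\<bar>"]) (auto intro: sum_nonneg)
        finally show ?thesis by (simp add: b_def)
      qed
      have "\<bar>g ?y - g ?x\<bar> < e / 4"
      proof (rule unif)
        fix i assume i: "i < k"
        show "\<bar>?y i\<bar> \<le> b" using xb[OF i] close[OF i] by linarith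
        show "\<bar>?x i\<bar> \<le> b" using xb[OF i] by linarith
        show "\<bar>?y i - ?x i\<bar> \<le> \<delta>" using close[OF i] by linarith
      next
        fix i assume i: "k \<le> i"
        show "?y i = 0" using i carrier_vecD[OF Yc] by (simp add: vec_point_def)
        show "?x i = 0" using i by (simp add: lin_fun_def)
      qed
      moreover have "0 \<le> 2 * B * ?c (vec_point (X n \<omega>))" using B0 tail_cutoff_bounds(1) by simp
      ultimately show ?thesis unfolding h_def by linarith
    qed
    have main: "\<bar>(\<integral>\<omega>. g (vec_point (Y n \<omega>)) \<partial>M) - (\<integral>\<omega>. h (vec_point (X n \<omega>)) \<partial>M)\<bar>
        \<le> e / 4 + 2 * B * (\<integral>\<omega>. ?c (vec_point (X n \<omega>)) \<partial>M)" if n: "n \<ge> n0" for n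
    proof -
      note ig = bounded_continuous_integrable[OF M Y g(1) B, of n]
      note ih = bounded_continuous_integrable[OF M X h hB, of n]
      have ic: "integrable M (\<lambda>\<omega>. ?c (vec_point (X n \<omega>)))"
        by (rule bounded_continuous_integrable[OF M X continuous_on_tail_cutoff tail_cutoff_bounds(3)])
      have "\<bar>(\<integral>\<omega>. g (vec_point (Y n \<omega>)) \<partial>M) - (\<integral>\<omega>. h (vec_point (X n \<omega>)) \<partial>M)\<bar>
        = \<bar>\<integral>\<omega>. g (vec_point (Y n \<omega>)) - h (vec_point (X n \<omega>)) \<partial>M\<bar>"
        by (simp only: Bochner_Integration.integral_diff[OF ig ih])
      also have "\<dots> \<le> (\<integral>\<omega>. \<bar>g (vec_point (Y n \<omega>)) - h (vec_point (X n \<omega>))\<bar> \<partial>M)"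
        by (rule integral_abs_bound)
      also have "\<dots> \<le> (\<integral>\<omega>. e / 4 + 2 * B * ?c (vec_point (X n \<omega>)) \<partial>M)"
        using ig ih ic point[OF n] by (intro integral_mono) auto
      also have "\<dots> = e / 4 + 2 * B * (\<integral>\<omega>. ?c (vec_point (X n \<omega>)) \<partial>M)"
        using ic by (simp add: M.prob_space)
      finally show ?thesis .
    qed
    from ev obtain n1 where n1: "\<And>n. n \<ge> n1 \<Longrightarrow> (\<integral>\<omega>. ?c (vec_point (X n \<omega>)) \<partial>M) < e'"
      unfolding eventually_sequentially by blast
    show "\<exists>no. \<forall>n\<ge>no. norm ((\<integral>\<omega>. g (vec_point (Y n \<omega>)) \<partial>M) - (\<integral>\<omega>. h (vec_point (X n \<omega>)) \<partial>M) - 0) < e"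
    proof (intro exI[of _ "max n0 n1"] allI impI)
      fix n assume n: "n \<ge> max n0 n1"
      have "2 * B * (\<integral>\<omega>. ?c (vec_point (X n \<omega>)) \<partial>M) \<le> 2 * B * e'"
        using n1[of n] n B0 by (intro mult_left_mono) auto
      also have "\<dots> \<le> 2 * (B + 1) * e'" using e' by simp
      also have "\<dots> = e / 2"
      proof -
        have "2 * c * (e / (4 * c)) = e / 2" if "c > 0" for c using that by simp
        from this[of "B + 1"] show ?thesis using B0 by (simp only: e'_def)
      qed
      finally show "norm ((\<integral>\<omega>. g (vec_point (Y n \<omega>)) \<partial>M) - (\<integral>\<omega>. h (vec_point (X n \<omega>)) \<partial>M) - 0) < e"
        using main[of n] n e by simp
    qed
  qed
  show "(\<lambda>n. \<integral>\<omega>. g (vec_point (Y n \<omega>)) \<partial>M) \<longlonglongrightarrow> (\<integral>\<omega>. g (vec_point (L *\<^sub>v Z \<omega>)) \<partial>N)"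
    using tendsto_add[OF diff0 limh] by simp
qed

lemma normal_rv_cong:
  assumes eq: "\<And>\<omega>. \<omega> \<in> space M \<Longrightarrow> X \<omega> = Y \<omega>" and X: "normal_rv M X m v"
  shows "normal_rv M Y m v"
proof -
  have "X \<in> measurable M A \<longleftrightarrow> Y \<in> measurable M A" for A :: "real measure"
    using eq by (rule measurable_cong)
  moreover have "distr M lborel X = distr M lborel Y" using eq by (intro distr_cong) auto
  moreover have "(AE \<omega> in M. X \<omega> = m) \<longleftrightarrow> (AE \<omega> in M. Y \<omega> = m)"
    using eq by (intro AE_cong) simp
  ultimately show ?thesis using X unfolding normal_rv_def distributed_def by simp
qed

text \<open>Normality is defined through linear combinations, and a combination of
  \<open>L * Z\<close> with weights \<open>a\<close> is the combination of \<open>Z\<close> with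
  weights \<open>L^T * a\<close>.\<close>

lemma mv_normal_linear:
  assumes Z: "mv_normal N d Z (0\<^sub>v d) W" and L: "L \<in> carrier_mat k d"
    and rv: "rand_vec N k (\<lambda>\<omega>. L *\<^sub>v Z \<omega>)"
  shows "mv_normal N k (\<lambda>\<omega>. L *\<^sub>v Z \<omega>) (0\<^sub>v k) (L * W * L\<^sup>T)"
  unfolding mv_normal_def
proof (intro conjI ballI)
  have W: "W \<in> sym_mats d" using Z by (simp add: mv_normal_def)
  note Wc = sym_matsD(1)[OF W]
  note dims = carrier_matD[OF L] carrier_matD[OF Wc]
  show "rand_vec N k (\<lambda>\<omega>. L *\<^sub>v Z \<omega>)" by (rule rv)
  show "0\<^sub>v k \<in> carrier_vec k" by simp
  have c: "L * W * L\<^sup>T \<in> carrier_mat k k" by (rule carrier_matI) (simp_all add: dims)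
  moreover have "(L * W * L\<^sup>T)\<^sup>T = L * W * L\<^sup>T"
    by (simp add: transpose_mult_dim mult_mat_assoc_dim dims sym_matsD(2)[OF W])
  ultimately show "L * W * L\<^sup>T \<in> sym_mats k" unfolding sym_mats_def by blast
  fix a :: "real vec" assume a: "a \<in> carrier_vec k"
  define b where "b = L\<^sup>T *\<^sub>v a"
  have b: "b \<in> carrier_vec d" by (rule carrier_vecI) (simp add: b_def dims)
  have "normal_rv N (\<lambda>\<omega>. b \<bullet> Z \<omega>) (b \<bullet> 0\<^sub>v d) (b \<bullet> (W *\<^sub>v b))" using Z b by (simp add: mv_normal_def)
  moreover have "b \<bullet> 0\<^sub>v d = a \<bullet> 0\<^sub>v k" using a b by simp
  moreover have "b \<bullet> (W *\<^sub>v b) = a \<bullet> (L * W * L\<^sup>T *\<^sub>v a)"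
  proof -
    have "a \<bullet> (L *\<^sub>v (W *\<^sub>v b)) = b \<bullet> (W *\<^sub>v b)"
      unfolding b_def[symmetric]
      using scalar_prod_mult_mat_vec[OF L mult_mat_vec_carrier[OF Wc b] a] by (simp only: b_def)
    moreover have "L * W * L\<^sup>T *\<^sub>v a = L *\<^sub>v (W *\<^sub>v b)"
      by (simp add: b_def mult_mat_vec_assoc_dim dims carrier_vecD[OF a])
    ultimately show ?thesis by (simp only:)
  qed
  moreover have "b \<bullet> Z \<omega> = a \<bullet> (L *\<^sub>v Z \<omega>)" if "\<omega> \<in> space N" for \<omega>
  proof -
    have "Z \<omega> \<in> carrier_vec d" using Z that by (simp add: mv_normal_def rand_vec_def)
    from scalar_prod_mult_mat_vec[OF L this a] show ?thesis by (simp only: b_def)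
  qed
  ultimately show "normal_rv N (\<lambda>\<omega>. a \<bullet> (L *\<^sub>v Z \<omega>)) (a \<bullet> 0\<^sub>v k) (a \<bullet> (L * W * L\<^sup>T *\<^sub>v a))"
    using normal_rv_cong[of N "\<lambda>\<omega>. b \<bullet> Z \<omega>"] by metis
qed

section \<open>Limit laws\<close>

lemma det_measurable:
  fixes A :: "'a \<Rightarrow> real mat"
  assumes "\<And>\<omega>. \<omega> \<in> space M \<Longrightarrow> A \<omega> \<in> carrier_mat n n"
    and "\<And>i j. i < n \<Longrightarrow> j < n \<Longrightarrow> (\<lambda>\<omega>. A \<omega> $$ (i, j)) \<in> borel_measurable M"
  shows "(\<lambda>\<omega>. det (A \<omega>)) \<in> borel_measurable M"
proof -
  have "(\<lambda>\<omega>. \<Sum>\<pi>\<in>{\<pi>. \<pi> permutes {0..<n}}. signof \<pi> * (\<Prod>i\<in>{0..<n}. A \<omega> $$ (i, \<pi> i))) \<in> borel_measurable M"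
  proof (rule borel_measurable_sum)
    fix \<pi> assume "\<pi> \<in> {\<pi>. \<pi> permutes {0..<n}}"
    then have "\<pi> i < n" if "i < n" for i using that permutes_in_image[of \<pi> "{0..<n}" i] by simp
    then have "(\<lambda>\<omega>. \<Prod>i\<in>{0..<n}. A \<omega> $$ (i, \<pi> i)) \<in> borel_measurable M"
      by (intro borel_measurable_prod assms(2)) auto
    then show "(\<lambda>\<omega>. signof \<pi> * (\<Prod>i\<in>{0..<n}. A \<omega> $$ (i, \<pi> i))) \<in> borel_measurable M"
      by (rule borel_measurable_times[OF borel_measurable_const])
  qed
  then show ?thesis
    using det_def'[OF assms(1)] by (subst measurable_cong) (assumption | simp)+
qed

text \<open>By Cramer's rule each entry of the inverse is a quotient of determinants of measurable
  entries.\<close>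

lemma minv_index_measurable:
  assumes H: "rand_mat M p H" "\<And>\<omega>. \<omega> \<in> space M \<Longrightarrow> H \<omega> \<in> pd_mats p" and ij: "i < p" "j < p"
  shows "(\<lambda>\<omega>. minv (H \<omega>) $$ (i, j)) \<in> borel_measurable M"
proof -
  have c: "H \<omega> \<in> carrier_mat p p" if "\<omega> \<in> space M" for \<omega> using pd_mats_carrier[OF H(2)[OF that]] .
  have m: "(\<lambda>\<omega>. H \<omega> $$ (k, l)) \<in> borel_measurable M" if "k < p" "l < p" for k l
    using H(1) that by (simp add: rand_mat_def)
  have "(\<lambda>\<omega>. det (mat_delete (H \<omega>) j i)) \<in> borel_measurable M"
  proof (rule det_measurable)
    show "mat_delete (H \<omega>) j i \<in> carrier_mat (p - 1) (p - 1)" if "\<omega> \<in> space M" for \<omega>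
      by (rule mat_delete_carrier[OF c[OF that]])
    fix k l assume kl: "k < p - 1" "l < p - 1"
    let ?k = "if k < j then k else Suc k" and ?l = "if l < i then l else Suc l"
    have "?k < p" "?l < p" using kl by auto
    from m[OF this] show "(\<lambda>\<omega>. mat_delete (H \<omega>) j i $$ (k, l)) \<in> borel_measurable M"
      by (subst measurable_cong[where g = "\<lambda>\<omega>. H \<omega> $$ (?k, ?l)"])
        (use kl carrier_matD[OF c] in \<open>simp_all add: mat_delete_def\<close>)
  qed
  then have "(\<lambda>\<omega>. (-1) ^ (j + i) * det (mat_delete (H \<omega>) j i) / det (H \<omega>)) \<in> borel_measurable M"
    by (intro borel_measurable_divide borel_measurable_times borel_measurable_const det_measurable[OF c m])
  then show ?thesis
    using minv_cofactor[OF c pd_mats_nonsing[OF H(2)] ij]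
    by (subst measurable_cong[where g = "\<lambda>\<omega>. (-1) ^ (j + i) * det (mat_delete (H \<omega>) j i) / det (H \<omega>)"])
      (simp_all add: cofactor_def)
qed

text \<open>If the scaled entries are bounded by \<open>K\<close>, the norm of \<open>X\<close> is
  at most \<open>p * |K|\<close> over sqrt n, so the scaled quadratic error is of order 1/sqrt n.
  The choice of \<open>n0\<close> depends on the bound alone and not on \<open>X\<close>.\<close>

lemma remainder_small:
  fixes C \<delta> e K :: real
  assumes C: "C \<ge> 0" and \<delta>: "\<delta> > 0" and e: "e > 0"
  shows "\<exists>n0. \<forall>n\<ge>n0. \<forall>X\<in>carrier_mat p p. (\<forall>i<p * p. \<bar>(sqrt (real n) \<cdot>\<^sub>v vec_op X) $ i\<bar> \<le> K) \<longrightarrow>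
    fnorm p X \<le> \<delta> \<and> sqrt (real n) * (C * (fnorm p X)\<^sup>2) \<le> e"
proof -
  define b where "b = real p * \<bar>K\<bar>"
  have b: "b \<ge> 0" by (simp add: b_def)
  have "filterlim (\<lambda>n. sqrt (real n)) at_top sequentially"
    by (rule filterlim_compose[OF sqrt_at_top filterlim_real_sequentially])
  then have "eventually (\<lambda>n. max 1 (max (b / \<delta>) (C * b\<^sup>2 / e)) \<le> sqrt (real n)) sequentially"
    by (simp only: filterlim_at_top)
  then obtain n0 where n0: "\<And>n. n \<ge> n0 \<Longrightarrow> max 1 (max (b / \<delta>) (C * b\<^sup>2 / e)) \<le> sqrt (real n)"
    unfolding eventually_sequentially by blast
  show ?thesis
  proof (intro exI[of _ n0] allI impI ballI)
    fix n and X :: "real mat"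
    assume n: "n \<ge> n0" and X: "X \<in> carrier_mat p p"
      and bound: "\<forall>i<p * p. \<bar>(sqrt (real n) \<cdot>\<^sub>v vec_op X) $ i\<bar> \<le> K"
    define s where "s = sqrt (real n)"
    have s: "s \<ge> 1" "b / \<delta> \<le> s" "C * b\<^sup>2 / e \<le> s" using n0[OF n] by (auto simp: s_def)
    have "fnorm p X \<le> real p * (\<bar>K\<bar> / s)"
    proof (rule fnorm_le)
      fix i j assume ij: "i < p" "j < p"
      have "(s \<cdot>\<^sub>v vec_op X) $ (j * p + i) = s * X $$ (i, j)"
        using vec_idx_less[OF ij] carrier_matD[OF X] by (simp add: vec_op_index[OF X ij])
      then have "s * \<bar>X $$ (i, j)\<bar> \<le> K"
        using bound[rule_format, OF vec_idx_less[OF ij]] s(1) by (simp add: s_def[symmetric] abs_mult)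
      then have "s * \<bar>X $$ (i, j)\<bar> \<le> \<bar>K\<bar>" by linarith
      then show "\<bar>X $$ (i, j)\<bar> \<le> \<bar>K\<bar> / s" using s(1) by (simp add: pos_le_divide_eq mult.commute)
    qed (use s(1) in simp)
    then have f: "fnorm p X \<le> b / s" by (simp add: b_def)
    have "b / s \<le> \<delta>" using s(1,2) \<delta> by (simp add: pos_divide_le_eq mult.commute)
    then have "fnorm p X \<le> \<delta>" using f by linarith
    moreover have "s * (C * (fnorm p X)\<^sup>2) \<le> e"
    proof -
      have "s * (C * (fnorm p X)\<^sup>2) \<le> s * (C * (b / s)\<^sup>2)"
        using s(1) C f fnorm_ge_0[of p X] by (intro mult_left_mono power_mono) auto
      also have "\<dots> = C * b\<^sup>2 / s" using s(1) by (simp add: power2_eq_square)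
      also have "\<dots> \<le> e" using s(1,3) e by (simp add: pos_divide_le_eq mult.commute)
      finally show ?thesis .
    qed
    ultimately show "fnorm p X \<le> \<delta> \<and> sqrt (real n) * (C * (fnorm p X)\<^sup>2) \<le> e" by (simp add: s_def)
  qed
qed

text \<open>Positive definiteness of \<open>V + X\<close> is part of the conclusion because the
  estimator is tied to the completion only where the sample matrix is positive definite.\<close>

lemma hG_remainder:
  fixes e K :: real and E :: "nat set set"
  assumes V: "V \<in> pd_mats p" and e: "e > 0"
  defines "P \<equiv> minv (hG p E V)"
  shows "\<exists>n0. \<forall>n\<ge>n0. \<forall>X\<in>sym_mats p. (\<forall>i<p * p. \<bar>(sqrt (real n) \<cdot>\<^sub>v vec_op X) $ i\<bar> \<le> K) \<longrightarrow>
    V + X \<in> pd_mats p \<and> (\<forall>i<p. \<forall>j<p.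
      \<bar>sqrt (real n) * (hG p E (V + X) - hG p E V - lin_map p E P X) $$ (i, j)\<bar> \<le> e \<and>
      \<bar>sqrt (real n) * (minv (hG p E (V + X)) - P + P * lin_map p E P X * P) $$ (i, j)\<bar> \<le> e)"
proof -
  obtain C \<delta> where C: "C \<ge> 0" "\<delta> > 0"
    and pd: "\<And>X. X \<in> sym_mats p \<Longrightarrow> fnorm p X \<le> \<delta> \<Longrightarrow> V + X \<in> pd_mats p"
    and b1: "\<And>X. X \<in> sym_mats p \<Longrightarrow> fnorm p X \<le> \<delta> \<Longrightarrow>
      fnorm p (hG p E (V + X) - hG p E V - lin_map p E P X) \<le> C * (fnorm p X)\<^sup>2"
    and b2: "\<And>X. X \<in> sym_mats p \<Longrightarrow> fnorm p X \<le> \<delta> \<Longrightarrow>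
      fnorm p (minv (hG p E (V + X)) - P + P * lin_map p E P X * P) \<le> C * (fnorm p X)\<^sup>2"
    unfolding P_def by (rule hG_expansion[OF V, of E]) blast
  obtain n0 where n0: "\<And>n X. n \<ge> n0 \<Longrightarrow> X \<in> carrier_mat p p \<Longrightarrow>
      (\<forall>i<p * p. \<bar>(sqrt (real n) \<cdot>\<^sub>v vec_op X) $ i\<bar> \<le> K) \<Longrightarrow>
      fnorm p X \<le> \<delta> \<and> sqrt (real n) * (C * (fnorm p X)\<^sup>2) \<le> e"
    using remainder_small[OF C e, of p K] by blast
  have entry: "\<bar>sqrt (real n) * A $$ (i, j)\<bar> \<le> e"
    if "fnorm p A \<le> c" "sqrt (real n) * c \<le> e" "i < p" "j < p" for A i j n c
  proof -
    have "\<bar>sqrt (real n) * A $$ (i, j)\<bar> = sqrt (real n) * \<bar>A $$ (i, j)\<bar>" by (simp add: abs_mult)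
    also have "\<dots> \<le> sqrt (real n) * c"
      using abs_index_le_fnorm[OF that(3,4), of A] that(1) by (intro mult_left_mono) auto
    finally show ?thesis using that(2) by linarith
  qed
  show ?thesis
  proof (intro exI[of _ n0] allI ballI impI)
    fix n X assume n: "n \<ge> n0" and X: "X \<in> sym_mats p"
      and bound: "\<forall>i<p * p. \<bar>(sqrt (real n) \<cdot>\<^sub>v vec_op X) $ i\<bar> \<le> K"
    note s = n0[OF n sym_matsD(1)[OF X] bound]
    show "V + X \<in> pd_mats p \<and> (\<forall>i<p. \<forall>j<p.
      \<bar>sqrt (real n) * (hG p E (V + X) - hG p E V - lin_map p E P X) $$ (i, j)\<bar> \<le> e \<and>
      \<bar>sqrt (real n) * (minv (hG p E (V + X)) - P + P * lin_map p E P X * P) $$ (i, j)\<bar> \<le> e)"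
      using pd[OF X] entry[OF b1[OF X]] entry[OF b2[OF X]] s by blast
  qed
qed

lemma rand_vec_scaled_vec_op:
  assumes H: "rand_mat M p H" and A: "A \<in> carrier_mat p p"
  shows "rand_vec M (p * p) (\<lambda>\<omega>. c \<cdot>\<^sub>v vec_op (H \<omega> - A))"
  unfolding rand_vec_def
proof (intro conjI ballI allI impI)
  note dA = carrier_matD[OF A]
  show "c \<cdot>\<^sub>v vec_op (H \<omega> - A) \<in> carrier_vec (p * p)" for \<omega>
    by (rule carrier_vecI) (simp add: dA)
  fix k assume k: "k < p * p"
  have e: "(c \<cdot>\<^sub>v vec_op (H \<omega> - A)) $ k = c * (H \<omega> $$ (k mod p, k div p) - A $$ (k mod p, k div p))" for \<omega>
    using k idx_div_mod_less[OF k] by (simp add: vec_op_def dA)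
  have "(\<lambda>\<omega>. H \<omega> $$ (k mod p, k div p)) \<in> borel_measurable M"
    using H idx_div_mod_less[OF k] by (simp add: rand_mat_def)
  then show "(\<lambda>\<omega>. (c \<cdot>\<^sub>v vec_op (H \<omega> - A)) $ k) \<in> borel_measurable M"
    unfolding e by (intro borel_measurable_times borel_measurable_diff borel_measurable_const)
qed

lemma uminus_sandwich:
  fixes A W :: "real mat"
  assumes "dim_col A = dim_row W" "dim_row W = dim_col W"
  shows "- A * W * (- A)\<^sup>T = A * W * A\<^sup>T"
  using assms by (simp add: transpose_uminus uminus_uminus_mat)

text \<open>\<open>H n\<close> stands for the completed estimator: it is the completion where
  \<open>Vhat n\<close> is positive definite and a measurable positive definite choice elsewhere.
  The limit in the last part is realized by a linear image \<open>Y\<close> of \<open>Z\<close>, so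
  no normal vector has to be constructed.\<close>

theorem theorem2:
  fixes p :: nat and E :: "nat set set"
    and M :: "'a measure" and N :: "'b measure"
    and V :: "real mat" and Vhat H :: "nat \<Rightarrow> 'a \<Rightarrow> real mat" and Z :: "'b \<Rightarrow> real vec"
    and \<sigma>1 \<sigma>2 :: real
  assumes p: "p \<ge> 1"
    and G: "simple_graph p E"
    and M: "prob_space M" and N: "prob_space N"
    and V: "V \<in> pd_mats p"
    and Vhat: "\<And>n. rand_mat M p (Vhat n)" "\<And>n \<omega>. \<omega> \<in> space M \<Longrightarrow> Vhat n \<omega> \<in> sym_mats p"
    and H: "\<And>n. rand_mat M p (H n)" "\<And>n \<omega>. \<omega> \<in> space M \<Longrightarrow> H n \<omega> \<in> pd_mats p"
      "\<And>n \<omega>. \<omega> \<in> space M \<Longrightarrow> Vhat n \<omega> \<in> pd_mats p \<Longrightarrow> H n \<omega> = hG p E (Vhat n \<omega>)"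
    and conv: "conv_distr (p * p) M (\<lambda>n \<omega>. sqrt (real n) \<cdot>\<^sub>v vec_op (Vhat n \<omega> - V)) N Z"
  shows
    "conv_distr (p * p) M (\<lambda>n \<omega>. sqrt (real n) \<cdot>\<^sub>v vec_op (H n \<omega> - hG p E V))
        N (\<lambda>\<omega>. DhG p E V *\<^sub>v Z \<omega>) \<and>
     (\<sigma>1 \<ge> 0 \<and> \<sigma>2 \<ge> - 2 * \<sigma>1 / real p \<and> mv_normal N (p * p) Z (0\<^sub>v (p * p)) (W_V p \<sigma>1 \<sigma>2 V) \<longrightarrow>
        mv_normal N (p * p) (\<lambda>\<omega>. DhG p E V *\<^sub>v Z \<omega>) (0\<^sub>v (p * p)) (W_VG p E \<sigma>1 \<sigma>2 V) \<and>
        (minv V \<in> pd_mats_graph p E \<longleftrightarrow> V = hG p E V) \<and>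
        (minv V \<in> pd_mats_graph p E \<longrightarrow>
           W_VG p E \<sigma>1 \<sigma>2 V =
             (2 * \<sigma>1) \<cdot>\<^sub>m (M_mat p * (kron V V - (QD p E)\<^sup>T
                 * minv (QD p E * M_mat p * kron (minv V) (minv V) * (QD p E)\<^sup>T)
                 * QD p E * M_mat p))
             + \<sigma>2 \<cdot>\<^sub>m outer_prod (vec_op V) (vec_op V) \<and>
           (\<exists>Y. mv_normal N (half_dim p - num_absent p E) Y
                  (0\<^sub>v (half_dim p - num_absent p E)) (W_uG p E \<sigma>1 \<sigma>2 V) \<and>
                conv_distr (half_dim p - num_absent p E) M
                  (\<lambda>n \<omega>. sqrt (real n) \<cdot>\<^sub>v
                     (QK p E *\<^sub>v vec_op (minv (H n \<omega>)) - QK p E *\<^sub>v vec_op (minv V))) N Y)))"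
proof -
  let ?X = "\<lambda>n \<omega>. sqrt (real n) \<cdot>\<^sub>v vec_op (Vhat n \<omega> - V)"
  define B where "B = hG p E V"
  define P where "P = minv B"
  define L where "L = DhG p E V"
  have B: "B \<in> pd_mats p" unfolding B_def by (rule hG_pd[OF V])
  have P: "P \<in> pd_mats p" unfolding P_def by (rule minv_pd_mats[OF B])
  note Vc = pd_mats_carrier[OF V] and Bc = pd_mats_carrier[OF B] and Pc = pd_mats_carrier[OF P]
  note dims = carrier_matD[OF Vc] carrier_matD[OF Bc] carrier_matD[OF Pc]
  have L_lin: "L = lin_mat p E P" by (simp only: L_def P_def B_def DhG_eq_lin_mat[OF V])
  have L: "L \<in> carrier_mat (p * p) (p * p)"
    by (rule carrier_matI) (simp_all only: L_lin lin_mat_dim[OF P])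
  have Xs: "Vhat n \<omega> - V \<in> sym_mats p" if "\<omega> \<in> space M" for n \<omega>
    by (rule sub_sym_mats[OF Vhat(2)[OF that] pd_mats_sym[OF V]])
  have VX: "V + (Vhat n \<omega> - V) = Vhat n \<omega>" if "\<omega> \<in> space M" for n \<omega>
    using carrier_matD[OF sym_matsD(1)[OF Vhat(2)[OF that]]] by (intro eq_matI) (simp_all add: dims)
  have Hc: "H n \<omega> \<in> carrier_mat p p" if "\<omega> \<in> space M" for n \<omega> by (rule pd_mats_carrier[OF H(2)[OF that]])
  have LX: "L *\<^sub>v ?X n \<omega> = sqrt (real n) \<cdot>\<^sub>v vec_op (lin_map p E P (Vhat n \<omega> - V))" if "\<omega> \<in> space M" for n \<omega>
    unfolding vec_op_lin_map[OF P sym_matsD(1)[OF Xs[OF that]]] L_lin[symmetric]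
    by (rule mult_mat_vec[OF L vec_op_carrier[OF sym_matsD(1)[OF Xs[OF that]]]])
  \<comment> \<open>Uniform in \<omega>: for large \<open>n\<close>, a bound on the scaled deviation
    at \<omega> forces \<open>Vhat n \<omega>\<close> to be positive definite, so
    \<open>H n \<omega>\<close> is the completion there and the deterministic expansion applies. The
    exceptional \<omega> are left to the tail estimate in \<open>conv_distr_delta\<close>.\<close>
  have remainder: "\<exists>n0. \<forall>n\<ge>n0. \<forall>\<omega>\<in>space M. (\<forall>i<p * p. \<bar>?X n \<omega> $ i\<bar> \<le> K) \<longrightarrow> (\<forall>i<p. \<forall>j<p.
      \<bar>sqrt (real n) * (H n \<omega> - B - lin_map p E P (Vhat n \<omega> - V)) $$ (i, j)\<bar> \<le> e \<and>
      \<bar>sqrt (real n) * (minv (H n \<omega>) - P + P * lin_map p E P (Vhat n \<omega> - V) * P) $$ (i, j)\<bar> \<le> e)"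
    if e: "e > 0" for e K :: real
  proof -
    obtain n0 where n0: "\<And>n X. n \<ge> n0 \<Longrightarrow> X \<in> sym_mats p \<Longrightarrow>
      (\<forall>i<p * p. \<bar>(sqrt (real n) \<cdot>\<^sub>v vec_op X) $ i\<bar> \<le> K) \<Longrightarrow>
      V + X \<in> pd_mats p \<and> (\<forall>i<p. \<forall>j<p.
      \<bar>sqrt (real n) * (hG p E (V + X) - B - lin_map p E P X) $$ (i, j)\<bar> \<le> e \<and>
      \<bar>sqrt (real n) * (minv (hG p E (V + X)) - P + P * lin_map p E P X * P) $$ (i, j)\<bar> \<le> e)"
      using hG_remainder[OF V e, where E = E and K = K, folded B_def, folded P_def] by blast
    show ?thesis
    proof (intro exI[of _ n0] allI ballI impI)
      fix n \<omega> i j assume n: "n \<ge> n0" and \<omega>: "\<omega> \<in> space M"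
        and b: "\<forall>i<p * p. \<bar>?X n \<omega> $ i\<bar> \<le> K" and ij: "i < p" "j < p"
      note r = n0[OF n Xs[OF \<omega>] b, unfolded VX[OF \<omega>]]
      have "H n \<omega> = hG p E (Vhat n \<omega>)" using H(3)[OF \<omega>] r by blast
      then show "\<bar>sqrt (real n) * (H n \<omega> - B - lin_map p E P (Vhat n \<omega> - V)) $$ (i, j)\<bar> \<le> e \<and>
        \<bar>sqrt (real n) * (minv (H n \<omega>) - P + P * lin_map p E P (Vhat n \<omega> - V) * P) $$ (i, j)\<bar> \<le> e"
        using r ij by simp
    qed
  qed
  have I: "conv_distr (p * p) M (\<lambda>n \<omega>. sqrt (real n) \<cdot>\<^sub>v vec_op (H n \<omega> - B)) N (\<lambda>\<omega>. L *\<^sub>v Z \<omega>)"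
  proof (rule conv_distr_delta[OF M N conv L])
    show "rand_vec M (p * p) (\<lambda>\<omega>. sqrt (real n) \<cdot>\<^sub>v vec_op (H n \<omega> - B))" for n
      by (rule rand_vec_scaled_vec_op[OF H(1) Bc])
    fix K e :: real assume "e > 0"
    from remainder[OF this, of K] obtain n0 where n0: "\<And>n \<omega> i j. n \<ge> n0 \<Longrightarrow> \<omega> \<in> space M \<Longrightarrow>
      (\<forall>i<p * p. \<bar>?X n \<omega> $ i\<bar> \<le> K) \<Longrightarrow> i < p \<Longrightarrow> j < p \<Longrightarrow>
      \<bar>sqrt (real n) * (H n \<omega> - B - lin_map p E P (Vhat n \<omega> - V)) $$ (i, j)\<bar> \<le> e" by blast
    show "\<exists>n0. \<forall>n\<ge>n0. \<forall>\<omega>\<in>space M. (\<forall>i<p * p. \<bar>?X n \<omega> $ i\<bar> \<le> K) \<longrightarrow>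
      (\<forall>i<p * p. \<bar>(sqrt (real n) \<cdot>\<^sub>v vec_op (H n \<omega> - B)) $ i - (L *\<^sub>v ?X n \<omega>) $ i\<bar> \<le> e)"
    proof (intro exI[of _ n0] allI ballI impI)
      fix n \<omega> k assume n: "n \<ge> n0" and \<omega>: "\<omega> \<in> space M"
        and b: "\<forall>i<p * p. \<bar>?X n \<omega> $ i\<bar> \<le> K" and k: "k < p * p"
      define T where "T = lin_map p E P (Vhat n \<omega> - V)"
      have dT: "dim_row T = p" "dim_col T = p" unfolding T_def by (rule carrier_matD[OF lin_map_carrier])+
      note d = idx_div_mod_less[OF k]
      have "(sqrt (real n) \<cdot>\<^sub>v vec_op (H n \<omega> - B)) $ k - (sqrt (real n) \<cdot>\<^sub>v vec_op T) $ k
        = sqrt (real n) * (H n \<omega> - B - T) $$ (k mod p, k div p)"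
        using k d by (simp add: vec_op_def dims dT right_diff_distrib)
      then show "\<bar>(sqrt (real n) \<cdot>\<^sub>v vec_op (H n \<omega> - B)) $ k - (L *\<^sub>v ?X n \<omega>) $ k\<bar> \<le> e"
        using n0[OF n \<omega> b d(1,2)] unfolding LX[OF \<omega>] T_def by (simp only:)
    qed
  qed
  have II: "mv_normal N (p * p) (\<lambda>\<omega>. L *\<^sub>v Z \<omega>) (0\<^sub>v (p * p)) (W_VG p E \<sigma>1 \<sigma>2 V)"
    if Zn: "mv_normal N (p * p) Z (0\<^sub>v (p * p)) (W_V p \<sigma>1 \<sigma>2 V)"
  proof -
    have "rand_vec N (p * p) (\<lambda>\<omega>. L *\<^sub>v Z \<omega>)" using I by (simp only: conv_distr_def)
    from mv_normal_linear[OF Zn L this] show ?thesis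
      by (simp only: L_def lin_mat_W_V[OF V])
  qed
  have III: "W_VG p E \<sigma>1 \<sigma>2 V =
             (2 * \<sigma>1) \<cdot>\<^sub>m (M_mat p * (kron V V - (QD p E)\<^sup>T
                 * minv (QD p E * M_mat p * kron (minv V) (minv V) * (QD p E)\<^sup>T)
                 * QD p E * M_mat p))
             + \<sigma>2 \<cdot>\<^sub>m outer_prod (vec_op V) (vec_op V)" if "V = B"
  proof -
    have VB: "hG p E V = V" and PV: "P = minv V" unfolding P_def B_def[symmetric] using that by simp_all
    show ?thesis
      \<comment> \<open>At a fixed point of the completion the derivative is \<open>lin_mat\<close>
        at the inverse of \<open>V\<close> itself, so the sandwich formula applies directly.\<close>
      unfolding W_VG_def L_def[symmetric] L_lin PV lin_mat_sandwich[OF V] VB Schur_D_def ..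
  qed
  have IV: "\<exists>Y. mv_normal N (half_dim p - num_absent p E) Y
                  (0\<^sub>v (half_dim p - num_absent p E)) (W_uG p E \<sigma>1 \<sigma>2 V) \<and>
                conv_distr (half_dim p - num_absent p E) M
                  (\<lambda>n \<omega>. sqrt (real n) \<cdot>\<^sub>v
                     (QK p E *\<^sub>v vec_op (minv (H n \<omega>)) - QK p E *\<^sub>v vec_op (minv V))) N Y"
    if Zn: "mv_normal N (p * p) Z (0\<^sub>v (p * p)) (W_V p \<sigma>1 \<sigma>2 V)" and "V = B"
  proof -
    have VB: "V = hG p E V" and PV: "minv V = P" unfolding P_def B_def[symmetric] using that(2) by simp_all
    let ?r = "npos p (K_set p E)"
    define R where "R = QK p E * kron P P"
    have R: "R \<in> carrier_mat ?r (p * p)" unfolding R_def by (rule carrier_matI) (simp_all add: dims)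
    note dR = carrier_matD[OF R] and dL = carrier_matD[OF L]
    \<comment> \<open>The linear part for the precision entries: inversion has differential
      \<open>X\<close> to \<open>- P * X * P\<close>, whose vectorized selection is
      \<open>- R\<close>, applied after the derivative \<open>L\<close> of the completion.\<close>
    have RL: "- (R * L) \<in> carrier_mat ?r (p * p)" by (rule carrier_matI) (simp_all add: dR dL)
    let ?Y = "\<lambda>n \<omega>. sqrt (real n) \<cdot>\<^sub>v (QK p E *\<^sub>v vec_op (minv (H n \<omega>)) - QK p E *\<^sub>v vec_op P)"
    have mc: "minv (H n \<omega>) \<in> carrier_mat p p" if "\<omega> \<in> space M" for n \<omega>
      by (rule pd_mats_minv(1)[OF H(2) H(2)]; rule that)
    have Y_index: "?Y n \<omega> $ k = sqrt (real n) * (minv (H n \<omega>) $$ (positions p (K_set p E) ! k) - P $$ (positions p (K_set p E) ! k))"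
      if "\<omega> \<in> space M" "k < ?r" for n \<omega> k
      using that(2) sel_mat_vec_op[OF mc[OF that(1)] that(2)] sel_mat_vec_op[OF Pc that(2)]
      by (simp add: QK_def del: index_mult_mat_vec)
    have conv_Y: "conv_distr ?r M ?Y N (\<lambda>\<omega>. - (R * L) *\<^sub>v Z \<omega>)"
    proof (rule conv_distr_delta[OF M N conv RL])
      show "rand_vec M ?r (?Y n)" for n
        unfolding rand_vec_def
      proof (intro conjI ballI allI impI)
        show "?Y n \<omega> \<in> carrier_vec ?r" for \<omega> by (rule carrier_vecI) simp
        fix k assume k: "k < ?r"
        obtain i j where z: "positions p (K_set p E) ! k = (i, j)" "i < p" "j < p"
          using positions_nth[OF k] by (cases "positions p (K_set p E) ! k") auto
        have "(\<lambda>\<omega>. sqrt (real n) * (minv (H n \<omega>) $$ (i, j) - P $$ (i, j))) \<in> borel_measurable M"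
          by (intro borel_measurable_times borel_measurable_diff borel_measurable_const
              minv_index_measurable[OF H(1,2) z(2,3)])
        then show "(\<lambda>\<omega>. ?Y n \<omega> $ k) \<in> borel_measurable M"
          using Y_index[OF _ k, of _ n] unfolding z(1)
          by (subst measurable_cong[where g = "\<lambda>\<omega>. sqrt (real n) * (minv (H n \<omega>) $$ (i, j) - P $$ (i, j))"])
      qed
      fix K e :: real assume "e > 0"
      from remainder[OF this, of K] obtain n0 where n0: "\<And>n \<omega> i j. n \<ge> n0 \<Longrightarrow> \<omega> \<in> space M \<Longrightarrow>
        (\<forall>i<p * p. \<bar>?X n \<omega> $ i\<bar> \<le> K) \<Longrightarrow> i < p \<Longrightarrow> j < p \<Longrightarrow>
        \<bar>sqrt (real n) * (minv (H n \<omega>) - P + P * lin_map p E P (Vhat n \<omega> - V) * P) $$ (i, j)\<bar> \<le> e" by blast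
      show "\<exists>n0. \<forall>n\<ge>n0. \<forall>\<omega>\<in>space M. (\<forall>i<p * p. \<bar>?X n \<omega> $ i\<bar> \<le> K) \<longrightarrow>
        (\<forall>i<?r. \<bar>?Y n \<omega> $ i - (- (R * L) *\<^sub>v ?X n \<omega>) $ i\<bar> \<le> e)"
      proof (intro exI[of _ n0] allI ballI impI)
        fix n \<omega> k assume n: "n \<ge> n0" and \<omega>: "\<omega> \<in> space M"
          and b: "\<forall>i<p * p. \<bar>?X n \<omega> $ i\<bar> \<le> K" and k: "k < ?r"
        define T where "T = lin_map p E P (Vhat n \<omega> - V)"
        have T: "T \<in> carrier_mat p p" by (simp add: T_def)
        have W: "P * T * P \<in> carrier_mat p p" by (rule carrier_matI) (simp_all add: dims)
        obtain i j where z: "positions p (K_set p E) ! k = (i, j)" "i < p" "j < p"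
          using positions_nth[OF k] by (cases "positions p (K_set p E) ! k") auto
        have dX: "dim_vec (?X n \<omega>) = p * p" by (simp add: dims)
        have "(R * L) *\<^sub>v ?X n \<omega> = R *\<^sub>v (sqrt (real n) \<cdot>\<^sub>v vec_op T)"
          unfolding T_def LX[OF \<omega>, symmetric]
          by (rule mult_mat_vec_assoc_dim) (simp_all only: dR dL dX)
        also have "\<dots> = sqrt (real n) \<cdot>\<^sub>v (R *\<^sub>v vec_op T)" by (rule mult_mat_vec[OF R vec_op_carrier[OF T]])
        also have "R *\<^sub>v vec_op T = QK p E *\<^sub>v (kron P P *\<^sub>v vec_op T)"
          unfolding R_def using carrier_matD[OF T] by (intro mult_mat_vec_assoc_dim) (simp_all add: dims)
        also have "kron P P *\<^sub>v vec_op T = vec_op (P * T * P)" by (rule kron_sandwich[OF pd_mats_sym[OF P] T])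
        finally have RLX: "(R * L) *\<^sub>v ?X n \<omega> = sqrt (real n) \<cdot>\<^sub>v (QK p E *\<^sub>v vec_op (P * T * P))" .
        have "(- (R * L) *\<^sub>v ?X n \<omega>) $ k = - (((R * L) *\<^sub>v ?X n \<omega>) $ k)"
        proof -
          have "- (R * L) *\<^sub>v ?X n \<omega> = - ((R * L) *\<^sub>v ?X n \<omega>)"
            by (rule uminus_mult_mat_vec) (simp only: dX dL index_mult_mat)
          then show ?thesis using k by (simp only: index_uminus_vec(1) dim_mult_mat_vec index_mult_mat(2) dR)
        qed
        also have "\<dots> = - (sqrt (real n) * (P * T * P) $$ (i, j))"
          unfolding RLX using k sel_mat_vec_op[OF W k]
          by (simp add: QK_def z(1) del: index_mult_mat_vec index_mult_mat(1) assoc_mult_mat)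
        finally have "?Y n \<omega> $ k - (- (R * L) *\<^sub>v ?X n \<omega>) $ k
          = sqrt (real n) * (minv (H n \<omega>) $$ (i, j) - P $$ (i, j) + (P * T * P) $$ (i, j))"
          unfolding Y_index[OF \<omega> k] z(1) by (simp only: distrib_left diff_minus_eq_add)
        also have "minv (H n \<omega>) $$ (i, j) - P $$ (i, j) + (P * T * P) $$ (i, j)
          = (minv (H n \<omega>) - P + P * T * P) $$ (i, j)"
          using z(2,3) carrier_matD[OF W] carrier_matD[OF mc[OF \<omega>]]
          by (simp add: dims del: index_mult_mat(1) assoc_mult_mat)
        finally show "\<bar>?Y n \<omega> $ k - (- (R * L) *\<^sub>v ?X n \<omega>) $ k\<bar> \<le> e"
          using n0[OF n \<omega> b z(2,3)] unfolding T_def by (simp only:)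
      qed
    qed
    then have "rand_vec N ?r (\<lambda>\<omega>. - (R * L) *\<^sub>v Z \<omega>)" by (simp only: conv_distr_def)
    from mv_normal_linear[OF Zn RL this]
    have "mv_normal N ?r (\<lambda>\<omega>. - (R * L) *\<^sub>v Z \<omega>) (0\<^sub>v ?r) (- (R * L) * W_V p \<sigma>1 \<sigma>2 V * (- (R * L))\<^sup>T)" .
    also have "- (R * L) * W_V p \<sigma>1 \<sigma>2 V * (- (R * L))\<^sup>T = R * (L * W_V p \<sigma>1 \<sigma>2 V * L\<^sup>T) * R\<^sup>T"
    proof -
      have dW: "dim_row (W_V p \<sigma>1 \<sigma>2 V) = p * p" "dim_col (W_V p \<sigma>1 \<sigma>2 V) = p * p"
        by (simp_all add: W_V_def dims)
      \<comment> \<open>The sign from inverting matrices occurs on both sides of the covariance and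
        cancels.\<close>
      have "- (R * L) * W_V p \<sigma>1 \<sigma>2 V * (- (R * L))\<^sup>T = (R * L) * W_V p \<sigma>1 \<sigma>2 V * (R * L)\<^sup>T"
        using uminus_sandwich[of "R * L" "W_V p \<sigma>1 \<sigma>2 V"] by (simp only: dW dL index_mult_mat)
      also have "\<dots> = R * (L * W_V p \<sigma>1 \<sigma>2 V * L\<^sup>T) * R\<^sup>T"
        by (simp add: transpose_mult_dim mult_mat_assoc_dim dR dL dW)
      finally show ?thesis .
    qed
    also have "L * W_V p \<sigma>1 \<sigma>2 V * L\<^sup>T = W_VG p E \<sigma>1 \<sigma>2 V" by (simp only: L_def lin_mat_W_V[OF V])
    also have "R * W_VG p E \<sigma>1 \<sigma>2 V * R\<^sup>T = W_uG p E \<sigma>1 \<sigma>2 V"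
      using W_uG_eq[OF V VB] by (simp only: R_def PV)
    finally show ?thesis using conv_Y unfolding length_K_positions PV by blast
  qed
  show ?thesis
    using I II III IV minv_graph_iff_hG_fixed[OF V, of E] unfolding L_def B_def by blast
qed

end
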